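(* Let $\mathbf X$ be a Euclidean space and let $f:\mathbf X\to[-\infty,+\infty]$ be prox-regular and subdifferentially continuous at $\bar x$ for $\bar v=0$. Then the following properties are equivalent: (a) The point $\bar x$ is a tilt-stable local minimizer of $f$. (b) For any $w\in\mathbf X\setminus\{0\}$ and any $q\in\mathrm{quad}\,f(\bar x,\bar v)$, we have $q(w)>0$.
   Context: Euclidean spaces are finite-dimensional; $\mathbb B_r(z)$ is the closed ball of radius $r$ centered at $z$. $\partial f$ is the limiting (Mordukhovich) subdifferential and $\mathrm{gph}\,\partial f=\{(x,v): v\in\partial f(x)\}$. Prox-regularity: $f$ is prox-regular at $\bar x$ for $\bar v$ if $f$ is finite at $\bar x$ and locally lower semicontinuous around $\bar x$ with $\bar v\in\partial f(\bar x)$, and there exist $\varepsilon>0$, $r\ge0$ such that $f(x')\ge f(x)+\langle v,x'-x\rangle-\frac r2\|x'-x\|^2$ for all $x'\in\mathbb B_\varepsilon(\bar x)$ whenever $(x,v)\in(\mathrm{gph}\,\partial f)\cap\mathbb B_\varepsilon(\bar x,\bar v)$ with $f(x)<f(\bar x)+\varepsilon$. Subdifferential continuity: $f$ is subdifferentially continuous at $\bar x$ for $\bar v$ if $(x^k,v^k)\to(\bar x,\bar v)$ with $v^k\in\partial f(x^k)$ implies $f(x^k)\to f(\bar x)$. Second subderivative: $\mathrm d^2f(x,v)(w)=\liminf_{t\searrow0,\,u\to w}\dfrac{f(x+tu)-f(x)-t\langle v,u\rangle}{\frac12t^2}$. GQF: a proper function $\varphi:\mathbf X\to[-\infty,+\infty]$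 is a generalized quadratic form (GQF) if $\mathrm{dom}\,\varphi$ is a linear subspace and there is a linear operator $L:\mathrm{dom}\,\varphi\to\mathbf X$ with $\langle Lx,y\rangle=\langle x,Ly\rangle$ for all $x,y\in\mathrm{dom}\,\varphi$ such that $\varphi(x)=\langle Lx,x\rangle$ for all $x\in\mathrm{dom}\,\varphi$. Quadratic bundle: $\mathrm{quad}\,f(\bar x,\bar v)$ is the set of all GQFs $q$ on $\mathbf X$ for which there is a sequence $(x^k,v^k)\in\mathrm{gph}\,\partial f$ with $(x^k,v^k)\to(\bar x,\bar v)$, with $\mathrm d^2f(x^k,v^k)$ a GQF for each $k$, and such that $\mathrm d^2f(x^k,v^k)$ epi-converges to $q$ (the epigraphs converge in the Painlevé–Kuratowski sense). Tilt stability: $\bar x$ is a tilt-stable local minimizer of $f$ if $f(\bar x)$ is finite and there is $\gamma>0$ such that the mapping $M_\gamma: v\mapsto\operatorname{argmin}\{f(x)-\langle v,x\rangle : x\in\mathbb B_\gamma(\bar x)\}$ is single-valued and Lipschitz continuous on a neighborhood of $0$, with $M_\gamma(0)=\{\bar x\}$. *)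

theory Defs
  imports "HOL-Analysis.Analysis"
begin

definition domain :: "('a \<Rightarrow> ereal) \<Rightarrow> 'a set" where
  "domain f = {x. f x < \<infinity>}"

definition proper :: "('a \<Rightarrow> ereal) \<Rightarrow> bool" where
  "proper f \<longleftrightarrow> domain f \<noteq> {} \<and> (\<forall>x. f x \<noteq> - \<infinity>)"

definition epi :: "('a \<Rightarrow> ereal) \<Rightarrow> ('a \<times> real) set" where
  "epi f = {(x, \<alpha>). f x \<le> ereal \<alpha>}"

text \<open>Local lower semicontinuity at a point, in the sense of Rockafellar and Wets (Variational
  Analysis, Definition 1.33). It holds in particular if \<open>f\<close> is finite at \<open>x\<close> and lower
  semicontinuous on a neighbourhood of \<open>x\<close>.\<close>

definition locally_lsc_at :: "('a::euclidean_space \<Rightarrow> ereal) \<Rightarrow> 'a \<Rightarrow> bool" where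
  "locally_lsc_at f x \<longleftrightarrow>
     \<bar>f x\<bar> \<noteq> \<infinity> \<and>
     (\<exists>\<epsilon>>0. \<forall>\<alpha>. ereal \<alpha> \<le> f x + ereal \<epsilon> \<longrightarrow> closed {y \<in> cball x \<epsilon>. f y \<le> ereal \<alpha>})"

text \<open>The regular (Frechet) subdifferential, and the limiting (Mordukhovich) subdifferential
  obtained from it by \<open>f\<close>-attentive limits. Both are empty where \<open>f\<close> is not finite.\<close>

definition regular_subdiff :: "('a::euclidean_space \<Rightarrow> ereal) \<Rightarrow> 'a \<Rightarrow> 'a set" where
  "regular_subdiff f x =
     {v. \<bar>f x\<bar> \<noteq> \<infinity> \<and>
         Liminf (at x) (\<lambda>y. (f y - f x - ereal (v \<bullet> (y - x))) / ereal (norm (y - x))) \<ge> 0}"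

definition limiting_subdiff :: "('a::euclidean_space \<Rightarrow> ereal) \<Rightarrow> 'a \<Rightarrow> 'a set" where
  "limiting_subdiff f x =
     {v. \<bar>f x\<bar> \<noteq> \<infinity> \<and>
         (\<exists>xs vs. xs \<longlonglongrightarrow> x \<and> (\<lambda>k. f (xs k)) \<longlonglongrightarrow> f x \<and> vs \<longlonglongrightarrow> v \<and>
                  (\<forall>k. vs k \<in> regular_subdiff f (xs k)))}"

definition gph_subdiff :: "('a::euclidean_space \<Rightarrow> ereal) \<Rightarrow> ('a \<times> 'a) set" where
  "gph_subdiff f = {(x, v). v \<in> limiting_subdiff f x}"

definition prox_regular :: "('a::euclidean_space \<Rightarrow> ereal) \<Rightarrow> 'a \<Rightarrow> 'a \<Rightarrow> bool" where
  "prox_regular f xbar vbar \<longleftrightarrow>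
     \<bar>f xbar\<bar> \<noteq> \<infinity> \<and> locally_lsc_at f xbar \<and> vbar \<in> limiting_subdiff f xbar \<and>
     (\<exists>\<epsilon>>0. \<exists>r\<ge>0. \<forall>(x, v) \<in> gph_subdiff f \<inter> cball (xbar, vbar) \<epsilon>.
        f x < f xbar + ereal \<epsilon> \<longrightarrow>
        (\<forall>x' \<in> cball xbar \<epsilon>.
           f x' \<ge> f x + ereal (v \<bullet> (x' - x)) - ereal (r / 2 * (norm (x' - x))\<^sup>2)))"

definition subdiff_continuous :: "('a::euclidean_space \<Rightarrow> ereal) \<Rightarrow> 'a \<Rightarrow> 'a \<Rightarrow> bool" where
  "subdiff_continuous f xbar vbar \<longleftrightarrow>
     (\<forall>xs vs. xs \<longlonglongrightarrow> xbar \<and> vs \<longlonglongrightarrow> vbar \<and> (\<forall>k. vs k \<in> limiting_subdiff f (xs k)) \<longrightarrow>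
        (\<lambda>k. f (xs k)) \<longlonglongrightarrow> f xbar)"

text \<open>The filter expresses that \<open>t\<close> decreases to \<open>0\<close> through positive values while, independently,
  \<open>u\<close> tends to \<open>w\<close> (with \<open>u = w\<close> allowed). Only meaningful where \<open>f x\<close> is finite.\<close>

definition second_subderiv :: "('a::euclidean_space \<Rightarrow> ereal) \<Rightarrow> 'a \<Rightarrow> 'a \<Rightarrow> 'a \<Rightarrow> ereal" where
  "second_subderiv f x v w =
     Liminf (at_right 0 \<times>\<^sub>F nhds w)
       (\<lambda>(t, u). (f (x + t *\<^sub>R u) - f x - ereal (t * (v \<bullet> u))) / ereal (1 / 2 * t\<^sup>2))"

text \<open>The operator \<open>L\<close> is only constrained on \<open>domain \<phi>\<close>; its values elsewhere are irrelevant.\<close>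

definition GQF :: "('a::euclidean_space \<Rightarrow> ereal) \<Rightarrow> bool" where
  "GQF \<phi> \<longleftrightarrow>
     proper \<phi> \<and> subspace (domain \<phi>) \<and>
     (\<exists>L :: 'a \<Rightarrow> 'a.
        (\<forall>x \<in> domain \<phi>. \<forall>y \<in> domain \<phi>. L (x + y) = L x + L y) \<and>
        (\<forall>c. \<forall>x \<in> domain \<phi>. L (c *\<^sub>R x) = c *\<^sub>R L x) \<and>
        (\<forall>x \<in> domain \<phi>. \<forall>y \<in> domain \<phi>. L x \<bullet> y = x \<bullet> L y) \<and>
        (\<forall>x \<in> domain \<phi>. \<phi> x = ereal (L x \<bullet> x)))"

text \<open>Painleve-Kuratowski limits of sequences of sets.\<close>

definition inner_limit :: "(nat \<Rightarrow> 'b::topological_space set) \<Rightarrow> 'b set" where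
  "inner_limit C = {z. \<exists>zs. zs \<longlonglongrightarrow> z \<and> (\<forall>\<^sub>F k in sequentially. zs k \<in> C k)}"

definition outer_limit :: "(nat \<Rightarrow> 'b::topological_space set) \<Rightarrow> 'b set" where
  "outer_limit C = {z. \<exists>r zs. strict_mono (r :: nat \<Rightarrow> nat) \<and> zs \<longlonglongrightarrow> z \<and> (\<forall>k. zs k \<in> C (r k))}"

definition PK_converges :: "(nat \<Rightarrow> 'b::topological_space set) \<Rightarrow> 'b set \<Rightarrow> bool" where
  "PK_converges C D \<longleftrightarrow> inner_limit C = D \<and> outer_limit C = D"

definition epi_converges ::
    "(nat \<Rightarrow> 'a::topological_space \<Rightarrow> ereal) \<Rightarrow> ('a \<Rightarrow> ereal) \<Rightarrow> bool" where
  "epi_converges \<phi> q \<longleftrightarrow> PK_converges (\<lambda>k. epi (\<phi> k)) (epi q)"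

definition quad_bundle ::
    "('a::euclidean_space \<Rightarrow> ereal) \<Rightarrow> 'a \<Rightarrow> 'a \<Rightarrow> ('a \<Rightarrow> ereal) set" where
  "quad_bundle f xbar vbar =
     {q. GQF q \<and>
         (\<exists>xs vs. (\<forall>k. (xs k, vs k) \<in> gph_subdiff f) \<and>
                  (\<lambda>k. (xs k, vs k)) \<longlonglongrightarrow> (xbar, vbar) \<and>
                  (\<forall>k. GQF (second_subderiv f (xs k) (vs k))) \<and>
                  epi_converges (\<lambda>k. second_subderiv f (xs k) (vs k)) q)}"

definition tilt_argmin :: "('a::euclidean_space \<Rightarrow> ereal) \<Rightarrow> 'a \<Rightarrow> real \<Rightarrow> 'a \<Rightarrow> 'a set" where
  "tilt_argmin f xbar \<gamma> v =
     {x \<in> cball xbar \<gamma>. \<forall>y \<in> cball xbar \<gamma>. f x - ereal (v \<bullet> x) \<le> f y - ereal (v \<bullet> y)}"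

definition tilt_stable :: "('a::euclidean_space \<Rightarrow> ereal) \<Rightarrow> 'a \<Rightarrow> bool" where
  "tilt_stable f xbar \<longleftrightarrow>
     \<bar>f xbar\<bar> \<noteq> \<infinity> \<and>
     (\<exists>\<gamma>>0. tilt_argmin f xbar \<gamma> 0 = {xbar} \<and>
        (\<exists>U m C. open U \<and> 0 \<in> U \<and> (\<forall>v \<in> U. tilt_argmin f xbar \<gamma> v = {m v}) \<and>
                 C-lipschitz_on U m))"

end

theory Submission
  imports Defs
begin

text \<open>
  Prox-regularity makes the proximal map \<open>P z = argmin (f + \<rho>/2 \<parallel>\<cdot> - z\<parallel>\<^sup>2)\<close> single-valued, monotone and
  Lipschitz near \<open>xbar\<close>; it is the gradient of a convex function, \<open>z \<mapsto> (P z, \<rho> (z - P z))\<close>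
  parametrises the graph of the subdifferential near \<open>(xbar, 0)\<close>, and the Moreau envelope \<open>e\<close> has gradient
  \<open>G z = \<rho> (z - P z)\<close>. Wherever \<open>P\<close> has a derivative \<open>A\<close>, the map \<open>A\<close> is symmetric positive
  semidefinite and the second subderivative of \<open>f\<close> at \<open>(P z, G z)\<close> is the generalized quadratic form
  \<open>A \<xi> \<mapsto> \<rho> \<langle>\<xi> - A \<xi>, A \<xi>\<rangle>\<close>. Limits of such \<open>A\<close> produce elements of the quadratic bundle, so if all
  of these are positive then compactness gives \<open>\<langle>A \<xi>, \<xi>\<rangle> \<le> (1 - \<delta>) \<parallel>\<xi>\<parallel>\<^sup>2\<close> uniformly near \<open>xbar\<close>. By Rademacher's
  theorem this integrates to strong convexity of \<open>e\<close>, and \<open>v \<mapsto> P (G\<^sup>-\<^sup>1 v)\<close> is the Lipschitz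
  map of tilted minimisers.

  Conversely, the Lipschitz map \<open>m\<close> of tilted minimisers gives uniform quadratic growth of \<open>f\<close> at \<open>m v\<close>;
  prox-regularity shows that every subgradient pair near \<open>(xbar, 0)\<close> has the form \<open>(m v, v)\<close>, and
  the resulting lower bound on second subderivatives survives epi-limits.
\<close>

text \<open>The obstacle is that \<open>f\<close> may be extended-valued and discontinuous, while
  the quadratic bundle sees only points where the second subderivative is a generalized quadratic
  form. Rademacher's theorem cannot be applied to \<open>f\<close>, but it can be applied to
  \<open>P\<close>, which is Lipschitz on a full ball. Formally the form obtained from
  \<open>A\<close> is that of \<open>\<rho> * (A^-1 - I)\<close>. Since \<open>A\<close> may be
  singular and its rank may drop in a limit, the form is written as a supremum of expressions affine
  in \<open>A\<close>, and \<open>A\<close> is never inverted in the limit argument. An upper bound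
  below 1 on the form of \<open>A\<close> is the same as strong monotonicity of \<open>G\<close>,
  since \<open>G\<close> has derivative \<open>\<rho> * (I - A)\<close>. In the converse direction a
  nearby pair \<open>(x, v)\<close> is compared with the pair \<open>(m v', v')\<close> that has the
  same value of \<open>x + v /\<^sub>R \<rho>\<close>; minimality of \<open>m v'\<close> and
  prox-regularity at \<open>x\<close> force the two pairs to coincide.\<close>

subsection \<open>Lipschitz functions on the line\<close>

text \<open>Almost all of \<open>A\<close> is covered by disjoint short intervals inside an open set
  barely larger than \<open>A\<close>. Each image lies in an interval at most \<open>p\<close> times
  as long, and the uncovered null set keeps measure zero under a Lipschitz map.\<close>

lemma measure_image_le_of_fine_cover:
  fixes h :: "real \<Rightarrow> real"
  assumes mono: "mono h" and lip: "L-lipschitz_on UNIV h"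
    and A: "A \<in> lmeasurable" and hA: "h ` A \<in> lmeasurable" and p: "p \<ge> 0"
    and cov: "\<And>x d. x \<in> A \<Longrightarrow> 0 < d \<Longrightarrow>
      \<exists>a b. a \<le> x \<and> x \<le> b \<and> a < b \<and> b - a < d \<and> h b - h a \<le> p * (b - a)"
  shows "measure lebesgue (h ` A) \<le> p * measure lebesgue A"
proof (rule field_le_epsilon)
  fix e :: real assume e: "e > 0"
  \<comment> \<open>The summand 1 keeps the quotient meaningful when \<open>p = 0\<close>.\<close>
  define e' where "e' = e / (p + 1)"
  have e': "e' > 0" "p * e' \<le> e" using e p by (auto simp: e'_def field_simps)
  obtain U where U: "open U" "A \<subseteq> U" "U - A \<in> lmeasurable" "emeasure lebesgue (U - A) < ennreal e'"
    using sets_lebesgue_outer_open[of A e'] A e' by blast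
  have Um: "U \<in> lmeasurable"
    using U A by (metis Diff_partition fmeasurable.Un)
  have "measure lebesgue (U - A) = measure lebesgue U - measure lebesgue A"
    using U A Um by (intro measurable_measure_Diff) auto
  moreover have "measure lebesgue (U - A) < e'"
    using U(3,4) e' by (simp add: emeasure_eq_measure2 ennreal_less_iff)
  ultimately have mU: "measure lebesgue U < measure lebesgue A + e'" by simp
  define K where "K = {(a,b). a < b \<and> {a..b} \<subseteq> U \<and> h b - h a \<le> p * (b - a)}"
  define c where "c = (\<lambda>(a,b). (a + b) / 2 :: real)"
  define r where "r = (\<lambda>(a,b). (b - a) / 2 :: real)"
  have cb: "cball (c i) (r i) = {fst i..snd i}" for i
    by (cases i) (auto simp: c_def r_def cball_eq_atLeastAtMost field_simps)
  obtain C where C: "countable C" "C \<subseteq> K"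
     "pairwise (\<lambda>i j. disjnt (cball (c i) (r i)) (cball (c j) (r j))) C"
     "negligible(A - (\<Union>i \<in> C. cball (c i) (r i)))"
  proof (rule Vitali_covering_theorem_cballs[of K r A c])
    show "\<And>i. i \<in> K \<Longrightarrow> 0 < r i" by (auto simp: K_def r_def)
    fix x d :: real assume x: "x \<in> A" and d: "0 < d"
    from x U obtain s where s: "s > 0" "cball x s \<subseteq> U" by (meson open_contains_cball subsetD)
    obtain a b where ab: "a \<le> x" "x \<le> b" "a < b" "b - a < min d s" "h b - h a \<le> p * (b - a)"
      using cov[OF x, of "min d s"] d s by auto
    have "{a..b} \<subseteq> cball x s" using ab by (auto simp: dist_real_def)
    then have "(a,b) \<in> K" using ab s by (auto simp: K_def)
    moreover have "x \<in> cball (c (a,b)) (r (a,b))" unfolding cb using ab by auto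
    moreover have "r (a,b) < d" using ab by (auto simp: r_def)
    ultimately show "\<exists>i. i \<in> K \<and> x \<in> cball (c i) (r i) \<and> r i < d" by blast
  qed
  define N where "N = A - (\<Union>i \<in> C. cball (c i) (r i))"
  have negN: "negligible (h ` N)"
  proof (rule negligible_locally_Lipschitz_image)
    show "negligible N" using C by (simp add: N_def)
    show "\<exists>T B. open T \<and> x \<in> T \<and> (\<forall>y\<in>N \<inter> T. norm (h y - h x) \<le> B * norm (y - x))" if "x \<in> N" for x
      using lipschitz_onD[OF lip] by (intro exI[of _ UNIV] exI[of _ L]) (auto simp: dist_norm)
  qed simp
  define D where "D = (\<lambda>i. {h (fst i)..h (snd i)})"
  \<comment> \<open>Finite subfamilies come first, so that only finite sums occur; the countable
    union in \<open>DU\<close> inherits the bound.\<close>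
  have bound: "measure lebesgue (\<Union>i\<in>F. D i) \<le> p * measure lebesgue U" if F: "F \<subseteq> C" "finite F" for F
  proof -
    have FK: "i \<in> F \<Longrightarrow> i \<in> K" for i using F C by auto
    have "measure lebesgue (\<Union>i\<in>F. D i) \<le> (\<Sum>i\<in>F. measure lebesgue (D i))"
      by (rule measure_UNION_le) (use F in \<open>auto simp: D_def\<close>)
    also have "\<dots> \<le> (\<Sum>i\<in>F. p * measure lebesgue {fst i..snd i})"
    proof (rule sum_mono)
      fix i assume "i \<in> F"
      with FK have i: "i \<in> K" by auto
      then have "h (fst i) \<le> h (snd i)" by (auto simp: K_def intro!: monoD[OF mono])
      then show "measure lebesgue (D i) \<le> p * measure lebesgue {fst i..snd i}"
        using i by (auto simp: D_def K_def)
    qed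
    also have "\<dots> = p * (\<Sum>i\<in>F. measure lebesgue {fst i..snd i})" by (simp add: sum_distrib_left)
    also have "(\<Sum>i\<in>F. measure lebesgue {fst i..snd i}) = measure lebesgue (\<Union>i\<in>F. {fst i..snd i})"
    proof (rule measure_UNION'[symmetric])
      show "pairwise (\<lambda>i j. disjnt {fst i..snd i} {fst j..snd j}) F"
        using pairwise_subset[OF C(3) F(1)] by (simp add: cb)
    qed (use F in auto)
    also have "p * \<dots> \<le> p * measure lebesgue U"
    proof (intro mult_left_mono p measure_mono_fmeasurable Um)
      show "(\<Union>i\<in>F. {fst i..snd i}) \<subseteq> U" using FK by (fastforce simp: K_def)
      show "(\<Union>i\<in>F. {fst i..snd i}) \<in> sets lebesgue" using F by auto
    qed
    finally show ?thesis .
  qed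
  have DU: "(\<Union>i\<in>C. D i) \<in> lmeasurable" "measure lebesgue (\<Union>i\<in>C. D i) \<le> p * measure lebesgue U"
    using fmeasurable_UN_bound[OF C(1) _ bound] measure_UN_bound[OF C(1) _ bound] by (auto simp: D_def)
  have "h ` A \<subseteq> (\<Union>i\<in>C. D i) \<union> h ` N"
  proof
    fix y assume "y \<in> h ` A"
    then obtain x where x: "x \<in> A" "y = h x" by auto
    show "y \<in> (\<Union>i\<in>C. D i) \<union> h ` N"
    proof (cases "x \<in> N")
      case False
      with x obtain i where "i \<in> C" "x \<in> {fst i..snd i}" by (auto simp: N_def cb)
      then have "y \<in> D i" using x by (auto simp: D_def intro!: monoD[OF mono])
      with \<open>i \<in> C\<close> show ?thesis by blast
    qed (use x in auto)
  qed
  then have "measure lebesgue (h ` A) \<le> measure lebesgue ((\<Union>i\<in>C. D i) \<union> h ` N)"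
    by (rule measure_mono_fmeasurable) (use hA DU negN in \<open>auto intro: negligible_imp_measurable\<close>)
  also have "\<dots> \<le> measure lebesgue (\<Union>i\<in>C. D i) + measure lebesgue (h ` N)"
    using DU negN by (intro measure_Un_le) (auto intro: negligible_imp_sets)
  also have "\<dots> \<le> p * measure lebesgue U" using DU negN by (simp add: negligible_imp_measure0)
  also have "\<dots> \<le> p * (measure lebesgue A + e')" using mU p by (intro mult_left_mono) auto
  also have "\<dots> \<le> p * measure lebesgue A + e" using e' by (simp add: algebra_simps)
  finally show "measure lebesgue (h ` A) \<le> p * measure lebesgue A + e" .
qed

text \<open>Intervals straddling the point replace difference quotients based at it. This makes both
  slope sets open, and hence \<open>dini_gap\<close> Borel.\<close>

definition slope_below :: "(real \<Rightarrow> real) \<Rightarrow> real \<Rightarrow> real \<Rightarrow> real set" where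
  "slope_below h p d = \<Union>{{a<..<b} |a b. b - a < d \<and> h b - h a < p * (b - a)}"

definition slope_above :: "(real \<Rightarrow> real) \<Rightarrow> real \<Rightarrow> real \<Rightarrow> real set" where
  "slope_above h q d = \<Union>{{a<..<b} |a b. b - a < d \<and> h b - h a > q * (b - a)}"

lemma open_slope_sets: "open (slope_below h p d)" "open (slope_above h q d)"
  unfolding slope_below_def slope_above_def by (auto intro!: open_Union)

text \<open>For \<open>p < q\<close> these are points at which the slopes over shrinking straddling
  intervals have no limit.\<close>

definition dini_gap :: "(real \<Rightarrow> real) \<Rightarrow> real \<Rightarrow> real \<Rightarrow> real set" where
  "dini_gap h p q = (\<Inter>n::nat. slope_below h p (inverse (Suc n)) \<inter> slope_above h q (inverse (Suc n)))"

lemma borel_dini_gap: "dini_gap h p q \<in> sets borel"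
  unfolding dini_gap_def by (intro sets.countable_INT) (auto intro!: borel_open open_slope_sets)

text \<open>On a bounded part \<open>E\<close> of the set, Vitali coverings give \<open>measure (h ` E) \<le> p * measure E\<close>
  and, applied to the inverse of \<open>h\<close>, also \<open>measure E \<le> measure (h ` E) / q\<close>.\<close>

lemma negligible_dini_gap:
  fixes h :: "real \<Rightarrow> real"
  assumes lo: "\<And>x y. x \<le> y \<Longrightarrow> y - x \<le> h y - h x"
    and hi: "\<And>x y. x \<le> y \<Longrightarrow> h y - h x \<le> L * (y - x)"
    and pq: "0 < p" "p < q"
  shows "negligible (dini_gap h p q)"
proof -
  have L: "L \<ge> 1" using lo[of 0 1] hi[of 0 1] by simp
  have lip: "L-lipschitz_on UNIV h"
  proof (rule lipschitz_onI)
    fix x y show "dist (h x) (h y) \<le> L * dist x y"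
      using lo[of x y] hi[of x y] lo[of y x] hi[of y x] L
      by (cases "x \<le> y") (auto simp: dist_real_def abs_if)
  qed (use L in auto)
  have conth: "continuous_on UNIV h" using lip by (rule lipschitz_on_continuous_on)
  have "mono h" using lo by (intro monoI) (smt (verit))
  have inj: "inj h"
  proof (rule injI)
    fix x y assume "h x = h y" then show "x = y" using lo[of x y] lo[of y x] by linarith
  qed
  have surj: "\<exists>x. h x = y" for y
  proof -
    define T where "T = \<bar>y - h 0\<bar>"
    have "T \<ge> 0" by (simp add: T_def)
    have "h (-T) \<le> y" using lo[of "-T" 0] \<open>T \<ge> 0\<close> T_def by linarith
    moreover have "y \<le> h T" using lo[of 0 T] \<open>T \<ge> 0\<close> T_def by linarith
    ultimately show ?thesis
      using IVT'[of h "-T" y T] \<open>T \<ge> 0\<close> conth by (auto intro: continuous_on_subset)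
  qed
  define k where "k = inv h"
  have hk: "h (k y) = y" for y unfolding k_def using surj by (metis f_inv_into_f rangeI)
  have kh: "k (h x) = x" for x unfolding k_def using inj by simp
  have monok: "mono k"
  proof (rule monoI)
    fix x y :: real assume "x \<le> y" then show "k x \<le> k y" using lo[of "k y" "k x"] hk by (smt (verit))
  qed
  have lipk: "1-lipschitz_on UNIV k"
  proof (rule lipschitz_onI)
    fix x y show "dist (k x) (k y) \<le> 1 * dist x y"
      using lo[of "k x" "k y"] lo[of "k y" "k x"]
      by (cases "k x \<le> k y") (auto simp: dist_real_def abs_if hk)
  qed auto
  have contk: "continuous_on UNIV k" using lipk by (rule lipschitz_on_continuous_on)
  have "negligible (dini_gap h p q \<inter> {-real n..real n})" for n
  proof -
    define E where "E = dini_gap h p q \<inter> {-real n..real n}"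
    have Eb: "E \<in> sets borel" by (auto simp: E_def borel_dini_gap)
    have E: "E \<in> lmeasurable"
      by (rule bounded_set_imp_lmeasurable) (use Eb in \<open>auto simp: E_def intro: bounded_subset[OF bounded_closed_interval]\<close>)
    have hE_eq: "h ` E = k -` E" using hk kh by (auto simp: image_iff) metis
    have "h ` E \<in> sets borel" unfolding hE_eq
      using measurable_sets[OF borel_measurable_continuous_onI[OF contk] Eb] by simp
    moreover have "bounded (h ` E)"
      by (rule bounded_subset[of "{h (- real n)..h (real n)}"])
        (auto simp: E_def intro: monoD[OF \<open>mono h\<close>])
    ultimately have hE: "h ` E \<in> lmeasurable" by (intro bounded_set_imp_lmeasurable) auto
    have khE: "k ` h ` E = E" by (auto simp: kh image_image)
    have small: "\<exists>n. inverse (real (Suc n)) < d" if "d > 0" for d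
      using reals_Archimedean[OF that] by simp
    have 1: "measure lebesgue (h ` E) \<le> p * measure lebesgue E"
    proof (rule measure_image_le_of_fine_cover[OF \<open>mono h\<close> lip E hE])
      fix x d :: real assume x: "x \<in> E" and "0 < d"
      then obtain n where n: "inverse (real (Suc n)) < d" using small by blast
      from x have "x \<in> slope_below h p (inverse (Suc n))" by (auto simp: E_def dini_gap_def)
      then obtain a b where "x \<in> {a<..<b}" "b - a < inverse (Suc n)" "h b - h a < p * (b - a)"
        unfolding slope_below_def by blast
      with n show "\<exists>a b. a \<le> x \<and> x \<le> b \<and> a < b \<and> b - a < d \<and> h b - h a \<le> p * (b - a)"
        by (intro exI[of _ a] exI[of _ b]) auto
    qed (use pq in auto)
    have 2: "measure lebesgue (k ` h ` E) \<le> (1/q) * measure lebesgue (h ` E)"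
    proof (rule measure_image_le_of_fine_cover[OF monok lipk hE])
      show "k ` h ` E \<in> lmeasurable" using E by (simp only: khE)
      fix y d :: real assume y: "y \<in> h ` E" and d: "0 < d"
      then obtain x where x: "x \<in> E" "y = h x" by auto
      \<comment> \<open>The image under \<open>h\<close> of an interval shorter than
        \<open>d / L\<close> is shorter than \<open>d\<close>.\<close>
      obtain n where n: "inverse (real (Suc n)) < d / L" using small[of "d / L"] d L by auto
      from x have "x \<in> slope_above h q (inverse (Suc n))" by (auto simp: E_def dini_gap_def)
      then obtain a b where ab: "x \<in> {a<..<b}" "b - a < inverse (Suc n)" "h b - h a > q * (b - a)"
        unfolding slope_above_def by blast
      have "h b - h a \<le> L * (b - a)" using hi[of a b] ab by auto
      also have "\<dots> < L * (d / L)" using ab n L by (intro mult_strict_left_mono) auto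
      finally have "h b - h a < d" using L by simp
      moreover have "h a < h b" using lo[of a b] ab by auto
      moreover have "h a \<le> y" "y \<le> h b" using x ab monoD[OF \<open>mono h\<close>] by auto
      moreover have "k (h b) - k (h a) \<le> 1 / q * (h b - h a)"
        using ab pq by (simp add: kh field_simps)
      ultimately show "\<exists>a b. a \<le> y \<and> y \<le> b \<and> a < b \<and> b - a < d \<and> k b - k a \<le> 1 / q * (b - a)"
        by blast
    qed (use pq in auto)
    have "q * measure lebesgue E \<le> p * measure lebesgue E"
      using 1 2 pq by (simp add: khE field_simps)
    then have "(q - p) * measure lebesgue E \<le> 0" by (simp add: algebra_simps)
    then have "measure lebesgue E = 0"
      using pq by (metis diff_gt_0_iff_gt measure_nonneg mult_le_0_iff not_le order_antisym)
    then show ?thesis using E by (simp add: E_def negligible_iff_measure)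
  qed
  then have "negligible (\<Union>n. dini_gap h p q \<inter> {-real n..real n})"
    by (intro negligible_countable_Union) auto
  moreover have "dini_gap h p q \<subseteq> (\<Union>n. dini_gap h p q \<inter> {-real n..real n})"
  proof
    fix x assume "x \<in> dini_gap h p q"
    moreover obtain n where "\<bar>x\<bar> \<le> real n" using real_arch_simple by blast
    ultimately show "x \<in> (\<Union>n. dini_gap h p q \<inter> {-real n..real n})" by (auto simp: abs_le_iff intro!: exI[of _ n])
  qed
  ultimately show ?thesis by (rule negligible_subset)
qed

lemma slope_belowI: "b - a < d \<Longrightarrow> h b - h a < p * (b - a) \<Longrightarrow> a < x \<Longrightarrow> x < b \<Longrightarrow> x \<in> slope_below h p d"
  unfolding slope_below_def by (rule UnionI[of "{a<..<b}"]) auto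

text \<open>A difference quotient at \<open>x\<close> comes from an interval with \<open>x\<close>
  as an endpoint. By continuity the endpoint can be pushed slightly past \<open>x\<close>, to
  \<open>x - s * t\<close>, without losing the strict inequalities.\<close>

lemma in_slope_below:
  fixes h :: "real \<Rightarrow> real"
  assumes "continuous_on UNIV h" and t: "t \<noteq> 0" "\<bar>t\<bar> < d" "(h (x + t) - h x) / t < p"
  shows "x \<in> slope_below h p d"
proof -
  have cont: "isCont h y" for y using assms(1) by (simp add: continuous_on_eq_continuous_at)
  have "((\<lambda>s. (h (x + t) - h (x - s * t)) / ((1 + s) * t)) \<longlongrightarrow> (h (x + t) - h (x - 0 * t)) / ((1 + 0) * t)) (at_right 0)"
    using cont t by (intro tendsto_intros isCont_tendsto_compose[of "x - 0 * t" h]) auto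
  then have "\<forall>\<^sub>F s in at_right 0. (h (x + t) - h (x - s * t)) / ((1 + s) * t) < p"
    by (rule order_tendstoD) (use t in simp)
  moreover have "((\<lambda>s. (1 + s) * \<bar>t\<bar>) \<longlongrightarrow> (1 + 0) * \<bar>t\<bar>) (at_right 0)" by (intro tendsto_intros)
  then have "\<forall>\<^sub>F s in at_right 0. (1 + s) * \<bar>t\<bar> < d" by (rule order_tendstoD) (use t in simp)
  moreover have "\<forall>\<^sub>F s in at_right (0::real). 0 < s" by (simp add: eventually_at_right_less)
  ultimately have "\<forall>\<^sub>F s in at_right 0. 0 < s \<and> (1 + s) * \<bar>t\<bar> < d \<and> (h (x + t) - h (x - s * t)) / ((1 + s) * t) < p"
    by eventually_elim auto
  then obtain s where s: "0 < s" "(1 + s) * \<bar>t\<bar> < d" "(h (x + t) - h (x - s * t)) / ((1 + s) * t) < p"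
    using eventually_happens'[OF trivial_limit_at_right_real] by blast
  show ?thesis
  proof (cases "t > 0")
    case True
    then have "h (x + t) - h (x - s * t) < p * ((1 + s) * t)" using s by (simp add: pos_divide_less_eq)
    then show ?thesis using True s by (intro slope_belowI[of "x + t" "x - s * t"]) (auto simp: algebra_simps)
  next
    case False
    then have t0: "t < 0" using t by simp
    then have "(1 + s) * t < 0" using s(1) by (simp add: mult_pos_neg)
    then have "p * ((1 + s) * t) < h (x + t) - h (x - s * t)" using s(3) by (simp add: neg_divide_less_eq)
    then show ?thesis using t0 s
      by (intro slope_belowI[of "x - s * t" "x + t"]) (auto simp: algebra_simps mult_pos_neg)
  qed
qed

lemma slope_above_uminus: "slope_above h q d = slope_below (\<lambda>x. - h x) (- q) d"
  unfolding slope_above_def slope_below_def by (auto simp: algebra_simps)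

text \<open>If the lower and upper limits differed, two rationals would separate them. Rational
  thresholds matter because the exceptional set must later be a countable union. The bounds
  \<open>a\<close> and \<open>b\<close> keep the limit finite.\<close>

lemma bounded_diff_quotient_converges:
  fixes D :: "real \<Rightarrow> real"
  assumes bd: "\<And>t. t \<noteq> 0 \<Longrightarrow> a < D t \<and> D t < b"
    and no: "\<And>p q. p \<in> \<rat> \<Longrightarrow> q \<in> \<rat> \<Longrightarrow> a < p \<Longrightarrow> p < q \<Longrightarrow>
        \<not> ((\<exists>\<^sub>F t in at 0. D t < p) \<and> (\<exists>\<^sub>F t in at 0. D t > q))"
  shows "\<exists>l. (D \<longlongrightarrow> l) (at 0)"
proof -
  let ?F = "at (0::real)"
  let ?lo = "Liminf ?F (\<lambda>t. ereal (D t))" and ?hi = "Limsup ?F (\<lambda>t. ereal (D t))"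
  have ev: "\<forall>\<^sub>F t in ?F. a < D t \<and> D t < b"
    using bd by (auto simp: eventually_at_filter)
  have nb: "?F \<noteq> bot" by simp
  have up: "?hi \<le> ereal b"
    by (rule Limsup_bounded) (use ev in \<open>auto elim: eventually_mono\<close>)
  have low: "ereal a \<le> ?lo"
    by (rule Liminf_bounded) (use ev in \<open>auto elim: eventually_mono\<close>)
  have le: "?lo \<le> ?hi"
    by (rule Liminf_le_Limsup[OF nb])
  have "?lo = ?hi"
  proof (rule ccontr)
    assume "\<not> ?thesis"
    with le have "?lo < ?hi" by simp
    then obtain s where s: "?lo < ereal s" "ereal s < ?hi"
      using ereal_dense2 by blast
    obtain s' where s': "ereal s < ereal s'" "ereal s' < ?hi"
      using ereal_dense2[OF s(2)] by blast
    obtain s0 where s0: "?lo < ereal s0" "ereal s0 < ereal s"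
      using ereal_dense2[OF s(1)] by blast
    obtain p where p: "p \<in> \<rat>" "s0 < p" "p < s" using Rats_dense_in_real s0(2) by auto
    obtain q where q: "q \<in> \<rat>" "s < q" "q < s'" using Rats_dense_in_real s'(1) by auto
    have "a < p" using low s0 p by (metis ereal_less_eq(3) le_less_trans less_ereal.simps(1) order.strict_trans)
    moreover have "\<exists>\<^sub>F t in ?F. D t < p"
    proof (rule ccontr)
      assume "\<not> ?thesis"
      then have "\<forall>\<^sub>F t in ?F. ereal p \<le> ereal (D t)" by (simp add: frequently_def not_less)
      then have "ereal p \<le> ?lo" by (rule Liminf_bounded)
      then have "ereal p < ereal s0" using s0(1) by (rule le_less_trans)
      then show False using p by auto
    qed
    moreover have "\<exists>\<^sub>F t in ?F. D t > q"
    proof (rule ccontr)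
      assume "\<not> ?thesis"
      then have "\<forall>\<^sub>F t in ?F. ereal (D t) \<le> ereal q" by (simp add: frequently_def not_less)
      then have "?hi \<le> ereal q" by (rule Limsup_bounded)
      with s' have "ereal s' < ereal q" by (metis less_le_trans)
      then show False using q by auto
    qed
    ultimately show False using no[of p q] p q by auto
  qed
  moreover obtain l where l: "?lo = ereal l"
    using low up le by (cases "?lo") auto
  ultimately have "((\<lambda>t. ereal (D t)) \<longlongrightarrow> ereal l) ?F"
    using tendsto_iff_Liminf_eq_Limsup[OF nb, of "\<lambda>t. ereal (D t)" "ereal l"] by simp
  then show ?thesis by auto
qed

text \<open>Adding the steep linear term \<open>(L + 1) * t\<close> does not affect
  differentiability and puts all slopes between \<open>1\<close> and \<open>2 * L + 1\<close>. The
  covering estimates then apply both to the new function and to its inverse.\<close>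

lemma lipschitz_real_differentiable_ae:
  fixes g :: "real \<Rightarrow> real"
  assumes lip: "L-lipschitz_on UNIV g"
  shows "negligible {x. \<not> (\<exists>l. ((\<lambda>t. (g (x + t) - g x) / t) \<longlongrightarrow> l) (at 0))}"
proof -
  have L: "L \<ge> 0" using lip by (rule lipschitz_on_nonneg)
  have gl: "\<bar>g x - g y\<bar> \<le> L * \<bar>x - y\<bar>" for x y using lipschitz_onD[OF lip, of x y] by (simp add: dist_real_def)
  define h where "h = (\<lambda>t. g t + (L + 1) * t)"
  have lo: "y - x \<le> h y - h x" if "x \<le> y" for x y
    using gl[of x y] that by (simp add: h_def algebra_simps abs_if split: if_splits)
  have hi: "h y - h x \<le> (2 * L + 1) * (y - x)" if "x \<le> y" for x y
    using gl[of x y] that by (simp add: h_def algebra_simps abs_if split: if_splits)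
  have conth: "continuous_on UNIV h" unfolding h_def
    by (intro continuous_intros lipschitz_on_continuous_on[OF lip])
  define N where "N = (\<Union>p\<in>\<rat> \<inter> {0<..}. \<Union>q\<in>\<rat> \<inter> {p<..}. dini_gap h p q)"
  have cr: "countable (\<rat> \<inter> {p<..})" for p :: real
    by (rule countable_subset[OF _ countable_rat]) auto
  have Np: "(\<Union>q\<in>\<rat> \<inter> {p<..}. dini_gap h p q) \<in> null_sets lebesgue" if "0 < p" for p
    by (rule null_sets_UN'[OF cr])
      (use negligible_dini_gap[OF lo hi that] in \<open>simp add: negligible_iff_null_sets\<close>)
  have "N \<in> null_sets lebesgue" unfolding N_def
    by (rule null_sets_UN'[OF cr]) (rule Np, simp)
  then have "negligible N" by (simp add: negligible_iff_null_sets)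
  moreover have "{x. \<not> (\<exists>l. ((\<lambda>t. (g (x + t) - g x) / t) \<longlongrightarrow> l) (at 0))} \<subseteq> N"
  proof (rule ccontr)
    assume "\<not> ?thesis"
    then obtain x where nl: "\<not> (\<exists>l. ((\<lambda>t. (g (x + t) - g x) / t) \<longlongrightarrow> l) (at 0))" and xN: "x \<notin> N" by auto
    have "\<exists>l. ((\<lambda>t. (h (x + t) - h x) / t) \<longlongrightarrow> l) (at 0)"
    proof (rule bounded_diff_quotient_converges[of 0 _ "2 * L + 2"])
      fix t :: real assume t: "t \<noteq> 0"
      show "0 < (h (x + t) - h x) / t \<and> (h (x + t) - h x) / t < 2 * L + 2"
        using lo[of x "x + t"] hi[of x "x + t"] lo[of "x + t" x] hi[of "x + t" x] t
        by (cases "t > 0") (auto simp: field_simps)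
    next
      fix p q :: real assume pq: "p \<in> \<rat>" "q \<in> \<rat>" "0 < p" "p < q"
      show "\<not> ((\<exists>\<^sub>F t in at 0. (h (x + t) - h x) / t < p) \<and> (\<exists>\<^sub>F t in at 0. q < (h (x + t) - h x) / t))"
      proof
        assume *: "(\<exists>\<^sub>F t in at 0. (h (x + t) - h x) / t < p) \<and> (\<exists>\<^sub>F t in at 0. q < (h (x + t) - h x) / t)"
        have fr: "\<exists>t. t \<noteq> 0 \<and> \<bar>t\<bar> < d \<and> P t" if "\<exists>\<^sub>F t in at 0. P t" "d > 0" for P and d :: real
          using that by (auto simp: frequently_at dist_real_def)
        have "x \<in> slope_below h p d \<inter> slope_above h q d" if d: "d > 0" for d
        proof -
          obtain t where "t \<noteq> 0" "\<bar>t\<bar> < d" "(h (x + t) - h x) / t < p" using fr[OF conjunct1[OF *] d] by blast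
          then have "x \<in> slope_below h p d" by (rule in_slope_below[OF conth])
          moreover obtain t where t: "t \<noteq> 0" "\<bar>t\<bar> < d" "q < (h (x + t) - h x) / t" using fr[OF conjunct2[OF *] d] by blast
          have "((- h (x + t)) - (- h x)) / t < - q" using t(3) by (simp add: diff_divide_distrib)
          then have "x \<in> slope_above h q d" unfolding slope_above_uminus
            by (intro in_slope_below[of "\<lambda>x. - h x" t] t continuous_intros conth)
          ultimately show ?thesis by blast
        qed
        then have "x \<in> dini_gap h p q" unfolding dini_gap_def by simp
        then show False using xN pq by (auto simp: N_def)
      qed
    qed
    then obtain l where l: "((\<lambda>t. (h (x + t) - h x) / t) \<longlongrightarrow> l) (at 0)" by blast
    have "((\<lambda>t. (g (x + t) - g x) / t) \<longlongrightarrow> l - (L + 1)) (at 0)"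
    proof (rule Lim_transform_eventually)
      show "((\<lambda>t. (h (x + t) - h x) / t - (L + 1)) \<longlongrightarrow> l - (L + 1)) (at 0)" by (intro tendsto_intros l)
      show "\<forall>\<^sub>F t in at 0. (h (x + t) - h x) / t - (L + 1) = (g (x + t) - g x) / t"
        by (auto simp: eventually_at_filter h_def field_simps)
    qed
    with nl show False by blast
  qed
  ultimately show ?thesis by (rule negligible_subset)
qed

subsection \<open>Rademacher's theorem\<close>

definition diffquot :: "('a::euclidean_space \<Rightarrow> real) \<Rightarrow> 'a \<Rightarrow> 'a \<Rightarrow> real \<Rightarrow> real" where
  "diffquot g d z t = (g (z + t *\<^sub>R d) - g z) / t"

text \<open>A limit along a single sequence is Borel in \<open>z\<close> and defined everywhere,
  with an arbitrary value where it diverges. By \<open>has_dirderiv_imp\<close> it is the two-sided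
  derivative wherever that exists.\<close>

definition dirderiv :: "('a::euclidean_space \<Rightarrow> real) \<Rightarrow> 'a \<Rightarrow> 'a \<Rightarrow> real" where
  "dirderiv g d z = lim (\<lambda>n. diffquot g d z (inverse (real (Suc n))))"

definition has_dirderiv :: "('a::euclidean_space \<Rightarrow> real) \<Rightarrow> 'a \<Rightarrow> 'a \<Rightarrow> real \<Rightarrow> bool" where
  "has_dirderiv g d z l \<longleftrightarrow> (diffquot g d z \<longlongrightarrow> l) (at 0)"

lemma filterlim_inverse_Suc_at_0: "filterlim (\<lambda>n. inverse (real (Suc n))) (at 0) sequentially"
  unfolding filterlim_at using LIMSEQ_inverse_real_of_nat by auto

lemma has_dirderiv_imp: "has_dirderiv g d z l \<Longrightarrow> dirderiv g d z = l"
  unfolding has_dirderiv_def dirderiv_def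
  by (intro limI) (rule filterlim_compose[OF _ filterlim_inverse_Suc_at_0])

lemma has_dirderiv_seq: "has_dirderiv g d z l \<Longrightarrow> (\<lambda>n. diffquot g d z (inverse (real (Suc n)))) \<longlonglongrightarrow> l"
  unfolding has_dirderiv_def by (rule filterlim_compose[OF _ filterlim_inverse_Suc_at_0])

lemma has_dirderiv_scaleR:
  assumes "has_dirderiv g d z l"
  shows "has_dirderiv g (c *\<^sub>R d) z (c * l)"
proof (cases "c = 0")
  case True
  then show ?thesis by (simp add: has_dirderiv_def diffquot_def[abs_def])
next
  case False
  have "filterlim (\<lambda>t. c * t) (at 0) (at 0)"
    unfolding filterlim_at using False
    by (auto simp: eventually_at_filter intro!: tendsto_eq_intros)
  then have "((\<lambda>t. diffquot g d z (c * t)) \<longlongrightarrow> l) (at 0)"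
    using assms unfolding has_dirderiv_def by (rule filterlim_compose[rotated])
  then have "((\<lambda>t. c * diffquot g d z (c * t)) \<longlongrightarrow> c * l) (at 0)" by (intro tendsto_intros)
  moreover have "(\<lambda>t. c * diffquot g d z (c * t)) = diffquot g (c *\<^sub>R d) z"
    using False by (auto simp: diffquot_def fun_eq_iff mult.commute)
  ultimately show ?thesis by (simp add: has_dirderiv_def)
qed

text \<open>This Cauchy criterion has only countable quantifiers, so the set of points possessing a
  directional derivative is Borel. Continuity away from \<open>0\<close> carries the estimate from
  rational to real step sizes.\<close>

lemma convergent_at_0_iff_rat_cauchy:
  fixes D :: "real \<Rightarrow> real"
  assumes cont: "\<And>t. t \<noteq> 0 \<Longrightarrow> isCont D t"
  shows "(\<exists>l. (D \<longlongrightarrow> l) (at 0)) \<longleftrightarrow>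
    (\<forall>n::nat. \<exists>m::nat. \<forall>s t::rat. s \<noteq> 0 \<and> t \<noteq> 0 \<and> \<bar>of_rat s\<bar> < inverse (real (Suc m)) \<and> \<bar>of_rat t\<bar> < inverse (real (Suc m))
       \<longrightarrow> \<bar>D (of_rat s) - D (of_rat t)\<bar> \<le> inverse (real (Suc n)))" (is "?L \<longleftrightarrow> ?R")
proof
  assume ?L
  then obtain l where l: "(D \<longlongrightarrow> l) (at 0)" by blast
  show ?R
  proof
    fix n :: nat
    have "\<forall>\<^sub>F t in at 0. dist (D t) l < inverse (real (Suc n)) / 2"
      using tendstoD[OF l, of "inverse (real (Suc n)) / 2"] by simp
    then obtain d where d: "d > 0" "\<And>t. t \<noteq> 0 \<Longrightarrow> \<bar>t\<bar> < d \<Longrightarrow> dist (D t) l < inverse (real (Suc n)) / 2"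
      unfolding eventually_at by (auto simp: dist_real_def)
    obtain m where m: "inverse (real (Suc m)) < d" using reals_Archimedean[OF d(1)] by auto
    show "\<exists>m::nat. \<forall>s t::rat. s \<noteq> 0 \<and> t \<noteq> 0 \<and> \<bar>of_rat s\<bar> < inverse (real (Suc m)) \<and> \<bar>of_rat t\<bar> < inverse (real (Suc m))
       \<longrightarrow> \<bar>D (of_rat s) - D (of_rat t)\<bar> \<le> inverse (real (Suc n))"
    proof (intro exI[of _ m] allI impI)
      fix s t :: rat assume st: "s \<noteq> 0 \<and> t \<noteq> 0 \<and> \<bar>of_rat s\<bar> < inverse (real (Suc m)) \<and> \<bar>of_rat t\<bar> < inverse (real (Suc m))"
      have "dist (D (of_rat s)) l < inverse (real (Suc n)) / 2" "dist (D (of_rat t)) l < inverse (real (Suc n)) / 2"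
        using st m by (intro d(2); simp; linarith)+
      then show "\<bar>D (of_rat s) - D (of_rat t)\<bar> \<le> inverse (real (Suc n))"
        unfolding dist_real_def by linarith
    qed
  qed
next
  assume R: ?R
  have ext: "\<exists>d>0. \<forall>s t. s \<noteq> 0 \<and> t \<noteq> 0 \<and> \<bar>s\<bar> < d \<and> \<bar>t\<bar> < d \<longrightarrow> \<bar>D s - D t\<bar> \<le> e" if e: "e > 0" for e
  proof -
    obtain n where n: "inverse (real (Suc n)) < e" using reals_Archimedean[OF e] by auto
    obtain m where m: "\<And>s t::rat. s \<noteq> 0 \<Longrightarrow> t \<noteq> 0 \<Longrightarrow> \<bar>of_rat s\<bar> < inverse (real (Suc m)) \<Longrightarrow> \<bar>of_rat t\<bar> < inverse (real (Suc m))
       \<Longrightarrow> \<bar>D (of_rat s) - D (of_rat t)\<bar> \<le> inverse (real (Suc n))" using R by meson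
    define d where "d = inverse (real (Suc m))"
    have approx: "\<exists>q. (\<forall>k. q k \<noteq> 0 \<and> \<bar>of_rat (q k)\<bar> < d) \<and> (\<lambda>k. of_rat (q k)) \<longlonglongrightarrow> s" if s: "s \<noteq> 0" "\<bar>s\<bar> < d" for s :: real
    proof -
      \<comment> \<open>The punctured interval is open, so the rationals are dense in it and the
        approximating sequence can avoid \<open>0\<close> while staying shorter than
        \<open>d\<close>.\<close>
      define S where "S = ball 0 d - {0::real}"
      have "s \<in> closure (S \<inter> \<rat>)"
      proof -
        have "closure (S \<inter> closure \<rat>) \<subseteq> closure (S \<inter> \<rat>)"
          using open_Int_closure_subset[of S \<rat>] closure_minimal closed_closure by (metis S_def open_ball open_delete)
        moreover have "s \<in> closure (S \<inter> closure \<rat>)"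
          using s closure_subset[of S] by (auto simp: S_def Rats_closure_real)
        ultimately show ?thesis by blast
      qed
      then obtain x where x: "\<And>k. x k \<in> S \<inter> \<rat>" "x \<longlonglongrightarrow> s" unfolding closure_sequential by blast
      then have "\<forall>k. \<exists>q. x k = of_rat q" by (meson IntD2 Rats_cases)
      then obtain q where q: "\<And>k. x k = of_rat (q k)" by metis
      have "x = (\<lambda>k. of_rat (q k))" using q by auto
      moreover have "q k \<noteq> 0 \<and> \<bar>of_rat (q k)\<bar> < d" for k
        using x(1)[of k] q[of k] by (auto simp: S_def dist_real_def)
      ultimately show ?thesis using x by blast
    qed
    show ?thesis
    proof (intro exI[of _ d] conjI allI impI)
      show "d > 0" by (simp add: d_def)
      fix s t :: real assume st: "s \<noteq> 0 \<and> t \<noteq> 0 \<and> \<bar>s\<bar> < d \<and> \<bar>t\<bar> < d"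
      obtain q where q: "\<And>k. q k \<noteq> 0 \<and> \<bar>of_rat (q k)\<bar> < d" "(\<lambda>k. of_rat (q k)) \<longlonglongrightarrow> s" using approx st by blast
      obtain u where u: "\<And>k. u k \<noteq> 0 \<and> \<bar>of_rat (u k)\<bar> < d" "(\<lambda>k. of_rat (u k)) \<longlonglongrightarrow> t" using approx st by blast
      have "(\<lambda>k. \<bar>D (of_rat (q k)) - D (of_rat (u k))\<bar>) \<longlonglongrightarrow> \<bar>D s - D t\<bar>"
        using st by (intro tendsto_intros isCont_tendsto_compose[OF cont] q u) auto
      moreover have "\<bar>D (of_rat (q k)) - D (of_rat (u k))\<bar> \<le> inverse (real (Suc n))" for k
        using m q u unfolding d_def by blast
      ultimately have "\<bar>D s - D t\<bar> \<le> inverse (real (Suc n))" by (intro LIMSEQ_le_const2) auto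
      then show "\<bar>D s - D t\<bar> \<le> e" using n by linarith
    qed
  qed
  have "cauchy_filter (filtermap D (at 0))"
    unfolding cauchy_filter_metric_filtermap
  proof (intro allI impI)
    fix e :: real assume "e > 0"
    then obtain d where d: "d > 0" "\<And>s t. s \<noteq> 0 \<Longrightarrow> t \<noteq> 0 \<Longrightarrow> \<bar>s\<bar> < d \<Longrightarrow> \<bar>t\<bar> < d \<Longrightarrow> \<bar>D s - D t\<bar> \<le> e / 2"
      using ext[of "e/2"] by (metis half_gt_zero)
    have "\<forall>\<^sub>F t in at 0. t \<noteq> 0 \<and> \<bar>t\<bar> < d" using d(1) unfolding eventually_at by (auto simp: dist_real_def)
    moreover have "dist (D s) (D t) < e" if "s \<noteq> 0 \<and> \<bar>s\<bar> < d" "t \<noteq> 0 \<and> \<bar>t\<bar> < d" for s t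
      using d(2)[of s t] that \<open>e > 0\<close> by (simp add: dist_real_def)
    ultimately show "\<exists>P. eventually P (at 0) \<and> (\<forall>x y. P x \<and> P y \<longrightarrow> dist (D x) (D y) < e)" by blast
  qed
  then show ?L
    using cauchy_filter_complete_converges[OF _ complete_UNIV, of "filtermap D (at 0)"]
    by (simp add: filterlim_def filtermap_bot_iff)
qed

section \<open>Almost everywhere existence of directional derivatives\<close>

lemma AE_lborel_add:
  fixes c :: "'a::euclidean_space"
  assumes "AE z in lborel. P z"
  shows "AE z in lborel. P (z + c)"
proof -
  obtain N where N: "{z \<in> space lborel. \<not> P z} \<subseteq> N" "emeasure lborel N = 0" "N \<in> sets (lborel :: 'a measure)"
    using AE_E[OF assms] by blast
  then have "N \<in> null_sets lborel" by auto
  then have "AE z in lborel. z \<notin> N" by (rule AE_not_in)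
  then have "AE z in distr lborel borel ((+) c). z \<notin> N" unfolding lborel_distr_plus .
  then have "AE z in lborel. c + z \<notin> N"
    by (subst (asm) AE_distr_iff) (use N in auto)
  then show ?thesis by eventually_elim (use N in \<open>auto simp: add.commute\<close>)
qed

context
  fixes g :: "'a::euclidean_space \<Rightarrow> real" and L :: real
  assumes lip: "L-lipschitz_on UNIV g"
begin

lemma lip_continuous: "continuous_on A g"
  using lipschitz_on_continuous_on[OF lip] by (rule continuous_on_subset) simp

lemma lip_borel [measurable]: "g \<in> borel_measurable borel"
  using lip_continuous by (rule borel_measurable_continuous_onI)

lemma diffquot_bound: "\<bar>diffquot g d z t\<bar> \<le> L * norm d"
proof (cases "t = 0")
  case False
  have "\<bar>g (z + t *\<^sub>R d) - g z\<bar> \<le> L * (\<bar>t\<bar> * norm d)"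
    using lipschitz_onD[OF lip, of "z + t *\<^sub>R d" z] by (simp add: dist_real_def dist_norm)
  then show ?thesis using False by (simp add: diffquot_def field_simps)
qed (use lipschitz_on_nonneg[OF lip] in \<open>simp add: diffquot_def\<close>)

lemma isCont_diffquot: "t \<noteq> 0 \<Longrightarrow> isCont (diffquot g d z) t"
proof -
  assume t: "t \<noteq> 0"
  have "isCont g x" for x using lip_continuous[of UNIV] by (simp add: continuous_on_eq_continuous_at)
  then show ?thesis unfolding diffquot_def
    by (intro continuous_intros t isCont_o2[of t "\<lambda>t. z + t *\<^sub>R d" g]) auto
qed

lemma diffquot_borel [measurable]: "(\<lambda>z. diffquot g d z t) \<in> borel_measurable borel"
  unfolding diffquot_def by measurable

lemma dirderiv_borel [measurable]: "dirderiv g d \<in> borel_measurable borel"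
  unfolding dirderiv_def by measurable

lemma ex_dirderiv_pred [measurable]: "Measurable.pred borel (\<lambda>z. \<exists>l. has_dirderiv g d z l)"
  unfolding has_dirderiv_def convergent_at_0_iff_rat_cauchy[OF isCont_diffquot, simplified]
  by measurable

text \<open>Fubini without splitting off the direction \<open>d\<close>: on the product with \<open>\<real>\<close>, the exceptional
  set of \<open>(z, t) \<mapsto> z + t *\<^sub>R d\<close> has null sections for fixed \<open>z\<close>, hence for some fixed \<open>t\<close>.\<close>

lemma AE_has_dirderiv: "AE z in lborel. has_dirderiv g d z (dirderiv g d z)"
proof -
  let ?G = "\<lambda>z. \<exists>l. has_dirderiv g d z l"
  have line: "AE t in lborel. ?G (z + t *\<^sub>R d)" for z
  proof -
    define h where "h = (\<lambda>t. g (z + t *\<^sub>R d))"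
    have "(L * norm d)-lipschitz_on UNIV h"
    proof (rule lipschitz_onI)
      fix s t :: real
      have "dist (h s) (h t) \<le> L * dist (z + s *\<^sub>R d) (z + t *\<^sub>R d)"
        unfolding h_def by (rule lipschitz_onD[OF lip]) auto
      also have "dist (z + s *\<^sub>R d) (z + t *\<^sub>R d) = norm d * dist s t"
        by (simp add: dist_norm dist_real_def scaleR_diff_left[symmetric])
      finally show "dist (h s) (h t) \<le> L * norm d * dist s t" by simp
    qed (use lipschitz_on_nonneg[OF lip] in simp)
    then have "negligible {x. \<not> (\<exists>l. ((\<lambda>t. (h (x + t) - h x) / t) \<longlongrightarrow> l) (at 0))}"
      by (rule lipschitz_real_differentiable_ae)
    then have "AE x in lebesgue. \<exists>l. ((\<lambda>t. (h (x + t) - h x) / t) \<longlongrightarrow> l) (at 0)"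
      unfolding negligible_iff_null_sets by (rule AE_I') auto
    then have "AE x in lborel. \<exists>l. ((\<lambda>t. (h (x + t) - h x) / t) \<longlongrightarrow> l) (at 0)"
      by (simp add: AE_completion_iff)
    then show ?thesis
      by (simp add: has_dirderiv_def diffquot_def[abs_def] h_def algebra_simps)
  qed
  have "AE z in lborel. AE t in lborel. ?G (z + t *\<^sub>R d)" using line by simp
  then have "AE t in lborel. AE z in lborel. ?G (z + t *\<^sub>R d)"
  proof (subst (asm) lborel_pair.AE_commute)
    have "(\<lambda>x. fst x + snd x *\<^sub>R d) \<in> borel_measurable (lborel \<Otimes>\<^sub>M lborel)" by measurable
    from measurable_compose[OF this ex_dirderiv_pred]
    have "Measurable.pred (lborel \<Otimes>\<^sub>M lborel) (\<lambda>x. ?G (fst x + snd x *\<^sub>R d))" by simp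
    then show "{x \<in> space (lborel \<Otimes>\<^sub>M lborel). ?G (fst x + snd x *\<^sub>R d)} \<in> sets (lborel \<Otimes>\<^sub>M lborel)"
      unfolding pred_def .
  qed
  \<comment> \<open>One good \<open>t\<close> is enough, because Lebesgue measure is invariant under
    the shift by \<open>t *\<^sub>R d\<close>.\<close>
  then obtain t :: real where "AE z in lborel. ?G (z + t *\<^sub>R d)"
    using eventually_happens'[of "ae_filter (lborel :: real measure)"]
    by (auto simp: ae_filter_eq_bot_iff)
  then have "AE z in lborel. ?G z"
    using AE_lborel_add[of "\<lambda>z. ?G (z + t *\<^sub>R d)" "- (t *\<^sub>R d)"] by simp
  then show ?thesis by eventually_elim (auto dest: has_dirderiv_imp)
qed

end

section \<open>Almost everywhere linearity of the directional derivative\<close>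

lemma integrable_bounded_by_indicator:
  fixes F :: "'a::euclidean_space \<Rightarrow> real"
  assumes [measurable]: "F \<in> borel_measurable borel" and "bounded S" "S \<in> sets borel"
    and "\<And>z. \<bar>F z\<bar> \<le> c * indicator S z"
  shows "integrable lborel F"
proof (rule Bochner_Integration.integrable_bound[of _ "\<lambda>z. c * indicator S z"])
  have "emeasure lborel S < \<infinity>" using assms by (intro emeasure_bounded_finite)
  then show "integrable lborel (\<lambda>z. c * indicator S z :: real)"
    using assms by (intro integrable_mult_right integrable_real_indicator) auto
  show "AE x in lborel. norm (F x) \<le> norm (c * indicator S x :: real)"
    using assms(4) by (intro AE_I2) (simp, smt (verit))
qed auto

text \<open>The density \<open>1 + h / C\<close> defines a measure that agrees with \<open>lborel\<close> on boxes.\<close>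

lemma AE_zero_if_box_integrals_zero:
  fixes h :: "'a::euclidean_space \<Rightarrow> real"
  assumes [measurable]: "h \<in> borel_measurable borel" and bd: "\<And>z. \<bar>h z\<bar> \<le> c"
    and box: "\<And>l u. (\<integral>z. indicator (box l u) z * h z \<partial>lborel) = 0"
  shows "AE z in lborel. h z = 0"
proof -
  \<comment> \<open>The strict excess over \<open>c\<close> keeps the density nonnegative and
    \<open>C\<close> positive, even for \<open>c = 0\<close>.\<close>
  define C where "C = c + 1"
  have "c \<ge> 0" using bd[of 0] by linarith
  then have C: "C > 0" by (simp add: C_def)
  have hC: "\<bar>h z\<bar> < C" for z using bd[of z] by (simp add: C_def)
  define k where "k = (\<lambda>z. 1 + h z / C)"
  have [measurable]: "k \<in> borel_measurable borel" unfolding k_def by measurable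
  have k0: "k z \<ge> 0" "k z \<le> 2" for z
    using C hC[of z] by (auto simp: k_def field_simps abs_less_iff)
  have "lborel = density lborel (\<lambda>z. ennreal (k z))"
  proof (rule lborel_eqI)
    fix l u :: 'a assume lu: "\<And>b. b \<in> Basis \<Longrightarrow> l \<bullet> b \<le> u \<bullet> b"
    have int1: "integrable lborel (\<lambda>z. indicator (box l u) z :: real)"
      by (intro integrable_real_indicator emeasure_bounded_finite) auto
    have inth: "integrable lborel (\<lambda>z. indicator (box l u) z * h z)"
      by (rule integrable_bounded_by_indicator[of _ "box l u" c]) (use bd in \<open>auto simp: indicator_def\<close>)
    have "emeasure (density lborel (\<lambda>z. ennreal (k z))) (box l u) = (\<integral>\<^sup>+z. ennreal (indicator (box l u) z * k z) \<partial>lborel)"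
      by (subst emeasure_density) (auto intro!: nn_integral_cong simp: indicator_def)
    also have "\<dots> = ennreal (\<integral>z. indicator (box l u) z * k z \<partial>lborel)"
    proof (rule nn_integral_eq_integral)
      have "integrable lborel (\<lambda>z. indicator (box l u) z + indicator (box l u) z * h z / C)"
        by (intro Bochner_Integration.integrable_add int1 integrable_divide inth)
      then show "integrable lborel (\<lambda>z. indicator (box l u) z * k z)"
        by (simp add: k_def algebra_simps)
    qed (use k0 in auto)
    also have "(\<integral>z. indicator (box l u) z * k z \<partial>lborel)
       = (\<integral>z. indicator (box l u) z + indicator (box l u) z * h z / C \<partial>lborel)"
      by (simp add: k_def algebra_simps)
    also have "\<dots> = (\<integral>z. indicator (box l u) z \<partial>lborel) + (\<integral>z. indicator (box l u) z * h z \<partial>lborel) / C"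
      by (subst Bochner_Integration.integral_add) (auto intro!: int1 integrable_divide inth)
    also have "\<dots> = measure lborel (box l u)" by (simp add: box)
    also have "ennreal \<dots> = (\<Prod>b\<in>Basis. (u - l) \<bullet> b)"
      using lu by (simp add: measure_lborel_box_eq inner_diff_left prod_ennreal)
    finally show "emeasure (density lborel (\<lambda>z. ennreal (k z))) (box l u) = (\<Prod>b\<in>Basis. (u - l) \<bullet> b)" .
  qed simp
  then have "density lborel (\<lambda>z. 1) = density lborel (\<lambda>z. ennreal (k z))" by (simp add: density_1)
  then have "AE z in lborel. 1 = ennreal (k z)"
    by (intro sigma_finite_measure.density_unique[OF sigma_finite_lborel]) auto
  then show ?thesis
  proof eventually_elim
    case (elim z)
    then have "k z = 1" using k0(1)[of z] by (metis ennreal_1 ennreal_inj zero_le_one)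
    then show "h z = 0" using C by (simp add: k_def)
  qed
qed

lemma integral_lborel_translation:
  fixes F :: "'a::euclidean_space \<Rightarrow> real"
  assumes [measurable]: "F \<in> borel_measurable borel"
  shows "(\<integral>z. F (z + c) \<partial>lborel) = (\<integral>z. F z \<partial>lborel)"
proof -
  have "(\<integral>z. F z \<partial>lborel) = (\<integral>z. F z \<partial>distr lborel borel ((+) c))" by (simp add: lborel_distr_plus)
  also have "\<dots> = (\<integral>z. F (c + z) \<partial>lborel)" by (rule integral_distr) auto
  finally show ?thesis by (simp add: add.commute)
qed

lemma has_dirderiv_bound:
  assumes lip: "L-lipschitz_on UNIV g" and "has_dirderiv g d z l"
  shows "\<bar>l\<bar> \<le> L * norm d"
proof -
  have "(\<lambda>n. \<bar>diffquot g d z (inverse (real (Suc n)))\<bar>) \<longlonglongrightarrow> \<bar>l\<bar>"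
    by (intro tendsto_intros has_dirderiv_seq assms)
  then show ?thesis by (rule LIMSEQ_le_const2) (use diffquot_bound[OF lip] in auto)
qed

text \<open>Additivity is tested weakly, against indicators of boxes. At step \<open>t\<close> the
  quotient along \<open>u + v\<close> minus the quotient along \<open>u\<close> is the quotient
  along \<open>v\<close> at the shifted point \<open>z + t *\<^sub>R u\<close>. Translating the
  integral moves the shift onto the indicator, and the shifted indicator converges off the boundary
  of the box.\<close>

lemma AE_dirderiv_add:
  fixes g :: "'a::euclidean_space \<Rightarrow> real"
  assumes lip: "L-lipschitz_on UNIV g"
  shows "AE z in lborel. dirderiv g (u + v) z = dirderiv g u z + dirderiv g v z"
proof -
  note [measurable] = dirderiv_borel[OF lip] diffquot_borel[OF lip]
  have L: "L \<ge> 0" by (rule lipschitz_on_nonneg[OF lip])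
  define t where "t = (\<lambda>n. inverse (real (Suc n)))"
  have t: "t n > 0" "t n \<le> 1" for n by (auto simp: t_def field_simps)
  have tlim: "t \<longlonglongrightarrow> 0" unfolding t_def by (rule LIMSEQ_inverse_real_of_nat)
  define h0 where "h0 = (\<lambda>z. dirderiv g (u + v) z - dirderiv g u z - dirderiv g v z)"
  define c where "c = L * norm (u + v) + L * norm u + L * norm v"
  \<comment> \<open>\<open>dirderiv\<close> is arbitrary where the limit fails to exist. Cutting off
    at \<open>c\<close> gives a function bounded everywhere that still equals the defect almost
    everywhere.\<close>
  define h where "h = (\<lambda>z. if \<bar>h0 z\<bar> \<le> c then h0 z else 0)"
  have [measurable]: "h \<in> borel_measurable borel" unfolding h_def h0_def by measurable
  have c: "c \<ge> 0" using L by (auto simp: c_def)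
  have ae: "AE z in lborel. has_dirderiv g (u + v) z (dirderiv g (u + v) z) \<and>
      has_dirderiv g u z (dirderiv g u z) \<and> has_dirderiv g v z (dirderiv g v z)"
    by (intro AE_conjI AE_has_dirderiv[OF lip])
  have hh0: "AE z in lborel. h z = h0 z" using ae
  proof eventually_elim
    case (elim z)
    then have "\<bar>dirderiv g (u + v) z\<bar> \<le> L * norm (u + v)" "\<bar>dirderiv g u z\<bar> \<le> L * norm u"
      "\<bar>dirderiv g v z\<bar> \<le> L * norm v" using has_dirderiv_bound[OF lip] by blast+
    then have "\<bar>h0 z\<bar> \<le> c" unfolding h0_def c_def by linarith
    then show ?case by (simp add: h_def)
  qed
  have "AE z in lborel. h z = 0"
  proof (rule AE_zero_if_box_integrals_zero)
    show "\<bar>h z\<bar> \<le> c" for z using c by (simp add: h_def)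
    fix l r :: 'a
    define B where "B = box l r"
    have [measurable]: "B \<in> sets borel" and Bbd: "bounded B" by (auto simp: B_def)
    define F where "F = (\<lambda>n z. indicator B z * (diffquot g (u + v) z (t n) - diffquot g u z (t n) - diffquot g v z (t n)))"
    have "(\<lambda>n. \<integral>z. F n z \<partial>lborel) \<longlonglongrightarrow> (\<integral>z. indicator B z * h z \<partial>lborel)"
    proof (rule integral_dominated_convergence[where w = "\<lambda>z. c * indicator B z"])
      show "integrable lborel (\<lambda>z. c * indicator B z)"
        by (rule integrable_bounded_by_indicator[of _ B c]) (use c Bbd in \<open>auto simp: abs_mult\<close>)
      show "AE z in lborel. (\<lambda>n. F n z) \<longlonglongrightarrow> indicator B z * h z"
        using ae hh0
      proof eventually_elim
        case (elim z)
        then show ?case unfolding F_def t_def h0_def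
          by (simp only: elim(2)[unfolded h0_def]) (intro tendsto_intros has_dirderiv_seq; blast)
      qed
      show "AE z in lborel. norm (F n z) \<le> c * indicator B z" for n
      proof (rule AE_I2)
        fix z
        have "\<bar>diffquot g (u + v) z (t n) - diffquot g u z (t n) - diffquot g v z (t n)\<bar> \<le> c"
          using diffquot_bound[OF lip, of "u+v" z "t n"] diffquot_bound[OF lip, of u z "t n"]
            diffquot_bound[OF lip, of v z "t n"] unfolding c_def by linarith
        then show "norm (F n z) \<le> c * indicator B z" by (simp add: F_def indicator_def)
      qed
    qed (simp_all add: F_def)
    moreover have "(\<lambda>n. \<integral>z. F n z \<partial>lborel) \<longlonglongrightarrow> 0"
    proof -
      define G where "G = (\<lambda>n z. (indicator B (z - t n *\<^sub>R u) - indicator B z) * diffquot g v z (t n))"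
      obtain b where b: "\<And>z. z \<in> B \<Longrightarrow> norm z \<le> b" using Bbd by (auto simp: bounded_iff)
      \<comment> \<open>The steps satisfy \<open>t n \<le> 1\<close>, so this one ball contains
        \<open>B\<close> and all its translates, and one integrable function dominates the whole
        sequence.\<close>
      define S where "S = cball (0::'a) (b + norm u)"
      have inS: "z \<in> S" if "z - t n *\<^sub>R u \<in> B \<or> z \<in> B" for z n
      proof -
        have "norm (t n *\<^sub>R u) \<le> norm u" using t[of n] by (simp add: mult_left_le_one_le)
        then show ?thesis
          using that b[of z] b[of "z - t n *\<^sub>R u"] norm_triangle_ineq[of "z - t n *\<^sub>R u" "t n *\<^sub>R u"]
          by (auto simp: S_def intro: order_trans)
      qed
      have bnd: "\<bar>indicator B (z - t n *\<^sub>R u) * diffquot g v z (t n)\<bar> \<le> (L * norm v) * indicator S z"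
          "\<bar>indicator B z * diffquot g v z (t n)\<bar> \<le> (L * norm v) * indicator S z" for n z
        using inS[of z n] diffquot_bound[OF lip, of v z "t n"] L by (auto simp: indicator_def)
      have Sb: "bounded S" "S \<in> sets borel" by (auto simp: S_def)
      have eq: "(\<integral>z. F n z \<partial>lborel) = (\<integral>z. G n z \<partial>lborel)" for n
      proof -
        have q: "diffquot g (u + v) z (t n) - diffquot g u z (t n) = diffquot g v (z + t n *\<^sub>R u) (t n)" for z
          by (simp add: diffquot_def diff_divide_distrib[symmetric] algebra_simps)
        have i1: "integrable lborel (\<lambda>z. indicator B (z - t n *\<^sub>R u) * diffquot g v z (t n))"
          by (rule integrable_bounded_by_indicator[OF _ Sb bnd(1)]) measurable
        have i2: "integrable lborel (\<lambda>z. indicator B z * diffquot g v z (t n))"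
          by (rule integrable_bounded_by_indicator[OF _ Sb bnd(2)]) measurable
        have i3: "integrable lborel (\<lambda>z. indicator B z * diffquot g v (z + t n *\<^sub>R u) (t n))"
          by (rule integrable_bounded_by_indicator[OF _ Bbd, of _ "L * norm v"])
            (use diffquot_bound[OF lip, of v _ "t n"] in \<open>auto simp: indicator_def\<close>)
        have "(\<integral>z. F n z \<partial>lborel) =
           (\<integral>z. indicator B z * diffquot g v (z + t n *\<^sub>R u) (t n) - indicator B z * diffquot g v z (t n) \<partial>lborel)"
          unfolding F_def by (simp add: q algebra_simps)
        also have "\<dots> = (\<integral>z. indicator B z * diffquot g v (z + t n *\<^sub>R u) (t n) \<partial>lborel)
            - (\<integral>z. indicator B z * diffquot g v z (t n) \<partial>lborel)"
          by (rule Bochner_Integration.integral_diff[OF i3 i2])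
        also have "(\<integral>z. indicator B z * diffquot g v (z + t n *\<^sub>R u) (t n) \<partial>lborel)
          = (\<integral>z. indicator B (z - t n *\<^sub>R u) * diffquot g v z (t n) \<partial>lborel)"
          using integral_lborel_translation[of "\<lambda>z. indicator B (z - t n *\<^sub>R u) * diffquot g v z (t n)" "t n *\<^sub>R u"]
          by simp
        also have "\<dots> - (\<integral>z. indicator B z * diffquot g v z (t n) \<partial>lborel) = (\<integral>z. G n z \<partial>lborel)"
          unfolding G_def using Bochner_Integration.integral_diff[OF i1 i2] by (simp add: algebra_simps)
        finally show ?thesis .
      qed
      have "(\<lambda>n. \<integral>z. G n z \<partial>lborel) \<longlonglongrightarrow> (\<integral>z. 0 \<partial>(lborel :: 'a measure))"
      proof (rule integral_dominated_convergence[where s = G and f = "\<lambda>z. 0" and w = "\<lambda>z. (2 * L * norm v) * indicator S z"])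
        show "integrable lborel (\<lambda>z. (2 * L * norm v) * indicator S z)"
          by (rule integrable_bounded_by_indicator[OF _ Sb]) (use L Sb in \<open>auto simp: indicator_def\<close>)
        show "AE z in lborel. norm (G n z) \<le> 2 * L * norm v * indicator S z" for n
        proof (rule AE_I2)
          fix z
          have "\<bar>G n z\<bar> \<le> L * norm v * indicator S z + L * norm v * indicator S z"
            using bnd[of z n] unfolding G_def left_diff_distrib by linarith
          then show "norm (G n z) \<le> 2 * L * norm v * indicator S z" by simp
        qed
        \<comment> \<open>The indicator of an open box is locally constant off this boundary, so
          there \<open>G n z\<close> is eventually zero.\<close>
        have "cbox l r - box l r \<in> null_sets lebesgue"
          using negligible_frontier_interval negligible_iff_null_sets by blast
        then have "AE z in lebesgue. z \<notin> cbox l r - box l r" by (rule AE_not_in)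
        then have "AE z in lborel. z \<notin> cbox l r - box l r" by (simp add: AE_completion_iff)
        then show "AE z in lborel. (\<lambda>n. G n z) \<longlonglongrightarrow> 0"
        proof eventually_elim
          case (elim z)
          have zl: "(\<lambda>n. z - t n *\<^sub>R u) \<longlonglongrightarrow> z" using tlim by (auto intro!: tendsto_eq_intros)
          have "\<forall>\<^sub>F n in sequentially. indicator B (z - t n *\<^sub>R u) = (indicator B z :: real)"
          proof (cases "z \<in> B")
            case True
            then have "\<forall>\<^sub>F n in sequentially. z - t n *\<^sub>R u \<in> B"
              using topological_tendstoD[OF zl, of B] by (simp add: B_def open_box)
            then show ?thesis by eventually_elim (use True in simp)
          next
            case False
            then have "z \<in> - cbox l r" using elim by (auto simp: B_def)
            then have "\<forall>\<^sub>F n in sequentially. z - t n *\<^sub>R u \<in> - cbox l r"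
              using topological_tendstoD[OF zl, of "- cbox l r"] by (simp add: open_Compl closed_cbox)
            then show ?thesis
              by eventually_elim (use False box_subset_cbox[of l r] in \<open>auto simp: B_def indicator_def\<close>)
          qed
          then have "\<forall>\<^sub>F n in sequentially. G n z = 0"
            by eventually_elim (simp add: G_def)
          then show ?case by (rule tendsto_eventually)
        qed
      qed (simp_all add: G_def)
      then show ?thesis by (simp add: eq)
    qed
    ultimately show "(\<integral>z. indicator (box l r) z * h z \<partial>lborel) = 0"
      unfolding B_def by (rule LIMSEQ_unique)
  qed simp
  with hh0 show ?thesis by eventually_elim (simp add: h0_def)
qed

lemma AE_dirderiv_sum:
  fixes g :: "'a::euclidean_space \<Rightarrow> real"
  assumes lip: "L-lipschitz_on UNIV g" and "finite B"
  shows "AE z in lborel. dirderiv g (\<Sum>b\<in>B. x b *\<^sub>R b) z = (\<Sum>b\<in>B. x b * dirderiv g b z)"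
  using \<open>finite B\<close>
proof induction
  case empty
  have "has_dirderiv g 0 z 0" for z by (simp add: has_dirderiv_def diffquot_def[abs_def])
  then show ?case by (simp add: has_dirderiv_imp)
next
  case (insert b B)
  from AE_dirderiv_add[OF lip, of "x b *\<^sub>R b" "\<Sum>b\<in>B. x b *\<^sub>R b"] AE_has_dirderiv[OF lip, of b] insert.IH
  show ?case
  proof eventually_elim
    case (elim z)
    from has_dirderiv_imp[OF has_dirderiv_scaleR[OF elim(2), of "x b"]] elim insert.hyps
    show ?case by simp
  qed
qed

text \<open>Almost everywhere, the derivatives along a countable dense set of directions all come
  from one vector \<open>a\<close>. The Lipschitz bound and compactness of the unit sphere make the
  convergence uniform in the direction, which is Frechet differentiability.\<close>

theorem rademacher_real:
  fixes g :: "'a::euclidean_space \<Rightarrow> real"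
  assumes lip: "L-lipschitz_on UNIV g"
  shows "AE z in lborel. \<exists>g'. (g has_derivative g') (at z)"
proof -
  have L: "L \<ge> 0" by (rule lipschitz_on_nonneg[OF lip])
  obtain D :: "'a set" where D: "countable D" "\<And>X. open X \<Longrightarrow> X \<noteq> {} \<Longrightarrow> \<exists>d\<in>D. d \<in> X"
    using countable_dense_setE by blast
  have "AE z in lborel. \<forall>d\<in>D. has_dirderiv g d z (\<Sum>b\<in>Basis. (d \<bullet> b) * dirderiv g b z)"
  proof (subst AE_ball_countable[OF D(1)], rule ballI)
    fix d
    from AE_dirderiv_sum[OF lip finite_Basis, of "\<lambda>b. d \<bullet> b"] AE_has_dirderiv[OF lip, of d]
    show "AE z in lborel. has_dirderiv g d z (\<Sum>b\<in>Basis. (d \<bullet> b) * dirderiv g b z)"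
      by eventually_elim (simp add: euclidean_representation)
  qed
  then show ?thesis
  proof eventually_elim
    case (elim z)
    define a where "a = (\<Sum>b\<in>Basis. dirderiv g b z *\<^sub>R b)"
    have dd: "has_dirderiv g d z (a \<bullet> d)" if "d \<in> D" for d
      using elim that by (simp add: a_def inner_sum_right mult.commute inner_commute[of _ d])
    have "(g has_derivative (\<lambda>y. a \<bullet> y)) (at z)"
      unfolding has_derivative_at_alt
    proof (intro conjI allI impI)
      show "bounded_linear (\<lambda>y. a \<bullet> y)" by (rule bounded_linear_inner_right)
      fix e :: real assume e: "e > 0"
      \<comment> \<open>Replacing the direction \<open>w\<close> by a nearby \<open>d\<close> costs
        three errors: 1 from the quotient along \<open>d\<close>, \<open>L\<close> from
        \<open>g\<close>, and \<open>norm a\<close> from the linear part, each times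
        \<open>e1\<close>.\<close>
      define e1 where "e1 = e / (L + norm a + 1)"
      have e1: "e1 > 0" "e1 * (L + norm a + 1) = e"
        using e add_nonneg_pos[of "L + norm a" 1] L by (auto simp: e1_def)
      have "sphere (0::'a) 1 \<subseteq> (\<Union>d\<in>D. ball d e1)"
      proof
        fix w :: 'a
        obtain d where "d \<in> D" "d \<in> ball w e1" using D(2)[of "ball w e1"] e1 by auto
        then show "w \<in> (\<Union>d\<in>D. ball d e1)" by (auto simp: dist_commute)
      qed
      then obtain F where F: "F \<subseteq> D" "finite F" "sphere 0 1 \<subseteq> (\<Union>d\<in>F. ball d e1)"
        using compactE_image[OF compact_sphere, of D "\<lambda>d. ball d e1" 0 1] by (metis open_ball)
      have "\<forall>\<^sub>F t in at 0. \<forall>d\<in>F. dist (diffquot g d z t) (a \<bullet> d) < e1"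
        using F dd e1 by (subst eventually_ball_finite_distrib) (auto simp: has_dirderiv_def intro!: tendstoD)
      then obtain r where r: "r > 0" "\<And>t d. t \<noteq> 0 \<Longrightarrow> \<bar>t\<bar> < r \<Longrightarrow> d \<in> F \<Longrightarrow> dist (diffquot g d z t) (a \<bullet> d) < e1"
        unfolding eventually_at by (auto simp: dist_real_def)
      show "\<exists>d>0. \<forall>y. norm (y - z) < d \<longrightarrow> norm (g y - g z - a \<bullet> (y - z)) \<le> e * norm (y - z)"
      proof (intro exI[of _ r] conjI allI impI r(1))
        fix y assume y: "norm (y - z) < r"
        show "norm (g y - g z - a \<bullet> (y - z)) \<le> e * norm (y - z)"
        proof (cases "y = z")
          case False
          define s where "s = norm (y - z)"
          define w where "w = (y - z) /\<^sub>R s"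
          have s: "s > 0" "s < r" using False y by (auto simp: s_def)
          have yw: "y = z + s *\<^sub>R w" using s by (simp add: w_def)
          have "norm w = 1" using s by (simp add: w_def s_def)
          then obtain d where d: "d \<in> F" "norm (w - d) < e1" using F(3) by (force simp: dist_norm norm_minus_commute)
          have "\<bar>diffquot g d z s - a \<bullet> d\<bar> < e1" using r(2)[of s d] s d by (simp add: dist_real_def)
          then have "\<bar>s * (diffquot g d z s - a \<bullet> d)\<bar> \<le> s * e1" using s by (simp add: abs_mult)
          moreover have "s * (diffquot g d z s - a \<bullet> d) = g (z + s *\<^sub>R d) - g z - s * (a \<bullet> d)"
            using s by (simp add: diffquot_def field_simps)
          ultimately have 1: "\<bar>g (z + s *\<^sub>R d) - g z - s * (a \<bullet> d)\<bar> \<le> s * e1" by simp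
          have "\<bar>g y - g (z + s *\<^sub>R d)\<bar> \<le> L * norm (s *\<^sub>R (w - d))"
            using lipschitz_onD[OF lip, of y "z + s *\<^sub>R d"] by (simp add: dist_real_def dist_norm yw algebra_simps)
          also have "\<dots> \<le> L * (s * e1)" using d s L by (intro mult_left_mono) auto
          finally have 2: "\<bar>g y - g (z + s *\<^sub>R d)\<bar> \<le> L * (s * e1)" .
          have "\<bar>s * (a \<bullet> d) - a \<bullet> (y - z)\<bar> = s * \<bar>a \<bullet> (d - w)\<bar>"
            using s by (simp add: yw inner_diff_right abs_mult flip: right_diff_distrib)
          also have "\<dots> \<le> s * (norm a * e1)"
          proof (intro mult_left_mono)
            have "\<bar>a \<bullet> (d - w)\<bar> \<le> norm a * norm (d - w)" by (rule Cauchy_Schwarz_ineq2)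
            also have "\<dots> \<le> norm a * e1" using d by (intro mult_left_mono) (auto simp: norm_minus_commute)
            finally show "\<bar>a \<bullet> (d - w)\<bar> \<le> norm a * e1" .
          qed (use s in auto)
          finally have 3: "\<bar>s * (a \<bullet> d) - a \<bullet> (y - z)\<bar> \<le> s * (norm a * e1)" .
          have "\<bar>g y - g z - a \<bullet> (y - z)\<bar> \<le> s * e1 + L * (s * e1) + s * (norm a * e1)"
            using 1 2 3 by linarith
          also have "\<dots> = s * (e1 * (L + norm a + 1))" by (simp add: algebra_simps)
          also have "\<dots> = e * s" by (simp add: e1)
          finally show ?thesis by (simp add: s_def)
        qed simp
      qed
    qed
    then show ?case by blast
  qed
qed

theorem rademacher:
  fixes g :: "'a::euclidean_space \<Rightarrow> 'b::euclidean_space"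
  assumes lip: "L-lipschitz_on UNIV g"
  shows "AE z in lborel. \<exists>g'. (g has_derivative g') (at z)"
proof -
  have "AE z in lborel. \<forall>b\<in>Basis. \<exists>g'. ((\<lambda>x. g x \<bullet> b) has_derivative g') (at z)"
  proof (subst AE_ball_countable[OF countable_finite[OF finite_Basis]], rule ballI, rule rademacher_real)
    fix b :: 'b assume b: "b \<in> Basis"
    show "L-lipschitz_on UNIV (\<lambda>x. g x \<bullet> b)"
    proof (rule lipschitz_onI)
      fix x y
      have "dist (g x \<bullet> b) (g y \<bullet> b) \<le> norm (g x - g y)"
        using Basis_le_norm[OF b, of "g x - g y"] by (simp add: dist_real_def inner_diff_left)
      also have "\<dots> \<le> L * dist x y" using lipschitz_onD[OF lip, of x y] by (simp add: dist_norm)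
      finally show "dist (g x \<bullet> b) (g y \<bullet> b) \<le> L * dist x y" .
    qed (rule lipschitz_on_nonneg[OF lip])
  qed
  then show ?thesis
  proof eventually_elim
    case (elim z)
    then obtain g' where g': "\<And>b. b \<in> Basis \<Longrightarrow> ((\<lambda>x. g x \<bullet> b) has_derivative g' b) (at z)" by metis
    have "((\<lambda>x. \<Sum>b\<in>Basis. (g x \<bullet> b) *\<^sub>R b) has_derivative (\<lambda>y. \<Sum>b\<in>Basis. g' b y *\<^sub>R b)) (at z)"
      by (intro has_derivative_sum has_derivative_scaleR_left g')
    then show ?case by (auto simp: euclidean_representation)
  qed
qed

section \<open>From an almost everywhere derivative bound to an inequality on segments\<close>

lemma has_derivative_imp_has_dirderiv:
  assumes "(g has_derivative g') (at z)"
  shows "has_dirderiv g d z (g' d)"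
proof -
  have lin: "linear g'" using assms has_derivative_linear by blast
  have "((\<lambda>t. g (z + t *\<^sub>R d)) has_derivative (\<lambda>t. g' (t *\<^sub>R d))) (at 0)"
    by (rule has_derivative_compose[of "\<lambda>t. z + t *\<^sub>R d" "\<lambda>t. t *\<^sub>R d" 0 UNIV g g'])
      (auto intro!: derivative_eq_intros assms)
  then have "((\<lambda>t. g (z + t *\<^sub>R d)) has_real_derivative g' d) (at 0)"
    using linear_scale[OF lin] by (simp add: has_field_derivative_def mult_commute_abs)
  then show ?thesis
    unfolding DERIV_def has_dirderiv_def diffquot_def[abs_def] by simp
qed

text \<open>Averaging over a small ball \<open>Q\<close> replaces the almost everywhere derivative along the segment by a
  genuine derivative of \<open>\<lambda>s. \<integral>\<^sub>Q P (z + s *\<^sub>R d) \<bullet> d\<close>, so the mean value theorem applies.\<close>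

lemma inner_diff_le_if_derivative_le:
  fixes P :: "'a::euclidean_space \<Rightarrow> 'a"
  assumes lipP: "M-lipschitz_on UNIV P" and S: "open S" "convex S"
    and bd: "\<And>z A \<zeta>. z \<in> S \<Longrightarrow> (P has_derivative A) (at z) \<Longrightarrow> A \<zeta> \<bullet> \<zeta> \<le> c * (norm \<zeta>)\<^sup>2"
    and z: "z1 \<in> S" "z2 \<in> S"
  shows "(P z2 - P z1) \<bullet> (z2 - z1) \<le> c * (norm (z2 - z1))\<^sup>2"
proof (rule ccontr)
  define d where "d = z2 - z1"
  define g where "g = (\<lambda>z. P z \<bullet> d)"
  define L where "L = M * norm d"
  have M: "M \<ge> 0" by (rule lipschitz_on_nonneg[OF lipP])
  have lip: "L-lipschitz_on UNIV g"
  proof (rule lipschitz_onI)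
    fix x y
    have "dist (g x) (g y) \<le> norm (P x - P y) * norm d"
      unfolding g_def dist_real_def inner_diff_left[symmetric] by (rule Cauchy_Schwarz_ineq2)
    also have "\<dots> \<le> (M * dist x y) * norm d"
      using lipschitz_onD[OF lipP, of x y] by (intro mult_right_mono) (auto simp: dist_norm)
    finally show "dist (g x) (g y) \<le> L * dist x y" by (simp add: L_def mult_ac)
  qed (use M in \<open>auto simp: L_def\<close>)
  note [measurable] = lip_borel[OF lip] dirderiv_borel[OF lip] diffquot_borel[OF lip]
  define \<psi> where "\<psi> = (\<lambda>z. g (z + d) - g z - c * (norm d)\<^sup>2)"
  assume "\<not> ?thesis"
  then have "\<psi> z1 > 0" by (simp add: \<psi>_def g_def d_def inner_diff_left)
  \<comment> \<open>By continuity at least half of the violation at \<open>z1\<close> persists for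
    all starting points in a small ball. The positive measure of that ball turns the averaged
    inequality into a contradiction.\<close>
  define \<tau> where "\<tau> = \<psi> z1 / 2"
  have \<tau>: "\<tau> > 0" "\<tau> < \<psi> z1" using \<open>\<psi> z1 > 0\<close> by (auto simp: \<tau>_def)
  have contg: "continuous_on UNIV g" by (rule lip_continuous[OF lip])
  have "continuous_on UNIV \<psi>" unfolding \<psi>_def
    by (intro continuous_intros continuous_on_compose2[OF contg]) auto
  then have "open {z. \<tau> < \<psi> z}" by (intro open_Collect_less continuous_intros)
  moreover have "open ((\<lambda>z. z + d) -` S)" using S(1) by (intro open_vimage continuous_intros)
  ultimately have "open ({z. \<tau> < \<psi> z} \<inter> S \<inter> (\<lambda>z. z + d) -` S)" using S(1) by blast
  moreover have "z1 \<in> {z. \<tau> < \<psi> z} \<inter> S \<inter> (\<lambda>z. z + d) -` S" using z \<tau> by (auto simp: d_def)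
  ultimately obtain r where r: "r > 0" "ball z1 r \<subseteq> {z. \<tau> < \<psi> z} \<inter> S \<inter> (\<lambda>z. z + d) -` S"
    by (meson open_contains_ball)
  define Q where "Q = ball z1 r"
  have [measurable]: "Q \<in> sets borel" and Qb: "bounded Q" by (auto simp: Q_def)
  have Qfin: "emeasure lborel Q < \<infinity>" by (rule emeasure_bounded_finite[OF Qb])
  have Qpos: "measure lborel Q > 0" unfolding Q_def by (rule content_ball_pos[OF r(1)])
  have intQ: "integrable lborel (\<lambda>z. indicator Q z * C)" for C :: real
    using Qfin by (intro integrable_mult_left integrable_real_indicator) auto
  obtain b where b: "\<And>z. z \<in> Q \<Longrightarrow> norm z \<le> b" using Qb by (auto simp: bounded_iff)
  have intg: "integrable lborel (\<lambda>z. indicator Q z * g (z + a))" for a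
  proof (rule integrable_bounded_by_indicator[OF _ Qb])
    show "\<bar>indicator Q z * g (z + a)\<bar> \<le> (\<bar>g a\<bar> + L * b) * indicator Q z" for z
    proof (cases "z \<in> Q")
      case True
      have "\<bar>g (z + a) - g a\<bar> \<le> L * norm z"
        using lipschitz_onD[OF lip, of "z + a" a] by (simp add: dist_norm)
      also have "\<dots> \<le> L * b" using b[OF True] lipschitz_on_nonneg[OF lip] by (intro mult_left_mono) auto
      finally show ?thesis using True by simp
    qed simp
  qed auto
  define F where "F = (\<lambda>s. \<integral>z. indicator Q z * g (z + s *\<^sub>R d) \<partial>lborel)"
  define F' where "F' = (\<lambda>s. \<integral>z. indicator Q z * dirderiv g d (z + s *\<^sub>R d) \<partial>lborel)"
  have ae: "AE z in lborel. has_dirderiv g d (z + s *\<^sub>R d) (dirderiv g d (z + s *\<^sub>R d))" for s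
    by (rule AE_lborel_add[OF AE_has_dirderiv[OF lip]])
  have deriv: "(F has_real_derivative F' s) (at s)" for s
    unfolding DERIV_def tendsto_at_iff_sequentially
  proof (intro allI impI)
    fix X :: "nat \<Rightarrow> real" assume X: "\<forall>i. X i \<in> UNIV - {0}" "X \<longlonglongrightarrow> 0"
    have "((\<lambda>h. (F (s + h) - F s) / h) \<circ> X) i = (\<integral>z. indicator Q z * diffquot g d (z + s *\<^sub>R d) (X i) \<partial>lborel)" for i
    proof -
      have "F (s + X i) - F s = (\<integral>z. indicator Q z * g (z + (s + X i) *\<^sub>R d) - indicator Q z * g (z + s *\<^sub>R d) \<partial>lborel)"
        unfolding F_def by (rule Bochner_Integration.integral_diff[symmetric]; rule intg)
      then have "(F (s + X i) - F s) / X i =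
         (\<integral>z. (indicator Q z * g (z + (s + X i) *\<^sub>R d) - indicator Q z * g (z + s *\<^sub>R d)) / X i \<partial>lborel)"
        by simp
      also have "\<dots> = (\<integral>z. indicator Q z * diffquot g d (z + s *\<^sub>R d) (X i) \<partial>lborel)"
        by (simp add: diffquot_def scaleR_add_left add.assoc right_diff_distrib)
      finally show ?thesis by simp
    qed
    then have "((\<lambda>h. (F (s + h) - F s) / h) \<circ> X) = (\<lambda>i. \<integral>z. indicator Q z * diffquot g d (z + s *\<^sub>R d) (X i) \<partial>lborel)" by auto
    moreover have "\<dots> \<longlonglongrightarrow> F' s"
      unfolding F'_def
    proof (rule integral_dominated_convergence[where w = "\<lambda>z. indicator Q z * (L * norm d)"])
      show "AE z in lborel. (\<lambda>i. indicator Q z * diffquot g d (z + s *\<^sub>R d) (X i)) \<longlonglongrightarrow> indicator Q z * dirderiv g d (z + s *\<^sub>R d)"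
        using ae[of s]
      proof eventually_elim
        case (elim z)
        have "filterlim X (at 0) sequentially" using X by (auto simp: filterlim_at)
        with elim show ?case unfolding has_dirderiv_def
          by (intro tendsto_intros) (rule filterlim_compose)
      qed
      show "AE z in lborel. norm (indicator Q z * diffquot g d (z + s *\<^sub>R d) (X i)) \<le> indicator Q z * (L * norm d)" for i
        using diffquot_bound[OF lip] by (intro AE_I2) (auto simp: indicator_def)
    qed (use intQ in auto)
    ultimately show "((\<lambda>h. (F (s + h) - F s) / h) \<circ> X) \<longlonglongrightarrow> F' s" by simp
  qed
  \<comment> \<open>For almost every \<open>z\<close>, the map \<open>P\<close> has a derivative
    \<open>A\<close> at \<open>z + s *\<^sub>R d\<close>, and there the derivative of
    \<open>g\<close> along \<open>d\<close> is \<open>A d \<bullet> d\<close>. Convexity of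
    \<open>S\<close> keeps the point inside \<open>S\<close>.\<close>
  have F'le: "F' s \<le> measure lborel Q * (c * (norm d)\<^sup>2)" if s: "0 < s" "s < 1" for s
  proof -
    have "F' s \<le> (\<integral>z. indicator Q z * (c * (norm d)\<^sup>2) \<partial>lborel)" unfolding F'_def
    proof (rule integral_mono_AE)
      have aeb: "AE z in lborel. \<bar>dirderiv g d (z + s *\<^sub>R d)\<bar> \<le> L * norm d"
        using ae[of s] by eventually_elim (rule has_dirderiv_bound[OF lip])
      show "integrable lborel (\<lambda>z. indicator Q z * dirderiv g d (z + s *\<^sub>R d))"
      proof (rule Bochner_Integration.integrable_bound[OF intQ[of "L * norm d"]])
        show "AE z in lborel. norm (indicator Q z * dirderiv g d (z + s *\<^sub>R d)) \<le> norm (indicator Q z * (L * norm d))"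
          using aeb by eventually_elim (auto simp: indicator_def)
      qed auto
      show "AE z in lborel. indicator Q z * dirderiv g d (z + s *\<^sub>R d) \<le> indicator Q z * (c * (norm d)\<^sup>2)"
        using AE_lborel_add[OF rademacher[OF lipP], of "s *\<^sub>R d"]
      proof eventually_elim
        case (elim z)
        show ?case
        proof (cases "z \<in> Q")
          case True
          then have zz: "z \<in> S" "z + d \<in> S" using r(2) by (auto simp: Q_def)
          have "z + s *\<^sub>R d = (1 - s) *\<^sub>R z + s *\<^sub>R (z + d)" by (simp add: algebra_simps)
          then have zS: "z + s *\<^sub>R d \<in> S" using convexD[OF S(2) zz, of "1 - s" s] s by simp
          obtain A where A: "(P has_derivative A) (at (z + s *\<^sub>R d))" using elim by blast
          then have "(g has_derivative (\<lambda>y. A y \<bullet> d)) (at (z + s *\<^sub>R d))"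
            unfolding g_def by (rule has_derivative_inner_left)
          then have "dirderiv g d (z + s *\<^sub>R d) = A d \<bullet> d"
            by (intro has_dirderiv_imp has_derivative_imp_has_dirderiv)
          then show ?thesis using bd[OF zS A, of d] True by simp
        qed simp
      qed
    qed (rule intQ)
    then show ?thesis by simp
  qed
  obtain s where s: "0 < s" "s < 1" "F 1 - F 0 = (1 - 0) * F' s"
    using MVT2[of 0 1 F F'] deriv by auto
  have "measure lborel Q * (c * (norm d)\<^sup>2 + \<tau>) = (\<integral>z. indicator Q z * (c * (norm d)\<^sup>2 + \<tau>) \<partial>lborel)" by simp
  also have "\<dots> \<le> (\<integral>z. indicator Q z * g (z + 1 *\<^sub>R d) - indicator Q z * g (z + 0 *\<^sub>R d) \<partial>lborel)"
  proof (rule integral_mono)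
    fix z
    show "indicator Q z * (c * (norm d)\<^sup>2 + \<tau>) \<le> indicator Q z * g (z + 1 *\<^sub>R d) - indicator Q z * g (z + 0 *\<^sub>R d)"
    proof (cases "z \<in> Q")
      case True
      then have "\<tau> < \<psi> z" using r(2) by (auto simp: Q_def)
      then show ?thesis using True by (simp add: \<psi>_def)
    qed simp
  qed (rule intQ, intro Bochner_Integration.integrable_diff intg)
  also have "\<dots> = F 1 - F 0" unfolding F_def by (rule Bochner_Integration.integral_diff; rule intg)
  also have "\<dots> \<le> measure lborel Q * (c * (norm d)\<^sup>2)" using F'le[OF s(1,2)] s(3) by simp
  finally show False using mult_pos_pos[OF Qpos \<tau>(1)] by (simp add: distrib_left)
qed

subsection \<open>Generalized quadratic forms of positive semidefinite maps\<close>

definition psd :: "('a::euclidean_space \<Rightarrow> 'a) \<Rightarrow> bool" where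
  "psd A \<longleftrightarrow> linear A \<and> (\<forall>x y. A x \<bullet> y = x \<bullet> A y) \<and> (\<forall>x. 0 \<le> A x \<bullet> x)"

text \<open>The supremum over \<open>\<zeta>\<close> of
  \<open>2 * (w \<bullet> \<zeta>) - A \<zeta> \<bullet> \<zeta>\<close> is the conjugate of the
  quadratic form of \<open>A\<close>, taken at \<open>2 *\<^sub>R w\<close>. For invertible positive
  \<open>A\<close> it is the form of the inverse at \<open>w\<close>, so the whole supremum is the
  form of \<open>\<rho> * (A^-1 - I)\<close>.\<close>

definition dual_bound :: "real \<Rightarrow> ('a::euclidean_space \<Rightarrow> 'a) \<Rightarrow> 'a \<Rightarrow> 'a \<Rightarrow> real" where
  "dual_bound \<rho> A w \<zeta> = 2 * \<rho> * (w \<bullet> \<zeta>) - \<rho> * (A \<zeta> \<bullet> \<zeta>) - \<rho> * (norm w)\<^sup>2"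

text \<open>This will be the second subderivative of \<open>f\<close> where the proximal map with parameter \<open>1 / \<rho>\<close>
  has derivative \<open>A\<close>; as a supremum of functions continuous in \<open>A\<close> it behaves well under epi-limits.\<close>

definition dual_form :: "real \<Rightarrow> ('a::euclidean_space \<Rightarrow> 'a) \<Rightarrow> 'a \<Rightarrow> ereal" where
  "dual_form \<rho> A w = (SUP \<zeta>. ereal (dual_bound \<rho> A w \<zeta>))"

lemma dual_bound_le_dual_form: "ereal (dual_bound \<rho> A w \<zeta>) \<le> dual_form \<rho> A w"
  unfolding dual_form_def by (rule SUP_upper) simp

lemma dual_bound_range: "dual_bound \<rho> A (A \<xi>) \<xi> = \<rho> * (\<xi> \<bullet> A \<xi> - A \<xi> \<bullet> A \<xi>)"
  by (simp add: dual_bound_def power2_norm_eq_inner inner_commute algebra_simps)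

text \<open>The values of the bound at \<open>\<xi>\<close> and at \<open>\<zeta>\<close> differ by
  \<open>\<rho> * (A (\<xi> - \<zeta>) \<bullet> (\<xi> - \<zeta>))\<close>, which is nonnegative;
  hence \<open>\<xi>\<close> maximises.\<close>

lemma dual_form_range:
  assumes A: "psd A" and \<rho>: "\<rho> \<ge> 0"
  shows "dual_form \<rho> A (A \<xi>) = ereal (\<rho> * (\<xi> \<bullet> A \<xi> - A \<xi> \<bullet> A \<xi>))"
proof (rule antisym)
  have lin: "linear A" and sym: "\<And>x y. A x \<bullet> y = x \<bullet> A y" and pos: "\<And>x. 0 \<le> A x \<bullet> x"
    using A by (auto simp: psd_def)
  show "dual_form \<rho> A (A \<xi>) \<le> ereal (\<rho> * (\<xi> \<bullet> A \<xi> - A \<xi> \<bullet> A \<xi>))"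
    unfolding dual_form_def
  proof (rule SUP_least)
    fix \<zeta>
    have "0 \<le> \<rho> * (A (\<xi> - \<zeta>) \<bullet> (\<xi> - \<zeta>))" using pos \<rho> by simp
    also have "A (\<xi> - \<zeta>) \<bullet> (\<xi> - \<zeta>) = \<xi> \<bullet> A \<xi> - 2 * (A \<xi> \<bullet> \<zeta>) + A \<zeta> \<bullet> \<zeta>"
      using sym[of \<xi> \<zeta>] by (simp add: linear_diff[OF lin] inner_diff inner_commute)
    finally show "ereal (dual_bound \<rho> A (A \<xi>) \<zeta>) \<le> ereal (\<rho> * (\<xi> \<bullet> A \<xi> - A \<xi> \<bullet> A \<xi>))"
      by (simp add: dual_bound_def power2_norm_eq_inner algebra_simps)
  qed
  show "ereal (\<rho> * (\<xi> \<bullet> A \<xi> - A \<xi> \<bullet> A \<xi>)) \<le> dual_form \<rho> A (A \<xi>)"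
    using dual_bound_le_dual_form[of \<rho> A "A \<xi>" \<xi>] by (simp add: dual_bound_range)
qed

text \<open>Such a \<open>w\<close> has a nonzero component \<open>n\<close> orthogonal to the
  range. By symmetry \<open>A n = 0\<close>, so along multiples of \<open>n\<close> the bound is
  affine with positive slope.\<close>

lemma dual_bound_unbounded:
  assumes A: "psd A" and \<rho>: "\<rho> > 0" and w: "w \<notin> range A"
  shows "\<exists>\<zeta>. dual_bound \<rho> A w \<zeta> > C"
proof -
  have lin: "linear A" and sym: "\<And>x y. A x \<bullet> y = x \<bullet> A y" using A by (auto simp: psd_def)
  have sub: "subspace (range A)" by (rule linear_subspace_image[OF lin subspace_UNIV])
  obtain y n where yn: "y \<in> span (range A)" "\<And>u. u \<in> span (range A) \<Longrightarrow> orthogonal n u" "w = y + n"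
    using orthogonal_subspace_decomp_exists[of "range A" w] by blast
  have "y \<in> range A" using yn(1) sub by (metis span_eq_iff)
  then have n0: "n \<noteq> 0" using w yn(3) by auto
  have An: "A n = 0"
  proof -
    have "n \<bullet> A (A n) = 0" using yn(2)[of "A (A n)"] by (auto simp: orthogonal_def span_base)
    then show ?thesis using sym[of n "A n"] by simp
  qed
  have "orthogonal n y" using yn by blast
  then have wn: "w \<bullet> n = n \<bullet> n" using yn(3) by (simp add: orthogonal_def inner_add_left inner_add_right inner_commute)
  define s where "s = (C + \<rho> * (norm w)\<^sup>2 + 1) / (2 * \<rho> * (n \<bullet> n))"
  have "dual_bound \<rho> A w (s *\<^sub>R n) = s * (2 * \<rho> * (n \<bullet> n)) - \<rho> * (norm w)\<^sup>2"
    by (simp add: dual_bound_def wn linear_scale[OF lin] An)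
  also have "s * (2 * \<rho> * (n \<bullet> n)) = C + \<rho> * (norm w)\<^sup>2 + 1" using n0 \<rho> by (simp add: s_def)
  finally show ?thesis by (intro exI[of _ "s *\<^sub>R n"]) simp
qed

lemma dual_form_not_range:
  assumes "psd A" "\<rho> > 0" "w \<notin> range A"
  shows "dual_form \<rho> A w = \<infinity>"
proof (rule ereal_top)
  fix C :: real
  obtain \<zeta> where "C < dual_bound \<rho> A w \<zeta>" using dual_bound_unbounded[OF assms] by blast
  then show "ereal C \<le> dual_form \<rho> A w"
    using dual_bound_le_dual_form[of \<rho> A w \<zeta>] by (metis ereal_less_eq(3) less_imp_le order_trans)
qed

lemma domain_dual_form:
  assumes "psd A" "\<rho> > 0"
  shows "domain (dual_form \<rho> A) = range A"
  using dual_form_not_range[OF assms] dual_form_range[OF assms(1)] assms(2)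
  by (fastforce simp: domain_def)

lemma GQF_dual_form:
  assumes A: "psd A" and \<rho>: "\<rho> > 0"
  shows "GQF (dual_form \<rho> A)"
proof -
  have lin: "linear A" and sym: "\<And>x y. A x \<bullet> y = x \<bullet> A y" using A by (auto simp: psd_def)
  note dom = domain_dual_form[OF A \<rho>]
  have "dual_form \<rho> A x \<noteq> - \<infinity>" for x
    using dual_bound_le_dual_form[of \<rho> A x 0] by auto
  then have prp: "proper (dual_form \<rho> A)" by (simp add: proper_def dom)
  obtain B where B: "linear B" "\<And>w. w \<in> range A \<Longrightarrow> A (B w) = w"
    using linear_exists_right_inverse_on[OF lin subspace_UNIV] by blast
  \<comment> \<open>\<open>B\<close> is any linear right inverse of \<open>A\<close> on its range.
    The symmetry of \<open>A\<close> makes the form of \<open>B\<close> symmetric on that range,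
    whichever right inverse was chosen.\<close>
  define K where "K = (\<lambda>w. \<rho> *\<^sub>R (B w - w))"
  have "K (x + y) = K x + K y" for x y
    by (simp add: K_def linear_add[OF B(1)] algebra_simps)
  moreover have "K (c *\<^sub>R x) = c *\<^sub>R K x" for c x
    by (simp add: K_def linear_scale[OF B(1)] algebra_simps)
  moreover have "K x \<bullet> y = x \<bullet> K y" if "x \<in> range A" "y \<in> range A" for x y
  proof -
    have "B x \<bullet> y = x \<bullet> B y" using sym[of "B x" "B y"] B(2) that by simp
    then show ?thesis by (simp add: K_def inner_diff)
  qed
  moreover have "dual_form \<rho> A x = ereal (K x \<bullet> x)" if "x \<in> range A" for x
    using dual_form_range[OF A, of \<rho> "B x"] B(2)[OF that] \<rho>
    by (simp add: K_def inner_diff)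
  ultimately show ?thesis unfolding GQF_def dom
    using prp linear_subspace_image[OF lin subspace_UNIV] by blast
qed

text \<open>Pointwise convergence can fail, because the domains \<open>range (As k)\<close> vary and
  may shrink in the limit. Each single bound passes to the limit jointly in the map and the point,
  which controls the outer limit; the points \<open>As k \<xi>\<close> serve as recovery sequence
  for \<open>A \<xi>\<close>.\<close>

lemma epi_converges_dual_form:
  fixes As :: "nat \<Rightarrow> 'a::euclidean_space \<Rightarrow> 'a"
  assumes As: "\<And>k. psd (As k)" and A: "psd A" and \<rho>: "\<rho> > 0"
    and lim: "\<And>x. (\<lambda>k. As k x) \<longlonglongrightarrow> A x"
  shows "epi_converges (\<lambda>k. dual_form \<rho> (As k)) (dual_form \<rho> A)"
proof -
  let ?C = "\<lambda>k. epi (dual_form \<rho> (As k))"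
  have "inner_limit ?C \<subseteq> outer_limit ?C"
  proof
    fix z assume "z \<in> inner_limit ?C"
    then obtain zs where zs: "zs \<longlonglongrightarrow> z" "\<forall>\<^sub>F k in sequentially. zs k \<in> ?C k"
      by (auto simp: inner_limit_def)
    then obtain N where N: "\<And>k. k \<ge> N \<Longrightarrow> zs k \<in> ?C k" by (auto simp: eventually_sequentially)
    have "strict_mono (\<lambda>k. k + N)" by (simp add: strict_mono_def)
    moreover have "(\<lambda>k. zs (k + N)) \<longlonglongrightarrow> z" using zs(1) by (rule LIMSEQ_ignore_initial_segment)
    ultimately show "z \<in> outer_limit ?C"
      unfolding outer_limit_def using N by (auto intro!: exI[of _ "\<lambda>k. k + N"] exI[of _ "\<lambda>k. zs (k + N)"])
  qed
  moreover have "outer_limit ?C \<subseteq> epi (dual_form \<rho> A)"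
  proof
    fix z assume "z \<in> outer_limit ?C"
    then obtain r zs where r: "strict_mono (r :: nat \<Rightarrow> nat)" "zs \<longlonglongrightarrow> z" "\<And>k. zs k \<in> ?C (r k)"
      by (auto simp: outer_limit_def)
    obtain w \<alpha> where z: "z = (w, \<alpha>)" by (cases z)
    have w: "(\<lambda>k. fst (zs k)) \<longlonglongrightarrow> w" "(\<lambda>k. snd (zs k)) \<longlonglongrightarrow> \<alpha>"
      using tendsto_fst[OF r(2)] tendsto_snd[OF r(2)] z by auto
    have "dual_bound \<rho> A w \<zeta> \<le> \<alpha>" for \<zeta>
    proof (rule LIMSEQ_le)
      have "(\<lambda>k. As (r k) \<zeta>) \<longlonglongrightarrow> A \<zeta>" using LIMSEQ_subseq_LIMSEQ[OF lim r(1)] by (simp add: o_def)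
      then show "(\<lambda>k. dual_bound \<rho> (As (r k)) (fst (zs k)) \<zeta>) \<longlonglongrightarrow> dual_bound \<rho> A w \<zeta>"
        unfolding dual_bound_def by (intro tendsto_intros w)
      have "dual_bound \<rho> (As (r k)) (fst (zs k)) \<zeta> \<le> snd (zs k)" for k
        using r(3)[of k] dual_bound_le_dual_form[of \<rho> "As (r k)" "fst (zs k)" \<zeta>]
        by (auto simp: epi_def case_prod_beta dest: order_trans)
      then show "\<exists>N. \<forall>k\<ge>N. dual_bound \<rho> (As (r k)) (fst (zs k)) \<zeta> \<le> snd (zs k)" by blast
    qed (rule w)
    then have "dual_form \<rho> A w \<le> ereal \<alpha>" unfolding dual_form_def by (intro SUP_least) simp
    then show "z \<in> epi (dual_form \<rho> A)" by (simp add: epi_def z)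
  qed
  moreover have "epi (dual_form \<rho> A) \<subseteq> inner_limit ?C"
  proof
    fix z assume "z \<in> epi (dual_form \<rho> A)"
    then obtain w \<alpha> where z: "z = (w, \<alpha>)" "dual_form \<rho> A w \<le> ereal \<alpha>" by (auto simp: epi_def)
    then have "w \<in> domain (dual_form \<rho> A)" by (auto simp: domain_def)
    then obtain \<xi> where \<xi>: "w = A \<xi>" by (auto simp: domain_dual_form[OF A \<rho>])
    let ?q = "\<lambda>A. \<rho> * (\<xi> \<bullet> A \<xi> - A \<xi> \<bullet> A \<xi>)"
    \<comment> \<open>The constant \<open>\<alpha> - ?q A\<close> is the height of the given point
      above the graph, so the sequence reaches every point of the epigraph and not only its
      boundary.\<close>
    define zs where "zs = (\<lambda>k. (As k \<xi>, ?q (As k) + (\<alpha> - ?q A)))"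
    have "?q A \<le> \<alpha>" using z(2) dual_form_range[OF A, of \<rho> \<xi>] \<rho> by (simp add: \<xi>)
    then have "zs k \<in> ?C k" for k
      using dual_form_range[OF As, of \<rho> k \<xi>] \<rho> by (simp add: zs_def epi_def)
    moreover have "zs \<longlonglongrightarrow> (A \<xi>, ?q A + (\<alpha> - ?q A))"
      unfolding zs_def by (intro tendsto_intros lim)
    ultimately show "z \<in> inner_limit ?C"
      unfolding inner_limit_def z(1) \<xi> by auto
  qed
  ultimately show ?thesis unfolding epi_converges_def PK_converges_def by blast
qed

lemma symmetric_derivative_of_gradient:
  fixes e :: "'a::euclidean_space \<Rightarrow> real"
  assumes "r > 0" and de: "\<And>z. z \<in> ball z0 r \<Longrightarrow> (e has_derivative (\<lambda>h. G z \<bullet> h)) (at z)"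
    and H: "(G has_derivative H) (at z0)"
  shows "H u \<bullet> w = H w \<bullet> u"
proof -
  have lin: "linear H" using H has_derivative_linear by blast
  define D where "D = (\<lambda>u w t. e (z0 + t *\<^sub>R u + t *\<^sub>R w) - e (z0 + t *\<^sub>R u) - e (z0 + t *\<^sub>R w) + e z0)"
  have lim: "((\<lambda>t. D u w t / t\<^sup>2) \<longlongrightarrow> H u \<bullet> w) (at_right 0)" for u w
  proof (rule tendstoI)
    fix \<epsilon> :: real assume \<epsilon>: "\<epsilon> > 0"
    \<comment> \<open>The two linearisation errors add up to \<open>t * \<delta> * (K - 1)\<close>;
      the extra 1 makes \<open>K\<close> positive for all \<open>u\<close> and
      \<open>w\<close>.\<close>
    define K where "K = (norm u + 2 * norm w) * norm w + 1"
    have K: "K > 0" by (auto simp: K_def intro!: add_nonneg_pos mult_nonneg_nonneg add_nonneg_nonneg)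
    define \<delta> where "\<delta> = \<epsilon> / (2 * K)"
    have \<delta>: "\<delta> > 0" using \<epsilon> K by (simp add: \<delta>_def)
    obtain d where d: "d > 0" "\<And>y. norm (y - z0) < d \<Longrightarrow> norm (G y - G z0 - H (y - z0)) \<le> \<delta> * norm (y - z0)"
      using H \<delta> unfolding has_derivative_at_alt by blast
    define T where "T = min d r / (norm u + norm w + 1)"
    have nn: "norm u + norm w + 1 > 0" by (auto intro: add_nonneg_pos)
    have T: "T > 0" using d(1) \<open>r > 0\<close> nn by (simp add: T_def)
    have "dist (D u w t / t\<^sup>2) (H u \<bullet> w) < \<epsilon>" if t: "0 < t" "t < T" for t
    proof -
      have tT: "t * (norm u + norm w + 1) < min d r" using t nn by (simp add: T_def field_simps)
      have small: "norm (a *\<^sub>R u + s *\<^sub>R w) < min d r" "norm (a *\<^sub>R u + s *\<^sub>R w) \<le> t * (norm u + norm w)"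
        if "0 \<le> s" "s \<le> t" "a = 0 \<or> a = t" for s a
      proof -
        have "norm (a *\<^sub>R u + s *\<^sub>R w) \<le> norm (a *\<^sub>R u) + norm (s *\<^sub>R w)" by (rule norm_triangle_ineq)
        also have "\<dots> \<le> t * norm u + t * norm w"
          using that t by (intro add_mono) (auto intro: mult_right_mono)
        finally show "norm (a *\<^sub>R u + s *\<^sub>R w) \<le> t * (norm u + norm w)" by (simp add: distrib_left)
        also have "\<dots> < t * (norm u + norm w + 1)" using t by simp
        also note tT
        finally show "norm (a *\<^sub>R u + s *\<^sub>R w) < min d r" .
      qed
      define \<phi> where "\<phi> = (\<lambda>s. e (z0 + (t *\<^sub>R u + s *\<^sub>R w)) - e (z0 + (0 *\<^sub>R u + s *\<^sub>R w)))"
      define \<phi>' where "\<phi>' = (\<lambda>s. (G (z0 + (t *\<^sub>R u + s *\<^sub>R w)) - G (z0 + (0 *\<^sub>R u + s *\<^sub>R w))) \<bullet> w)"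
      have der: "(\<phi> has_real_derivative \<phi>' s) (at s)" if s: "0 \<le> s" "s \<le> t" for s
      proof -
        have "((\<lambda>s. e (z0 + (a *\<^sub>R u + s *\<^sub>R w))) has_derivative (\<lambda>k. G (z0 + (a *\<^sub>R u + s *\<^sub>R w)) \<bullet> (k *\<^sub>R w))) (at s)"
          if a: "a = 0 \<or> a = t" for a
        proof (rule has_derivative_compose[of "\<lambda>s. z0 + (a *\<^sub>R u + s *\<^sub>R w)" "\<lambda>k. k *\<^sub>R w" s UNIV e])
          show "((\<lambda>s. z0 + (a *\<^sub>R u + s *\<^sub>R w)) has_derivative (\<lambda>k. k *\<^sub>R w)) (at s)"
            by (auto intro!: derivative_eq_intros)
          show "(e has_derivative (\<bullet>) (G (z0 + (a *\<^sub>R u + s *\<^sub>R w)))) (at (z0 + (a *\<^sub>R u + s *\<^sub>R w)))"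
            using small(1)[OF s a] by (intro de) (simp add: dist_norm norm_minus_commute[of _ 0] flip: norm_minus_cancel[of "a *\<^sub>R u + s *\<^sub>R w"])
        qed
        from this[of t] this[of 0]
        have "(\<phi> has_derivative (\<lambda>k. G (z0 + (t *\<^sub>R u + s *\<^sub>R w)) \<bullet> (k *\<^sub>R w) - G (z0 + (0 *\<^sub>R u + s *\<^sub>R w)) \<bullet> (k *\<^sub>R w))) (at s)"
          unfolding \<phi>_def by (intro has_derivative_diff) auto
        moreover have "(\<lambda>k. G (z0 + (t *\<^sub>R u + s *\<^sub>R w)) \<bullet> (k *\<^sub>R w) - G (z0 + (0 *\<^sub>R u + s *\<^sub>R w)) \<bullet> (k *\<^sub>R w)) = (*) (\<phi>' s)"
          by (auto simp: fun_eq_iff \<phi>'_def inner_diff_left algebra_simps)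
        ultimately show ?thesis unfolding has_field_derivative_def by simp
      qed
      obtain s where s: "0 < s" "s < t" "\<phi> t - \<phi> 0 = (t - 0) * \<phi>' s"
        using MVT2[OF t(1), of \<phi> \<phi>'] der by auto
      have "D u w t = \<phi> t - \<phi> 0" by (simp add: D_def \<phi>_def add.assoc)
      then have Dt: "D u w t = t * \<phi>' s" using s by simp
      let ?a = "t *\<^sub>R u + s *\<^sub>R w" and ?b = "0 *\<^sub>R u + s *\<^sub>R w"
      have 1: "norm (G (z0 + ?a) - G z0 - H ?a) \<le> \<delta> * (t * (norm u + norm w))"
        using d(2)[of "z0 + ?a"] small[of s t] s \<delta> by (auto intro: order_trans mult_left_mono)
      have "norm ?b \<le> t * norm w" using s by (auto intro: mult_right_mono)
      then have 2: "norm (G (z0 + ?b) - G z0 - H ?b) \<le> \<delta> * (t * norm w)"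
        using d(2)[of "z0 + ?b"] small[of s 0] s \<delta> by (auto intro: order_trans mult_left_mono)
      have "H ?a - H ?b = t *\<^sub>R H u" by (simp add: linear_add[OF lin] linear_scale[OF lin])
      then have eq: "G (z0 + ?a) - G (z0 + ?b) - t *\<^sub>R H u = (G (z0 + ?a) - G z0 - H ?a) - (G (z0 + ?b) - G z0 - H ?b)"
        by (simp add: algebra_simps)
      have 3: "norm (G (z0 + ?a) - G (z0 + ?b) - t *\<^sub>R H u) \<le> \<delta> * (t * (norm u + norm w)) + \<delta> * (t * norm w)"
        unfolding eq by (rule order_trans[OF norm_triangle_ineq4 add_mono[OF 1 2]])
      have "\<bar>\<phi>' s - t * (H u \<bullet> w)\<bar> = \<bar>(G (z0 + ?a) - G (z0 + ?b) - t *\<^sub>R H u) \<bullet> w\<bar>"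
        by (simp add: \<phi>'_def inner_diff_left)
      also have "\<dots> \<le> norm (G (z0 + ?a) - G (z0 + ?b) - t *\<^sub>R H u) * norm w" by (rule Cauchy_Schwarz_ineq2)
      also have "\<dots> \<le> (\<delta> * (t * (norm u + norm w)) + \<delta> * (t * norm w)) * norm w"
        using 3 by (intro mult_right_mono) auto
      also have "\<dots> = t * \<delta> * (K - 1)" by (simp add: K_def algebra_simps)
      also have "\<dots> \<le> t * \<delta> * K" using t \<delta> by (intro mult_left_mono) auto
      also have "\<dots> < t * \<epsilon>" using t \<epsilon> K by (simp add: \<delta>_def)
      finally have "\<bar>\<phi>' s - t * (H u \<bullet> w)\<bar> < t * \<epsilon>" .
      moreover have "D u w t / t\<^sup>2 - H u \<bullet> w = (\<phi>' s - t * (H u \<bullet> w)) / t"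
        using t by (simp add: Dt power2_eq_square field_simps)
      ultimately have "\<bar>D u w t / t\<^sup>2 - H u \<bullet> w\<bar> < t * \<epsilon> / t"
        using t by (simp only: abs_divide abs_of_pos divide_strict_right_mono)
      then show ?thesis using t by (simp add: dist_real_def)
    qed
    then show "\<forall>\<^sub>F t in at_right 0. dist (D u w t / t\<^sup>2) (H u \<bullet> w) < \<epsilon>"
      using T unfolding eventually_at_right_field by auto
  qed
  have "D u w = D w u" by (auto simp: D_def fun_eq_iff algebra_simps)
  with lim[of u w] lim[of w u] show ?thesis
    by (metis tendsto_unique trivial_limit_at_right_real)
qed

subsection \<open>The proximal map and the Moreau envelope\<close>

text \<open>After division by the norm of \<open>y - x\<close>, the quadratic defect is of first
  order and vanishes in the limit.\<close>

lemma in_regular_subdiffI: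
  fixes f :: "'a::euclidean_space \<Rightarrow> ereal"
  assumes fx: "f x = ereal a" and c: "c \<ge> 0" and \<delta>: "\<delta> > 0"
    and lb: "\<And>y. norm (y - x) < \<delta> \<Longrightarrow> ereal (a + v \<bullet> (y - x) - c * (norm (y - x))\<^sup>2) \<le> f y"
  shows "v \<in> regular_subdiff f x"
proof -
  have "0 \<le> Liminf (at x) (\<lambda>y. (f y - f x - ereal (v \<bullet> (y - x))) / ereal (norm (y - x)))"
  proof (cases "at x = bot")
    case True
    then show ?thesis by (simp add: Liminf_def)
  next
    case False
    have "((\<lambda>y. - c * norm (y - x)) \<longlongrightarrow> - c * norm (x - x)) (at x)"
      by (intro tendsto_intros)
    then have "((\<lambda>y. ereal (- c * norm (y - x))) \<longlongrightarrow> ereal 0) (at x)" by simp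
    then have "0 = Liminf (at x) (\<lambda>y. ereal (- c * norm (y - x)))"
      by (metis lim_imp_Liminf[OF False] zero_ereal_def)
    also have "\<dots> \<le> Liminf (at x) (\<lambda>y. (f y - f x - ereal (v \<bullet> (y - x))) / ereal (norm (y - x)))"
    proof (rule Liminf_mono)
      have "ereal (- c * norm (y - x)) \<le> (f y - f x - ereal (v \<bullet> (y - x))) / ereal (norm (y - x))"
        if y: "y \<noteq> x" "dist y x < \<delta>" for y
      proof -
        have n: "norm (y - x) > 0" using y by simp
        have "ereal (a + v \<bullet> (y - x) - c * (norm (y - x))\<^sup>2) \<le> f y" using lb y by (simp add: dist_norm)
        then show ?thesis
        proof (cases "f y")
          case (real b)
          then have "a + v \<bullet> (y - x) - c * (norm (y - x))\<^sup>2 \<le> b" using lb[of y] y by (simp add: dist_norm)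
          then have "- c * norm (y - x) \<le> (b - a - v \<bullet> (y - x)) / norm (y - x)"
            using n by (simp add: field_simps power2_eq_square)
          then show ?thesis using real fx n by simp
        qed (use fx n in auto)
      qed
      then show "\<forall>\<^sub>F y in at x. ereal (- c * norm (y - x)) \<le> (f y - f x - ereal (v \<bullet> (y - x))) / ereal (norm (y - x))"
        unfolding eventually_at using \<delta> by blast
    qed
    finally show ?thesis .
  qed
  then show ?thesis by (simp add: regular_subdiff_def fx)
qed

lemma regular_subset_limiting_subdiff: "regular_subdiff f x \<subseteq> limiting_subdiff f x"
proof
  fix v assume v: "v \<in> regular_subdiff f x"
  then show "v \<in> limiting_subdiff f x"
    unfolding limiting_subdiff_def
    by (intro CollectI conjI exI[of _ "\<lambda>_. x"] exI[of _ "\<lambda>_. v"]) (auto simp: regular_subdiff_def)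
qed

lemma norm_sq_add: "(norm (a + b))\<^sup>2 = (norm a)\<^sup>2 + 2 * (a \<bullet> b) + (norm (b::'a::real_inner))\<^sup>2"
  by (simp add: power2_norm_eq_inner inner_add inner_commute)

text \<open>One radius serves both for prox-regularity and for semicontinuity. Bounding point and
  subgradient by \<open>\<epsilon> / 2\<close> separately keeps the pair inside the ball of radius
  \<open>\<epsilon>\<close> of the product space.\<close>

locale local_prox_regular =
  fixes f :: "'a::euclidean_space \<Rightarrow> ereal" and xbar :: 'a and \<epsilon> r :: real
  assumes fin: "\<bar>f xbar\<bar> \<noteq> \<infinity>" and eps: "\<epsilon> > 0" and r0: "r \<ge> 0"
    and lsc: "\<And>\<alpha>. ereal \<alpha> \<le> f xbar + ereal \<epsilon> \<Longrightarrow> closed {y \<in> cball xbar \<epsilon>. f y \<le> ereal \<alpha>}"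
    and zero_sub: "0 \<in> limiting_subdiff f xbar"
    and prox: "\<And>x v x'. v \<in> limiting_subdiff f x \<Longrightarrow> norm (x - xbar) \<le> \<epsilon> / 2 \<Longrightarrow> norm v \<le> \<epsilon> / 2 \<Longrightarrow>
      f x < f xbar + ereal \<epsilon> \<Longrightarrow> x' \<in> cball xbar \<epsilon> \<Longrightarrow>
      f x + ereal (v \<bullet> (x' - x)) - ereal (r / 2 * (norm (x' - x))\<^sup>2) \<le> f x'"
begin

definition \<rho> where "\<rho> = r + 1"
definition fr where "fr y = real_of_ereal (f y)"
definition dom where "dom = {y \<in> cball xbar \<epsilon>. f y < \<infinity>}"

lemma rho: "\<rho> \<ge> 1" "\<rho> > 0" using r0 by (auto simp: \<rho>_def)

lemma f_xbar: "f xbar = ereal (fr xbar)"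
  using fin by (cases "f xbar") (auto simp: fr_def)

text \<open>The subgradient \<open>0\<close> at \<open>xbar\<close> gives a real lower bound on the
  whole ball. It excludes the value minus infinity there, so \<open>fr\<close> represents
  \<open>f\<close> faithfully on \<open>dom\<close>.\<close>

lemma f_lower: "y \<in> cball xbar \<epsilon> \<Longrightarrow> ereal (fr xbar - r / 2 * (norm (y - xbar))\<^sup>2) \<le> f y"
  using prox[OF zero_sub, of y] eps by (simp add: f_xbar)

lemma f_dom: "y \<in> dom \<Longrightarrow> f y = ereal (fr y)"
  using f_lower[of y] by (cases "f y") (auto simp: dom_def fr_def)

lemma f_not_dom: "y \<in> cball xbar \<epsilon> \<Longrightarrow> y \<notin> dom \<Longrightarrow> f y = \<infinity>"
  by (auto simp: dom_def)

lemma xbar_dom: "xbar \<in> dom" using eps f_xbar by (simp add: dom_def)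

lemma dom_dist: "y \<in> dom \<Longrightarrow> norm (y - xbar) \<le> \<epsilon>"
  by (auto simp: dom_def dist_norm norm_minus_commute)

lemma fr_lower: "y \<in> dom \<Longrightarrow> fr xbar - r / 2 * (norm (y - xbar))\<^sup>2 \<le> fr y"
  using f_lower[of y] f_dom[of y] by (auto simp: dom_def)

lemma in_domI: "norm (y - xbar) \<le> \<epsilon> \<Longrightarrow> f y < \<infinity> \<Longrightarrow> y \<in> dom"
  by (auto simp: dom_def dist_norm norm_minus_commute)

lemma prox_real:
  assumes "v \<in> limiting_subdiff f x" "norm (x - xbar) \<le> \<epsilon> / 2" "norm v \<le> \<epsilon> / 2" "f x < ereal (fr xbar + \<epsilon>)"
  shows "x \<in> dom" "\<And>y. y \<in> dom \<Longrightarrow> fr x + v \<bullet> (y - x) - r / 2 * (norm (y - x))\<^sup>2 \<le> fr y"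
proof -
  show x: "x \<in> dom" using assms eps by (intro in_domI) auto
  fix y assume y: "y \<in> dom"
  then show "fr x + v \<bullet> (y - x) - r / 2 * (norm (y - x))\<^sup>2 \<le> fr y"
    using prox[OF assms(1-3), of y] assms(4) f_dom[OF x] f_dom[OF y] by (simp add: f_xbar dom_def)
qed

text \<open>Closedness of level sets is known only up to the level
  \<open>fr xbar + \<epsilon>\<close>, so the limiting level must lie strictly below it; the value
  at \<open>l\<close> is then squeezed by levels between the two.\<close>

lemma lsc_real:
  assumes y: "\<And>k. y k \<in> dom" "y \<longlonglongrightarrow> l" and a: "\<And>k. fr (y k) \<le> a k" "a \<longlonglongrightarrow> \<beta>" "\<beta> < fr xbar + \<epsilon>"
  shows "l \<in> dom \<and> fr l \<le> \<beta>"
proof -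
  have lev: "l \<in> cball xbar \<epsilon> \<and> f l \<le> ereal \<alpha>" if \<alpha>: "\<beta> < \<alpha>" "\<alpha> \<le> fr xbar + \<epsilon>" for \<alpha>
  proof -
    have "\<forall>\<^sub>F k in sequentially. a k < \<alpha>" by (rule order_tendstoD(2)[OF a(2) \<alpha>(1)])
    then have "\<forall>\<^sub>F k in sequentially. y k \<in> {y \<in> cball xbar \<epsilon>. f y \<le> ereal \<alpha>}"
    proof eventually_elim
      case (elim k)
      then have "fr (y k) \<le> \<alpha>" using a(1)[of k] by linarith
      then show ?case using y(1)[of k] f_dom[OF y(1), of k] by (simp add: dom_def)
    qed
    moreover have "closed {y \<in> cball xbar \<epsilon>. f y \<le> ereal \<alpha>}" using lsc \<alpha> by (simp add: f_xbar)
    ultimately have "l \<in> {y \<in> cball xbar \<epsilon>. f y \<le> ereal \<alpha>}"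
      using Lim_in_closed_set[OF _ _ sequentially_bot y(2)] by blast
    then show ?thesis by simp
  qed
  from lev[of "fr xbar + \<epsilon>"] a(3) have l: "l \<in> dom" by (auto simp: dom_def)
  have "fr l \<le> \<alpha>" if "\<beta> < \<alpha>" "\<alpha> < fr xbar + \<epsilon>" for \<alpha>
    using lev[of \<alpha>] that f_dom[OF l] by simp
  then have "fr l \<le> \<beta>" using a(3) by (intro dense_ge_bounded[of \<beta> "fr xbar + \<epsilon>"]) auto
  with l show ?thesis by simp
qed

section \<open>Local proximal points\<close>

definition is_prox where
  "is_prox z x \<longleftrightarrow> x \<in> dom \<and> (\<forall>y\<in>dom. fr x + \<rho> / 2 * (norm (x - z))\<^sup>2 \<le> fr y + \<rho> / 2 * (norm (y - z))\<^sup>2)"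

text \<open>For \<open>z\<close> within \<open>\<eta>\<close> of \<open>xbar\<close>, a proximal
  point lies within \<open>2 * \<rho> * \<eta>\<close> of \<open>xbar\<close> and its subgradient
  has norm at most \<open>\<rho> * (1 + 2 * \<rho>) * \<eta>\<close>. The choice makes both at most
  \<open>\<epsilon> / 4\<close>.\<close>

definition \<eta> where "\<eta> = min 1 (\<epsilon> / (4 * \<rho> * (1 + 2 * \<rho>)))"

lemma eta: "\<eta> > 0" "\<eta> \<le> 1" "\<rho> * (1 + 2 * \<rho>) * \<eta> \<le> \<epsilon> / 4" "2 * \<rho> * \<eta> \<le> \<epsilon> / 4" "\<rho> / 2 * \<eta>\<^sup>2 \<le> \<epsilon> / 4" "\<eta> \<le> \<epsilon> / 4"
proof -
  show e0: "\<eta> > 0" "\<eta> \<le> 1" using eps rho by (auto simp: \<eta>_def add_pos_pos)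
  have pos: "4 * \<rho> * (1 + 2 * \<rho>) > 0" using rho by (simp add: add_pos_pos)
  have "\<eta> * (4 * \<rho> * (1 + 2 * \<rho>)) \<le> \<epsilon>"
    using pos by (simp add: \<eta>_def pos_le_divide_eq[symmetric])
  then show 1: "\<rho> * (1 + 2 * \<rho>) * \<eta> \<le> \<epsilon> / 4" by (simp add: mult_ac)
  have "2 * \<rho> * \<eta> \<le> (1 + 2 * \<rho>) * \<eta>" using e0 by (simp add: algebra_simps)
  also have "\<dots> \<le> \<rho> * ((1 + 2 * \<rho>) * \<eta>)" using rho e0 mult_right_mono[of 1 \<rho> "(1 + 2 * \<rho>) * \<eta>"] by simp
  also have "\<dots> \<le> \<epsilon> / 4" using 1 by (simp only: mult.assoc)
  finally show 2: "2 * \<rho> * \<eta> \<le> \<epsilon> / 4" .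
  have "\<rho> / 2 * \<eta>\<^sup>2 \<le> \<rho> / 2 * \<eta>"
    using rho e0 by (intro mult_left_mono) (auto simp: power2_eq_square mult_left_le)
  also have "\<dots> \<le> 2 * \<rho> * \<eta>" using rho e0 by simp
  finally show "\<rho> / 2 * \<eta>\<^sup>2 \<le> \<epsilon> / 4" using 2 by linarith
  have "\<eta> \<le> 2 * \<rho> * \<eta>" using rho e0 by simp
  then show "\<eta> \<le> \<epsilon> / 4" using 2 by linarith
qed

lemma prox_exists:
  assumes z: "norm (z - xbar) \<le> \<eta>"
  shows "\<exists>x. is_prox z x"
proof -
  define h where "h = (\<lambda>y. fr y + \<rho> / 2 * (norm (y - z))\<^sup>2)"
  have hlow: "fr xbar - r / 2 * \<epsilon>\<^sup>2 \<le> h y" if "y \<in> dom" for y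
  proof -
    have "r / 2 * (norm (y - xbar))\<^sup>2 \<le> r / 2 * \<epsilon>\<^sup>2"
      using dom_dist[OF that] r0 by (intro mult_left_mono power_mono) auto
    moreover have "0 \<le> \<rho> / 2 * (norm (y - z))\<^sup>2" using rho by simp
    ultimately show ?thesis using fr_lower[OF that] unfolding h_def by linarith
  qed
  define \<mu> where "\<mu> = Inf (h ` dom)"
  have bdd: "bdd_below (h ` dom)" using hlow by (rule bdd_belowI2)
  have \<mu>: "\<mu> \<le> h y" if "y \<in> dom" for y unfolding \<mu>_def using that bdd by (simp add: cInf_lower)
  have "\<exists>y\<in>dom. h y < \<mu> + inverse (real (Suc k))" for k
  proof -
    have "Inf (h ` dom) < \<mu> + inverse (real (Suc k))" by (simp add: \<mu>_def)
    then show ?thesis using cInf_lessD[of "h ` dom"] xbar_dom by blast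
  qed
  then obtain y where y: "\<And>k. y k \<in> dom" "\<And>k. h (y k) < \<mu> + inverse (real (Suc k))" by metis
  have "\<And>k. y k \<in> cball xbar \<epsilon>" using y(1) by (auto simp: dom_def)
  then obtain l s where s: "strict_mono (s :: nat \<Rightarrow> nat)" "(y \<circ> s) \<longlonglongrightarrow> l"
    using compact_cball[of xbar \<epsilon>] unfolding compact_def by metis
  \<comment> \<open>Solving the near-minimality of \<open>y (s k)\<close> for \<open>fr\<close>
    gives this bound. Its limit stays below the admissible level because \<open>xbar\<close> itself
    is a competitor.\<close>
  define a where "a = (\<lambda>k. \<mu> + inverse (real (Suc (s k))) - \<rho> / 2 * (norm (y (s k) - z))\<^sup>2)"
  have "(\<lambda>k. inverse (real (Suc (s k)))) \<longlonglongrightarrow> 0"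
    using LIMSEQ_subseq_LIMSEQ[OF LIMSEQ_inverse_real_of_nat s(1)] by (simp add: o_def)
  moreover have ys: "(\<lambda>k. y (s k)) \<longlonglongrightarrow> l" using s(2) by (simp add: o_def)
  ultimately have alim: "a \<longlonglongrightarrow> \<mu> + 0 - \<rho> / 2 * (norm (l - z))\<^sup>2"
    unfolding a_def by (intro tendsto_intros)
  have "\<mu> \<le> fr xbar + \<rho> / 2 * \<eta>\<^sup>2"
  proof -
    have "\<rho> / 2 * (norm (xbar - z))\<^sup>2 \<le> \<rho> / 2 * \<eta>\<^sup>2"
      using z rho by (intro mult_left_mono power_mono) (auto simp: norm_minus_commute)
    then show ?thesis using \<mu>[OF xbar_dom] by (simp add: h_def)
  qed
  moreover have "0 \<le> \<rho> / 2 * (norm (l - z))\<^sup>2" using rho by simp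
  ultimately have "\<mu> + 0 - \<rho> / 2 * (norm (l - z))\<^sup>2 < fr xbar + \<epsilon>" using eta(5) eps by linarith
  from lsc_real[OF y(1) ys _ alim this] have l: "l \<in> dom" "fr l \<le> \<mu> - \<rho> / 2 * (norm (l - z))\<^sup>2"
    using y(2)[of "s k" for k] by (auto simp: a_def h_def less_imp_le algebra_simps)
  then have "h l \<le> \<mu>" by (simp add: h_def)
  then have "is_prox z l" unfolding is_prox_def using l \<mu> unfolding h_def by fastforce
  then show ?thesis by blast
qed

text \<open>Comparison with \<open>xbar\<close> and the lower bound of \<open>f\<close> around
  \<open>xbar\<close> keep \<open>x\<close> well inside the ball. Minimality then makes
  \<open>v\<close> a regular subgradient with quadratic constant \<open>\<rho>\<close>.
  Prox-regularity improves this constant to \<open>r\<close>, and the gap between the two drives the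
  later estimates.\<close>

lemma is_prox_facts:
  assumes z: "norm (z - xbar) \<le> \<eta>" and x: "is_prox z x"
  defines "v \<equiv> \<rho> *\<^sub>R (z - x)"
  shows "norm (x - xbar) \<le> 2 * \<rho> * norm (z - xbar)" and "norm (x - xbar) \<le> \<epsilon> / 4" and "norm v \<le> \<epsilon> / 4"
    and "fr x \<le> fr xbar + \<rho> / 2 * (norm (z - xbar))\<^sup>2" and "v \<in> limiting_subdiff f x"
    and "\<And>y. y \<in> dom \<Longrightarrow> fr x + v \<bullet> (y - x) - r / 2 * (norm (y - x))\<^sup>2 \<le> fr y"
proof -
  have xd: "x \<in> dom" and min: "\<And>y. y \<in> dom \<Longrightarrow> fr x + \<rho> / 2 * (norm (x - z))\<^sup>2 \<le> fr y + \<rho> / 2 * (norm (y - z))\<^sup>2"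
    using x by (auto simp: is_prox_def)
  define a where "a = x - xbar"
  define b where "b = z - xbar"
  have xz: "x - z = a - b" "xbar - z = - b" by (auto simp: a_def b_def)
  have "fr x + \<rho> / 2 * (norm (x - z))\<^sup>2 \<le> fr xbar + \<rho> / 2 * (norm (xbar - z))\<^sup>2" by (rule min[OF xbar_dom])
  then have m: "fr x + \<rho> / 2 * (norm (a - b))\<^sup>2 \<le> fr xbar + \<rho> / 2 * (norm b)\<^sup>2" unfolding xz by simp
  moreover have "fr xbar - r / 2 * (norm a)\<^sup>2 \<le> fr x" using fr_lower[OF xd] by (simp add: a_def)
  ultimately have "\<rho> / 2 * ((norm (a - b))\<^sup>2 - (norm b)\<^sup>2) \<le> r / 2 * (norm a)\<^sup>2" by (simp add: algebra_simps)
  also have "(norm (a - b))\<^sup>2 - (norm b)\<^sup>2 = (norm a)\<^sup>2 - 2 * (a \<bullet> b)"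
    by (simp add: power2_norm_eq_inner inner_diff inner_commute)
  finally have "(\<rho> - r) * (norm a)\<^sup>2 \<le> 2 * \<rho> * (a \<bullet> b)" by (simp add: algebra_simps)
  then have "(norm a)\<^sup>2 \<le> 2 * \<rho> * (a \<bullet> b)" by (simp add: \<rho>_def)
  also have "\<dots> \<le> 2 * \<rho> * (norm a * norm b)" using rho norm_cauchy_schwarz[of a b] by (intro mult_left_mono) auto
  finally have "norm a * norm a \<le> norm a * (2 * \<rho> * norm b)" by (simp add: power2_eq_square mult_ac)
  then have nab: "norm a \<le> 2 * \<rho> * norm b"
    using rho by (cases "norm a = 0") (auto simp: mult_le_cancel_left)
  then show "norm (x - xbar) \<le> 2 * \<rho> * norm (z - xbar)" by (simp add: a_def b_def)
  have bz: "norm b \<le> \<eta>" using z by (simp add: b_def)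
  then have "2 * \<rho> * norm b \<le> 2 * \<rho> * \<eta>" using rho by (intro mult_left_mono) auto
  then have na: "norm a \<le> \<epsilon> / 4" "norm a \<le> 2 * \<rho> * \<eta>" using nab eta(4) by auto
  then show xe: "norm (x - xbar) \<le> \<epsilon> / 4" by (simp add: a_def)
  have "norm v = \<rho> * norm (b - a)" using rho by (simp add: v_def a_def b_def)
  also have "\<dots> \<le> \<rho> * (\<eta> + 2 * \<rho> * \<eta>)"
    using rho na bz norm_triangle_ineq4[of b a] by (intro mult_left_mono) auto
  also have "\<dots> \<le> \<epsilon> / 4" using eta(3) by (simp add: algebra_simps)
  finally show ve: "norm v \<le> \<epsilon> / 4" .
  have "0 \<le> \<rho> / 2 * (norm (a - b))\<^sup>2" using rho by simp
  then show fx: "fr x \<le> fr xbar + \<rho> / 2 * (norm (z - xbar))\<^sup>2" using m unfolding b_def by linarith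
  have quad: "fr x + v \<bullet> (y - x) - \<rho> / 2 * (norm (y - x))\<^sup>2 \<le> fr y" if y: "y \<in> dom" for y
  proof -
    have "(norm (y - z))\<^sup>2 = (norm (y - x))\<^sup>2 + 2 * ((y - x) \<bullet> (x - z)) + (norm (x - z))\<^sup>2"
      using norm_sq_add[of "y - x" "x - z"] by simp
    then have "\<rho> / 2 * (norm (y - z))\<^sup>2 = \<rho> / 2 * (norm (y - x))\<^sup>2 + \<rho> * ((y - x) \<bullet> (x - z)) + \<rho> / 2 * (norm (x - z))\<^sup>2"
      by (simp add: distrib_left)
    moreover have "v \<bullet> (y - x) = - (\<rho> * ((y - x) \<bullet> (x - z)))"
      by (simp add: v_def inner_diff inner_commute algebra_simps)
    ultimately show ?thesis using min[OF y] by linarith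
  qed
  \<comment> \<open>The ball of radius \<open>\<epsilon> / 2\<close> around \<open>x\<close> stays
    inside the ball on which \<open>x\<close> is minimal, and off \<open>dom\<close> the function is
    infinite there.\<close>
  have "v \<in> regular_subdiff f x"
  proof (rule in_regular_subdiffI[where a = "fr x" and c = "\<rho> / 2" and \<delta> = "\<epsilon> / 2"])
    fix y assume y: "norm (y - x) < \<epsilon> / 2"
    have "norm (y - xbar) \<le> norm (y - x) + norm (x - xbar)" using norm_triangle_ineq[of "y - x" "x - xbar"] by simp
    then have yc: "y \<in> cball xbar \<epsilon>" using y xe eps by (simp add: dist_norm norm_minus_commute)
    show "ereal (fr x + v \<bullet> (y - x) - \<rho> / 2 * (norm (y - x))\<^sup>2) \<le> f y"
      using quad[of y] f_dom[of y] f_not_dom[OF yc] by (cases "y \<in> dom") auto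
  qed (use rho eps f_dom[OF xd] in auto)
  then show vl: "v \<in> limiting_subdiff f x" using regular_subset_limiting_subdiff by blast
  have "\<rho> / 2 * (norm (z - xbar))\<^sup>2 \<le> \<rho> / 2 * \<eta>\<^sup>2" using z rho by (intro mult_left_mono power_mono) auto
  then have "fr x < fr xbar + \<epsilon>" using fx eta(5) eps by linarith
  then show "fr x + v \<bullet> (y - x) - r / 2 * (norm (y - x))\<^sup>2 \<le> fr y" if "y \<in> dom" for y
    using prox_real(2)[OF vl _ _ _ that] xe ve eps f_dom[OF xd] by simp
qed

text \<open>Adding the two subgradient inequalities, each tested at the other proximal point, leaves
  the coefficient \<open>\<rho> - r = 1\<close> on the left.\<close>

lemma is_prox_monotone:
  assumes z: "norm (z - xbar) \<le> \<eta>" "norm (z' - xbar) \<le> \<eta>" and x: "is_prox z x" "is_prox z' x'"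
  shows "(norm (x - x'))\<^sup>2 \<le> \<rho> * ((x - x') \<bullet> (z - z'))"
proof -
  have d: "x \<in> dom" "x' \<in> dom" using x by (auto simp: is_prox_def)
  have 1: "fr x + (\<rho> *\<^sub>R (z - x)) \<bullet> (x' - x) - r / 2 * (norm (x' - x))\<^sup>2 \<le> fr x'"
    by (rule is_prox_facts(6)[OF z(1) x(1) d(2)])
  have 2: "fr x' + (\<rho> *\<^sub>R (z' - x')) \<bullet> (x - x') - r / 2 * (norm (x - x'))\<^sup>2 \<le> fr x"
    by (rule is_prox_facts(6)[OF z(2) x(2) d(1)])
  have "(\<rho> *\<^sub>R (z - x)) \<bullet> (x' - x) + (\<rho> *\<^sub>R (z' - x')) \<bullet> (x - x') = \<rho> * (norm (x - x'))\<^sup>2 - \<rho> * ((x - x') \<bullet> (z - z'))"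
    by (simp add: power2_norm_eq_inner inner_diff inner_commute algebra_simps)
  then have "\<rho> * (norm (x - x'))\<^sup>2 - \<rho> * ((x - x') \<bullet> (z - z')) \<le> r * (norm (x - x'))\<^sup>2"
    using 1 2 by (simp add: norm_minus_commute)
  then show ?thesis by (simp add: \<rho>_def algebra_simps)
qed

section \<open>The Moreau envelope and its gradient\<close>

definition P where "P z = (SOME x. is_prox z x)"
definition G where "G z = \<rho> *\<^sub>R (z - P z)"
definition e where "e z = fr (P z) + \<rho> / 2 * (norm (P z - z))\<^sup>2"

abbreviation "V \<equiv> cball xbar \<eta>"

lemma V_iff: "z \<in> V \<longleftrightarrow> norm (z - xbar) \<le> \<eta>" by (simp add: dist_norm norm_minus_commute)

lemma P: "z \<in> V \<Longrightarrow> is_prox z (P z)"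
  unfolding P_def V_iff by (rule someI_ex) (rule prox_exists)

lemma P_dom: "z \<in> V \<Longrightarrow> P z \<in> dom" using P by (simp add: is_prox_def)

lemma P_monotone: "z \<in> V \<Longrightarrow> z' \<in> V \<Longrightarrow> (norm (P z - P z'))\<^sup>2 \<le> \<rho> * ((P z - P z') \<bullet> (z - z'))"
  using is_prox_monotone P V_iff by blast

lemma P_lipschitz: "z \<in> V \<Longrightarrow> z' \<in> V \<Longrightarrow> norm (P z - P z') \<le> \<rho> * norm (z - z')"
proof -
  assume z: "z \<in> V" "z' \<in> V"
  have "norm (P z - P z') * norm (P z - P z') \<le> \<rho> * ((P z - P z') \<bullet> (z - z'))"
    using P_monotone[OF z] by (simp add: power2_eq_square)
  also have "\<dots> \<le> \<rho> * (norm (P z - P z') * norm (z - z'))"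
    using rho norm_cauchy_schwarz by (intro mult_left_mono) auto
  finally show ?thesis using rho
    by (cases "P z = P z'") (auto simp: mult_le_cancel_left mult.left_commute[of \<rho>])
qed

lemma P_near: "z \<in> V \<Longrightarrow> norm (P z - xbar) \<le> 2 * \<rho> * norm (z - xbar)"
  using is_prox_facts(1) P V_iff by blast

lemma P_xbar: "P xbar = xbar" using P_near[of xbar] eta(1) by simp

lemma gph_P: "z \<in> V \<Longrightarrow> (P z, G z) \<in> gph_subdiff f"
  using is_prox_facts(5) P V_iff unfolding gph_subdiff_def G_def by blast

lemma e_le: "z \<in> V \<Longrightarrow> y \<in> dom \<Longrightarrow> e z \<le> fr y + \<rho> / 2 * (norm (y - z))\<^sup>2"
  using P by (simp add: is_prox_def e_def)

text \<open>\<open>P z\<close> is a competitor in the minimisation that defines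
  \<open>e z'\<close>.\<close>

lemma e_upper:
  assumes "z \<in> V" "z' \<in> V"
  shows "e z' \<le> e z + G z \<bullet> (z' - z) + \<rho> / 2 * (norm (z' - z))\<^sup>2"
proof -
  have "e z' \<le> fr (P z) + \<rho> / 2 * (norm (P z - z'))\<^sup>2" by (rule e_le[OF assms(2) P_dom[OF assms(1)]])
  also have "(norm (P z - z'))\<^sup>2 = (norm (P z - z))\<^sup>2 + 2 * ((P z - z) \<bullet> (z - z')) + (norm (z' - z))\<^sup>2"
    using norm_sq_add[of "P z - z" "z - z'"] by (simp add: norm_minus_commute)
  also have "fr (P z) + \<rho> / 2 * \<dots> = e z + G z \<bullet> (z' - z) + \<rho> / 2 * (norm (z' - z))\<^sup>2"
    by (simp add: e_def G_def inner_diff inner_commute algebra_simps)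
  finally show ?thesis .
qed

lemma G_lipschitz: "z \<in> V \<Longrightarrow> z' \<in> V \<Longrightarrow> norm (G z - G z') \<le> \<rho> * (1 + \<rho>) * norm (z - z')"
proof -
  assume z: "z \<in> V" "z' \<in> V"
  have "norm (G z - G z') = \<rho> * norm ((z - z') - (P z - P z'))"
  proof -
    have "G z - G z' = \<rho> *\<^sub>R ((z - z') - (P z - P z'))" by (simp add: G_def algebra_simps)
    then show ?thesis using rho by simp
  qed
  also have "\<dots> \<le> \<rho> * (norm (z - z') + \<rho> * norm (z - z'))"
    using rho norm_triangle_ineq4[of "z - z'" "P z - P z'"] P_lipschitz[OF z] by (intro mult_left_mono) auto
  finally show ?thesis by (simp add: algebra_simps)
qed

text \<open>The upper estimate used in both directions encloses the increment of \<open>e\<close>.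
  The two bounds differ by terms of second order because \<open>G\<close> is Lipschitz;
  \<open>C\<close> collects their constants.\<close>

lemma e_derivative:
  assumes z: "z \<in> ball xbar \<eta>"
  shows "(e has_derivative (\<lambda>h. G z \<bullet> h)) (at z)"
  unfolding has_derivative_at_alt
proof (intro conjI allI impI)
  show "bounded_linear ((\<bullet>) (G z))" by (rule bounded_linear_inner_right)
  fix \<delta> :: real assume \<delta>: "\<delta> > 0"
  define C where "C = \<rho> * (1 + \<rho>) + \<rho> / 2"
  have C: "C > 0" using rho by (auto simp: C_def intro!: add_nonneg_pos)
  have zV: "z \<in> V" using z by (auto simp: less_imp_le)
  define d where "d = min (\<eta> - norm (z - xbar)) (\<delta> / C)"
  have d: "d > 0" using z \<delta> C by (auto simp: d_def dist_norm norm_minus_commute)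
  have "norm (e y - e z - G z \<bullet> (y - z)) \<le> \<delta> * norm (y - z)" if y: "norm (y - z) < d" for y
  proof -
    have "norm (y - xbar) \<le> norm (y - z) + norm (z - xbar)" using norm_triangle_ineq[of "y - z" "z - xbar"] by simp
    then have yV: "y \<in> V" unfolding V_iff using y by (simp add: d_def)
    have 1: "e y \<le> e z + G z \<bullet> (y - z) + \<rho> / 2 * (norm (y - z))\<^sup>2" by (rule e_upper[OF zV yV])
    have 2: "e z \<le> e y + G y \<bullet> (z - y) + \<rho> / 2 * (norm (y - z))\<^sup>2"
      using e_upper[OF yV zV] by (simp add: norm_minus_commute)
    have "\<bar>(G y - G z) \<bullet> (y - z)\<bar> \<le> norm (G y - G z) * norm (y - z)" by (rule Cauchy_Schwarz_ineq2)
    also have "\<dots> \<le> \<rho> * (1 + \<rho>) * norm (y - z) * norm (y - z)"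
      by (intro mult_right_mono G_lipschitz yV zV) simp
    finally have 3: "\<bar>(G y - G z) \<bullet> (y - z)\<bar> \<le> \<rho> * (1 + \<rho>) * (norm (y - z))\<^sup>2" by (simp add: power2_eq_square)
    have 4: "G y \<bullet> (z - y) = - ((G y - G z) \<bullet> (y - z)) - G z \<bullet> (y - z)"
      by (simp add: inner_diff algebra_simps)
    have 5: "0 \<le> \<rho> * (1 + \<rho>) * (norm (y - z))\<^sup>2" using rho by simp
    have "\<bar>e y - e z - G z \<bullet> (y - z)\<bar> \<le> \<rho> * (1 + \<rho>) * (norm (y - z))\<^sup>2 + \<rho> / 2 * (norm (y - z))\<^sup>2"
      using 1 2 3 4 5 by linarith
    also have "\<dots> = C * norm (y - z) * norm (y - z)" by (simp add: C_def power2_eq_square algebra_simps)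
    also have "\<dots> \<le> \<delta> * norm (y - z)"
      using y C by (intro mult_right_mono) (auto simp: d_def field_simps)
    finally show ?thesis by simp
  qed
  then show "\<exists>d>0. \<forall>y. norm (y - z) < d \<longrightarrow> norm (e y - e z - G z \<bullet> (y - z)) \<le> \<delta> * norm (y - z)"
    using d by blast
qed

end

subsection \<open>Second subderivatives\<close>

lemma has_derivative_directional_limit:
  fixes g :: "'a::real_normed_vector \<Rightarrow> 'b::real_normed_vector"
  assumes "(g has_derivative A) (at z)"
  shows "((\<lambda>t. (g (z + t *\<^sub>R h) - g z) /\<^sub>R t) \<longlongrightarrow> A h) (at 0)"
proof -
  have lin: "linear A" using assms has_derivative_linear by blast
  have "((\<lambda>t. g (z + t *\<^sub>R h)) has_derivative (\<lambda>t. A (t *\<^sub>R h))) (at 0)"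
    by (rule has_derivative_compose[of "\<lambda>t. z + t *\<^sub>R h" "\<lambda>t. t *\<^sub>R h" 0 UNIV g A])
      (auto intro!: derivative_eq_intros assms)
  then have "((\<lambda>t. g (z + t *\<^sub>R h)) has_vector_derivative A h) (at 0)"
    by (simp add: has_vector_derivative_def linear_scale[OF lin])
  then have "((\<lambda>t. norm (g (z + t *\<^sub>R h) - g z - t *\<^sub>R A h) / norm t) \<longlongrightarrow> 0) (at 0)"
    unfolding has_vector_derivative_def has_derivative_at by simp
  moreover have "\<forall>\<^sub>F t in at 0. norm (g (z + t *\<^sub>R h) - g z - t *\<^sub>R A h) / norm t
      = norm ((g (z + t *\<^sub>R h) - g z) /\<^sub>R t - A h)"
    unfolding eventually_at_filter
  proof (rule always_eventually, intro allI impI)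
    fix t :: real assume t: "t \<noteq> 0"
    have "(g (z + t *\<^sub>R h) - g z) /\<^sub>R t - A h = (g (z + t *\<^sub>R h) - g z - t *\<^sub>R A h) /\<^sub>R t"
      using t by (simp add: scaleR_diff_right)
    then show "norm (g (z + t *\<^sub>R h) - g z - t *\<^sub>R A h) / norm t = norm ((g (z + t *\<^sub>R h) - g z) /\<^sub>R t - A h)"
      by (simp add: divide_inverse mult.commute)
  qed
  ultimately have "((\<lambda>t. norm ((g (z + t *\<^sub>R h) - g z) /\<^sub>R t - A h)) \<longlongrightarrow> 0) (at 0)"
    by (rule Lim_transform_eventually)
  then show ?thesis by (simp add: tendsto_norm_zero_iff Lim_null[symmetric])
qed

lemma eventually_line_in_open:
  fixes z h :: "'a::real_normed_vector"
  assumes "open S" "z \<in> S"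
  shows "\<forall>\<^sub>F t in at (0::real). z + t *\<^sub>R h \<in> S"
proof -
  have "((\<lambda>t. z + t *\<^sub>R h) \<longlongrightarrow> z + 0 *\<^sub>R h) (at (0::real))" by (intro tendsto_intros)
  then show ?thesis using topological_tendstoD assms by fastforce
qed

lemma Liminf_le_along:
  fixes g :: "'b \<Rightarrow> ereal"
  assumes c: "filterlim c F G" and G: "G \<noteq> bot" and lim: "((\<lambda>t. g (c t)) \<longlongrightarrow> l) G"
  shows "Liminf F g \<le> l"
proof (rule ccontr)
  assume "\<not> ?thesis"
  then have "l < Liminf F g" by simp
  then obtain y where y: "l < y" "y < Liminf F g" using dense by blast
  have "\<forall>\<^sub>F t in G. y < g (c t)"
    using less_LiminfD[OF y(2)] c by (rule eventually_compose_filterlim)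
  moreover have "\<forall>\<^sub>F t in G. g (c t) < y" by (rule order_tendstoD(2)[OF lim y(1)])
  ultimately have "\<forall>\<^sub>F t in G. False" by eventually_elim auto
  then show False using G by (simp add: eventually_False)
qed

context local_prox_regular
begin

lemma ball_V: "z \<in> ball xbar \<eta> \<Longrightarrow> z \<in> V" by (auto simp: less_imp_le)

lemma eventually_line_in_V:
  "z \<in> ball xbar \<eta> \<Longrightarrow> \<forall>\<^sub>F t in at (0::real). z + t *\<^sub>R h \<in> V"
  by (rule eventually_mono[OF eventually_line_in_open[OF open_ball]]) (assumption, rule ball_V)

lemma P_derivative_norm_le:
  assumes z: "z \<in> ball xbar \<eta>" and A: "(P has_derivative A) (at z)"
  shows "norm (A h) \<le> \<rho> * norm h"
proof (rule tendsto_upperbound)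
  show "((\<lambda>t. norm ((P (z + t *\<^sub>R h) - P z) /\<^sub>R t)) \<longlongrightarrow> norm (A h)) (at 0)"
    by (intro tendsto_norm has_derivative_directional_limit A)
  show "\<forall>\<^sub>F t in at 0. norm ((P (z + t *\<^sub>R h) - P z) /\<^sub>R t) \<le> \<rho> * norm h"
    using eventually_line_in_V[OF z, of h] eventually_neq_at_within[of 0]
  proof eventually_elim
    case (elim t)
    have "norm (P (z + t *\<^sub>R h) - P z) \<le> \<rho> * (\<bar>t\<bar> * norm h)"
      using P_lipschitz[OF elim(1) ball_V[OF z]] by simp
    moreover have "norm ((P (z + t *\<^sub>R h) - P z) /\<^sub>R t) = norm (P (z + t *\<^sub>R h) - P z) / \<bar>t\<bar>"
      by (simp add: divide_inverse mult.commute)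
    ultimately show ?case using elim(2) by (simp add: pos_divide_le_eq mult_ac)
  qed
qed simp

lemma G_derivative: "(P has_derivative A) (at z) \<Longrightarrow> (G has_derivative (\<lambda>h. \<rho> *\<^sub>R (h - A h))) (at z)"
  unfolding G_def[abs_def] by (auto intro!: derivative_eq_intros)

text \<open>Positivity is the monotonicity of \<open>P\<close> in the limit. Symmetry holds because
  \<open>\<rho> * (I - A)\<close> is the derivative of the gradient \<open>G\<close> of
  \<open>e\<close>.\<close>

lemma psd_P_derivative:
  assumes z: "z \<in> ball xbar \<eta>" and A: "(P has_derivative A) (at z)"
  shows "psd A"
  unfolding psd_def
proof (intro conjI allI)
  show "linear A" using A has_derivative_linear by blast
  show "0 \<le> A h \<bullet> h" for h
  proof (rule tendsto_lowerbound)
    show "((\<lambda>t. ((P (z + t *\<^sub>R h) - P z) /\<^sub>R t) \<bullet> h) \<longlongrightarrow> A h \<bullet> h) (at 0)"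
      by (intro tendsto_intros has_derivative_directional_limit A)
    show "\<forall>\<^sub>F t in at 0. 0 \<le> ((P (z + t *\<^sub>R h) - P z) /\<^sub>R t) \<bullet> h"
      using eventually_line_in_V[OF z, of h] eventually_neq_at_within[of 0]
    proof eventually_elim
      case (elim t)
      have "0 \<le> \<rho> * ((P (z + t *\<^sub>R h) - P z) \<bullet> (t *\<^sub>R h))"
        using order_trans[OF zero_le_power2 P_monotone[OF elim(1) ball_V[OF z]]] by simp
      then have "0 \<le> t * ((P (z + t *\<^sub>R h) - P z) \<bullet> h)"
        using rho by (simp add: zero_le_mult_iff)
      then show ?case using elim(2) by (simp add: zero_le_mult_iff)
    qed
  qed simp
  fix x y
  define s where "s = \<eta> - dist xbar z"
  have s: "s > 0" "ball z s \<subseteq> ball xbar \<eta>" using z by (auto simp: s_def ball_subset_ball_iff dist_commute)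
  have "(\<rho> *\<^sub>R (x - A x)) \<bullet> y = (\<rho> *\<^sub>R (y - A y)) \<bullet> x"
    by (rule symmetric_derivative_of_gradient[where e = e and r = s, OF s(1) e_derivative G_derivative[OF A]])
      (use s in auto)
  then show "A x \<bullet> y = x \<bullet> A y" using rho by (simp add: inner_diff inner_commute)
qed

text \<open>L'Hopital's rule reduces the second-order quotient of \<open>e\<close> to the
  first-order quotient of \<open>G\<close> along the same line.\<close>

lemma e_second_order:
  assumes z: "z \<in> ball xbar \<eta>" and A: "(P has_derivative A) (at z)"
  shows "((\<lambda>t. (e (z + t *\<^sub>R h) - e z - t * (G z \<bullet> h)) / (t\<^sup>2 / 2)) \<longlongrightarrow> \<rho> * ((h - A h) \<bullet> h)) (at_right 0)"
proof (rule lhopital_right_0[where f' = "\<lambda>t. (G (z + t *\<^sub>R h) - G z) \<bullet> h" and g' = "\<lambda>t. t"])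
  have ev: "\<forall>\<^sub>F t in at_right (0::real). z + t *\<^sub>R h \<in> ball xbar \<eta>"
    using eventually_line_in_open[OF open_ball z, of h] by (rule filter_leD[OF at_le, rotated]) simp
  have "isCont e z" using e_derivative[OF z] has_derivative_continuous by blast
  then have "((\<lambda>t. e (z + t *\<^sub>R h)) \<longlongrightarrow> e z) (at_right 0)"
    by (rule isCont_tendsto_compose) (auto intro!: tendsto_eq_intros)
  then have "((\<lambda>t. e (z + t *\<^sub>R h) - e z - t * (G z \<bullet> h)) \<longlongrightarrow> e z - e z - 0 * (G z \<bullet> h)) (at_right 0)"
    by (intro tendsto_intros)
  then show "((\<lambda>t. e (z + t *\<^sub>R h) - e z - t * (G z \<bullet> h)) \<longlongrightarrow> 0) (at_right 0)" by simp
  show "((\<lambda>t. t\<^sup>2 / 2) \<longlongrightarrow> (0::real)) (at_right 0)" by (auto intro!: tendsto_eq_intros)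
  show "\<forall>\<^sub>F t in at_right (0::real). t\<^sup>2 / 2 \<noteq> 0" "\<forall>\<^sub>F t in at_right (0::real). t \<noteq> 0"
    by (auto simp: eventually_at_filter)
  show "\<forall>\<^sub>F t in at_right 0. ((\<lambda>t. e (z + t *\<^sub>R h) - e z - t * (G z \<bullet> h)) has_real_derivative (G (z + t *\<^sub>R h) - G z) \<bullet> h) (at t)"
    using ev
  proof eventually_elim
    case (elim t)
    have "((\<lambda>t. e (z + t *\<^sub>R h)) has_derivative (\<lambda>k. G (z + t *\<^sub>R h) \<bullet> (k *\<^sub>R h))) (at t)"
      by (rule has_derivative_compose[of "\<lambda>t. z + t *\<^sub>R h" "\<lambda>k. k *\<^sub>R h" t UNIV e])
        (auto intro!: derivative_eq_intros e_derivative[OF elim])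
    moreover have "(\<lambda>k. G (z + t *\<^sub>R h) \<bullet> (k *\<^sub>R h)) = (*) (G (z + t *\<^sub>R h) \<bullet> h)" by (auto simp: mult.commute)
    ultimately have "((\<lambda>t. e (z + t *\<^sub>R h)) has_real_derivative G (z + t *\<^sub>R h) \<bullet> h) (at t)"
      by (simp add: has_field_derivative_def)
    then show ?case by (auto intro!: derivative_eq_intros simp: inner_diff_left)
  qed
  show "\<forall>\<^sub>F t in at_right 0. ((\<lambda>t. t\<^sup>2 / 2) has_real_derivative t) (at t)"
    by (intro always_eventually allI) (auto intro!: derivative_eq_intros)
  have "((\<lambda>t. ((G (z + t *\<^sub>R h) - G z) /\<^sub>R t) \<bullet> h) \<longlongrightarrow> (\<rho> *\<^sub>R (h - A h)) \<bullet> h) (at 0)"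
    by (intro tendsto_intros has_derivative_directional_limit G_derivative A)
  then have "((\<lambda>t. ((G (z + t *\<^sub>R h) - G z) \<bullet> h) / t) \<longlongrightarrow> \<rho> * ((h - A h) \<bullet> h)) (at 0)"
    by (simp add: divide_inverse mult.commute)
  then show "((\<lambda>t. ((G (z + t *\<^sub>R h) - G z) \<bullet> h) / t) \<longlongrightarrow> \<rho> * ((h - A h) \<bullet> h)) (at_right 0)"
    by (rule tendsto_within_subset) simp
qed

text \<open>This identity links second-order increments: the objective defining
  \<open>e (z + t *\<^sub>R h)\<close>, tested at \<open>P z + t *\<^sub>R u\<close>, exceeds the
  increment of \<open>f\<close> exactly by the penalty on \<open>u - h\<close>.\<close>

lemma moreau_expansion:
  "fr (P z + t *\<^sub>R u) + \<rho> / 2 * (norm (P z + t *\<^sub>R u - (z + t *\<^sub>R h)))\<^sup>2 - e z - t * (G z \<bullet> h)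
   = (fr (P z + t *\<^sub>R u) - fr (P z) - t * (G z \<bullet> u)) + \<rho> * (norm (u - h))\<^sup>2 * (t\<^sup>2 / 2)"
proof -
  have "P z + t *\<^sub>R u - (z + t *\<^sub>R h) = (P z - z) + t *\<^sub>R (u - h)" by (simp add: algebra_simps)
  then have "(norm (P z + t *\<^sub>R u - (z + t *\<^sub>R h)))\<^sup>2 = (norm (P z - z))\<^sup>2 + 2 * (t * ((P z - z) \<bullet> (u - h))) + t\<^sup>2 * (norm (u - h))\<^sup>2"
    by (simp only: norm_sq_add) (simp add: power_mult_distrib)
  then have "\<rho> / 2 * (norm (P z + t *\<^sub>R u - (z + t *\<^sub>R h)))\<^sup>2 = \<rho> / 2 * (norm (P z - z))\<^sup>2
      + \<rho> * (t * ((P z - z) \<bullet> (u - h))) + \<rho> * (norm (u - h))\<^sup>2 * (t\<^sup>2 / 2)"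
    by (simp add: distrib_left)
  moreover have "\<rho> * (t * ((P z - z) \<bullet> (u - h))) = t * (G z \<bullet> h) - t * (G z \<bullet> u)"
    by (simp add: G_def inner_diff algebra_simps)
  ultimately show ?thesis unfolding e_def by linarith
qed

lemma second_order_limit_eq: "\<rho> * ((h - A h) \<bullet> h) - \<rho> * (norm (w - h))\<^sup>2 = dual_bound \<rho> A w h"
  by (simp add: dual_bound_def power2_norm_eq_inner inner_diff inner_commute algebra_simps)

lemma second_subderiv_geI:
  assumes x: "x \<in> dom" "norm (x - xbar) < \<epsilon>"
    and k: "(k \<longlongrightarrow> l) (at_right 0 \<times>\<^sub>F nhds w)"
    and le: "\<forall>\<^sub>F p in at_right 0 \<times>\<^sub>F nhds w. 0 < fst p \<longrightarrow> x + fst p *\<^sub>R snd p \<in> dom \<longrightarrow>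
      k p * ((fst p)\<^sup>2 / 2) \<le> fr (x + fst p *\<^sub>R snd p) - fr x - fst p * (v \<bullet> snd p)"
  shows "ereal l \<le> second_subderiv f x v w"
proof -
  let ?F = "at_right (0::real) \<times>\<^sub>F nhds w"
  have F: "?F \<noteq> bot" by (simp add: prod_filter_eq_bot)
  have f1: "filterlim fst (at_right 0) ?F" and f2: "(snd \<longlongrightarrow> w) ?F"
    by (rule filterlim_fst, rule filterlim_snd)
  have fst0: "(fst \<longlongrightarrow> 0) ?F" using f1 by (simp add: filterlim_at)
  have "((\<lambda>p. ereal (k p)) \<longlongrightarrow> ereal l) ?F" using k by simp
  then have "ereal l = Liminf ?F (\<lambda>p. ereal (k p))" using lim_imp_Liminf[OF F] by metis
  also have "\<dots> \<le> second_subderiv f x v w"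
    unfolding second_subderiv_def
  proof (rule Liminf_mono)
    have "((\<lambda>p. x + fst p *\<^sub>R snd p) \<longlongrightarrow> x + 0 *\<^sub>R w) ?F" by (intro tendsto_intros fst0 f2)
    then have e1: "\<forall>\<^sub>F p in ?F. x + fst p *\<^sub>R snd p \<in> ball xbar \<epsilon>"
      using topological_tendstoD[OF _ open_ball, of _ x _ xbar \<epsilon>] x(2) by (simp add: dist_norm norm_minus_commute)
    have "\<forall>\<^sub>F t in at_right (0::real). 0 < t" by (simp add: eventually_at_right_less)
    then have e2: "\<forall>\<^sub>F p in ?F. 0 < fst p" by (rule eventually_compose_filterlim[OF _ f1])
    from e1 e2 le show "\<forall>\<^sub>F p in ?F. ereal (k p) \<le> (case p of (t, u) \<Rightarrow> (f (x + t *\<^sub>R u) - f x - ereal (t * (v \<bullet> u))) / ereal (1 / 2 * t\<^sup>2))"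
    proof eventually_elim
      case (elim p)
      obtain t u where p: "p = (t, u)" by (cases p)
      have t: "t > 0" and yc: "x + t *\<^sub>R u \<in> cball xbar \<epsilon>" using elim by (auto simp: p)
      note fx = f_dom[OF x(1)]
      show ?case
      proof (cases "x + t *\<^sub>R u \<in> dom")
        case True
        then have "k p \<le> (fr (x + t *\<^sub>R u) - fr x - t * (v \<bullet> u)) / (t\<^sup>2 / 2)"
          using elim t by (subst pos_le_divide_eq) (auto simp: p)
        then show ?thesis using t by (simp add: p f_dom[OF True] fx)
      next
        case False
        then show ?thesis using t f_not_dom[OF yc] by (simp add: p fx)
      qed
    qed
  qed
  finally show ?thesis .
qed

text \<open>Since \<open>e\<close> is an infimum, its increment in any direction \<open>h\<close>
  bounds that of \<open>f\<close> in direction \<open>u\<close> from below, up to the penalty on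
  \<open>u - h\<close>. The direction \<open>h\<close> stays free, which is where the supremum in
  \<open>dual_form\<close> comes from.\<close>

lemma second_subderiv_lower:
  assumes z: "z \<in> ball xbar \<eta>" and A: "(P has_derivative A) (at z)"
  shows "ereal (dual_bound \<rho> A w h) \<le> second_subderiv f (P z) (G z) w"
proof (rule second_subderiv_geI[OF P_dom[OF ball_V[OF z]]])
  let ?F = "at_right (0::real) \<times>\<^sub>F nhds w"
  define k where "k = (\<lambda>p. (e (z + fst p *\<^sub>R h) - e z - fst p * (G z \<bullet> h)) / ((fst p)\<^sup>2 / 2) - \<rho> * (norm (snd p - h))\<^sup>2)"
  have f1: "filterlim fst (at_right 0) ?F" and f2: "(snd \<longlongrightarrow> w) ?F"
    by (rule filterlim_fst, rule filterlim_snd)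
  show "norm (P z - xbar) < \<epsilon>"
    using is_prox_facts(2)[OF _ P[OF ball_V[OF z]]] ball_V[OF z] eps unfolding V_iff by simp
  show "(k \<longlongrightarrow> dual_bound \<rho> A w h) ?F"
    unfolding k_def second_order_limit_eq[symmetric]
    by (intro tendsto_intros f2 filterlim_compose[OF e_second_order[OF z A] f1])
  have "\<forall>\<^sub>F t in at_right 0. z + t *\<^sub>R h \<in> V"
    using filter_leD[OF at_le[OF subset_UNIV] eventually_line_in_V[OF z]] .
  then have "\<forall>\<^sub>F p in ?F. z + fst p *\<^sub>R h \<in> V" by (rule eventually_compose_filterlim[OF _ f1])
  then show "\<forall>\<^sub>F p in ?F. 0 < fst p \<longrightarrow> P z + fst p *\<^sub>R snd p \<in> dom \<longrightarrow>
      k p * ((fst p)\<^sup>2 / 2) \<le> fr (P z + fst p *\<^sub>R snd p) - fr (P z) - fst p * (G z \<bullet> snd p)"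
  proof eventually_elim
    case (elim p)
    show ?case
    proof (intro impI)
      assume t: "0 < fst p" and y: "P z + fst p *\<^sub>R snd p \<in> dom"
      have "k p * ((fst p)\<^sup>2 / 2) = e (z + fst p *\<^sub>R h) - e z - fst p * (G z \<bullet> h) - \<rho> * (norm (snd p - h))\<^sup>2 * ((fst p)\<^sup>2 / 2)"
        unfolding k_def left_diff_distrib using t by simp
      then show "k p * ((fst p)\<^sup>2 / 2) \<le> fr (P z + fst p *\<^sub>R snd p) - fr (P z) - fst p * (G z \<bullet> snd p)"
        using e_le[OF elim y] moreau_expansion[of z "fst p" "snd p" h] by linarith
    qed
  qed
qed

text \<open>Along the proximal points \<open>P (z + t *\<^sub>R h)\<close> the infimum is attained,
  so the lower estimate becomes an equality. Their directions converge to
  \<open>A h\<close>.\<close>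

lemma second_subderiv_upper:
  assumes z: "z \<in> ball xbar \<eta>" and A: "(P has_derivative A) (at z)"
  shows "second_subderiv f (P z) (G z) (A h) \<le> ereal (dual_bound \<rho> A (A h) h)"
proof -
  let ?F = "at_right (0::real) \<times>\<^sub>F nhds (A h)"
  define u where "u = (\<lambda>t. (P (z + t *\<^sub>R h) - P z) /\<^sub>R t)"
  have ulim: "(u \<longlongrightarrow> A h) (at_right 0)"
    unfolding u_def by (rule tendsto_within_subset[OF has_derivative_directional_limit[OF A]]) simp
  have c: "filterlim (\<lambda>t. (t, u t)) ?F (at_right 0)"
    by (intro filterlim_Pair ulim filterlim_ident)
  show ?thesis unfolding second_subderiv_def
  proof (rule Liminf_le_along[OF c trivial_limit_at_right_real])
    have lim: "((\<lambda>t. (e (z + t *\<^sub>R h) - e z - t * (G z \<bullet> h)) / (t\<^sup>2 / 2) - \<rho> * (norm (u t - h))\<^sup>2)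
        \<longlongrightarrow> \<rho> * ((h - A h) \<bullet> h) - \<rho> * (norm (A h - h))\<^sup>2) (at_right 0)"
      by (intro tendsto_intros e_second_order[OF z A] ulim)
    then have "((\<lambda>t. ereal ((e (z + t *\<^sub>R h) - e z - t * (G z \<bullet> h)) / (t\<^sup>2 / 2) - \<rho> * (norm (u t - h))\<^sup>2))
        \<longlongrightarrow> ereal (dual_bound \<rho> A (A h) h)) (at_right 0)"
      by (simp add: second_order_limit_eq)
    moreover have "\<forall>\<^sub>F t in at_right 0. ereal ((e (z + t *\<^sub>R h) - e z - t * (G z \<bullet> h)) / (t\<^sup>2 / 2) - \<rho> * (norm (u t - h))\<^sup>2)
      = (case (t, u t) of (t, u) \<Rightarrow> (f (P z + t *\<^sub>R u) - f (P z) - ereal (t * (G z \<bullet> u))) / ereal (1 / 2 * t\<^sup>2))"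
      using filter_leD[OF at_le[OF subset_UNIV] eventually_line_in_V[OF z, of h]] eventually_at_right_less[of "0::real"]
    proof eventually_elim
      case (elim t)
      then have t: "t > 0" and zV: "z + t *\<^sub>R h \<in> V" by auto
      have y: "P z + t *\<^sub>R u t = P (z + t *\<^sub>R h)" using t by (simp add: u_def)
      note fPz = f_dom[OF P_dom[OF ball_V[OF z]]] and fy = f_dom[OF P_dom[OF zV]]
      have "e (z + t *\<^sub>R h) - e z - t * (G z \<bullet> h) = (fr (P z + t *\<^sub>R u t) - fr (P z) - t * (G z \<bullet> u t)) + \<rho> * (norm (u t - h))\<^sup>2 * (t\<^sup>2 / 2)"
        using moreau_expansion[of z t "u t" h] unfolding y by (simp add: e_def)
      then have "(e (z + t *\<^sub>R h) - e z - t * (G z \<bullet> h)) / (t\<^sup>2 / 2) = (fr (P z + t *\<^sub>R u t) - fr (P z) - t * (G z \<bullet> u t)) / (t\<^sup>2 / 2) + \<rho> * (norm (u t - h))\<^sup>2"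
        using t by (simp add: add_divide_distrib)
      then show ?case using t by (simp add: y fPz fy)
    qed
    ultimately show "((\<lambda>t. case (t, u t) of (t, u) \<Rightarrow> (f (P z + t *\<^sub>R u) - f (P z) - ereal (t * (G z \<bullet> u))) / ereal (1 / 2 * t\<^sup>2))
        \<longlongrightarrow> ereal (dual_bound \<rho> A (A h) h)) (at_right 0)"
      by (rule Lim_transform_eventually)
  qed
qed

lemma second_subderiv_eq:
  assumes z: "z \<in> ball xbar \<eta>" and A: "(P has_derivative A) (at z)"
  shows "second_subderiv f (P z) (G z) = dual_form \<rho> A"
proof
  fix w
  note psd = psd_P_derivative[OF z A]
  have ge: "dual_form \<rho> A w \<le> second_subderiv f (P z) (G z) w"
    unfolding dual_form_def by (rule SUP_least) (rule second_subderiv_lower[OF z A])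
  show "second_subderiv f (P z) (G z) w = dual_form \<rho> A w"
  proof (cases "w \<in> range A")
    case True
    then obtain h where w: "w = A h" by blast
    then show ?thesis
      using ge second_subderiv_upper[OF z A, of h] dual_bound_le_dual_form[of \<rho> A w h] by (auto intro: antisym order_trans)
  next
    case False
    then show ?thesis using ge dual_form_not_range[OF psd rho(2) False] by simp
  qed
qed

end

subsection \<open>From the quadratic bundle to tilt stability\<close>

lemma psd_limit:
  fixes As :: "nat \<Rightarrow> 'a::euclidean_space \<Rightarrow> 'a"
  assumes As: "\<And>k. psd (As k)" and lin: "linear A" and lim: "\<And>x. (\<lambda>k. As k x) \<longlonglongrightarrow> A x"
  shows "psd A"
  unfolding psd_def
proof (intro conjI allI lin)
  fix x y
  have "(\<lambda>k. As k x \<bullet> y) \<longlonglongrightarrow> A x \<bullet> y" by (intro tendsto_intros lim)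
  moreover have "(\<lambda>k. As k x \<bullet> y) \<longlonglongrightarrow> x \<bullet> A y"
  proof -
    have "(\<lambda>k. x \<bullet> As k y) \<longlonglongrightarrow> x \<bullet> A y" by (intro tendsto_intros lim)
    moreover have "x \<bullet> As k y = As k x \<bullet> y" for k using As by (simp add: psd_def)
    ultimately show ?thesis by simp
  qed
  ultimately show "A x \<bullet> y = x \<bullet> A y" by (rule LIMSEQ_unique)
  have "(\<lambda>k. As k x \<bullet> x) \<longlonglongrightarrow> A x \<bullet> x" by (intro tendsto_intros lim)
  then show "0 \<le> A x \<bullet> x" by (rule LIMSEQ_le_const) (use As in \<open>unfold psd_def, blast\<close>)
qed

section \<open>Uniform contraction of proximal derivatives and tilted minimisers\<close>

context local_prox_regular
begin

lemma xbar_V: "xbar \<in> V" using eta(1) by simp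

lemma G_xbar: "G xbar = 0" by (simp add: G_def P_xbar)

lemma gph_P_tendsto:
  assumes "\<And>k. zs k \<in> V" "zs \<longlonglongrightarrow> xbar"
  shows "(\<lambda>k. (P (zs k), G (zs k))) \<longlonglongrightarrow> (xbar, 0)"
proof (rule tendsto_Pair)
  have n0: "(\<lambda>k. norm (zs k - xbar)) \<longlonglongrightarrow> 0"
    using assms(2) by (simp add: LIM_zero tendsto_norm_zero)
  show "(\<lambda>k. P (zs k)) \<longlonglongrightarrow> xbar"
  proof (rule LIM_zero_cancel, rule Lim_null_comparison)
    show "\<forall>\<^sub>F k in sequentially. norm (P (zs k) - xbar) \<le> 2 * \<rho> * norm (zs k - xbar)"
      using P_near assms(1) by simp
    show "(\<lambda>k. 2 * \<rho> * norm (zs k - xbar)) \<longlonglongrightarrow> 0" by (intro tendsto_mult_right_zero n0)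
  qed
  show "(\<lambda>k. G (zs k)) \<longlonglongrightarrow> 0"
  proof (rule Lim_null_comparison)
    show "\<forall>\<^sub>F k in sequentially. norm (G (zs k)) \<le> \<rho> * (1 + \<rho>) * norm (zs k - xbar)"
      using G_lipschitz[OF assms(1) xbar_V] G_xbar by simp
    show "(\<lambda>k. \<rho> * (1 + \<rho>) * norm (zs k - xbar)) \<longlonglongrightarrow> 0" by (intro tendsto_mult_right_zero n0)
  qed
qed

lemma dual_form_in_quad_bundle:
  assumes z: "\<And>k. zs k \<in> ball xbar \<eta>" "zs \<longlonglongrightarrow> xbar"
    and As: "\<And>k. (P has_derivative As k) (at (zs k))"
    and A: "linear A" "\<And>x. (\<lambda>k. As k x) \<longlonglongrightarrow> A x"
  shows "psd A" "dual_form \<rho> A \<in> quad_bundle f xbar 0"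
proof -
  have pA: "psd (As k)" for k by (rule psd_P_derivative[OF z(1) As])
  show p: "psd A" by (rule psd_limit[OF pA A])
  note eq = second_subderiv_eq[OF z(1) As]
  let ?xs = "\<lambda>k. P (zs k)" and ?vs = "\<lambda>k. G (zs k)"
  have "GQF (dual_form \<rho> A)" by (rule GQF_dual_form[OF p rho(2)])
  moreover have "\<forall>k. (?xs k, ?vs k) \<in> gph_subdiff f" using gph_P[OF ball_V[OF z(1)]] by blast
  moreover have "(\<lambda>k. (?xs k, ?vs k)) \<longlonglongrightarrow> (xbar, 0)" by (rule gph_P_tendsto[OF ball_V[OF z(1)] z(2)])
  moreover have "\<forall>k. GQF (second_subderiv f (?xs k) (?vs k))"
    unfolding eq using GQF_dual_form[OF pA rho(2)] by blast
  moreover have "epi_converges (\<lambda>k. second_subderiv f (?xs k) (?vs k)) (dual_form \<rho> A)"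
    unfolding eq by (rule epi_converges_dual_form[OF pA p rho(2) A(2)])
  ultimately show "dual_form \<rho> A \<in> quad_bundle f xbar 0"
    unfolding quad_bundle_def mem_Collect_eq
    by (intro conjI) (assumption, rule exI[of _ ?xs], rule exI[of _ ?vs], simp)
qed

text \<open>If the bound failed near \<open>xbar\<close>, a limit \<open>A\<close> of derivatives would satisfy \<open>A u \<bullet> u \<ge> 1\<close> for a
  unit vector \<open>u\<close>, and \<open>dual_form \<rho> A \<in> quad_bundle f xbar 0\<close> would be nonpositive at \<open>A u \<noteq> 0\<close>.\<close>

lemma P_derivative_strict_contraction:
  assumes pos: "\<And>w q. w \<noteq> 0 \<Longrightarrow> q \<in> quad_bundle f xbar 0 \<Longrightarrow> 0 < q w"
  shows "\<exists>\<delta>>0. \<exists>\<eta>'>0. \<eta>' \<le> \<eta> \<and> (\<forall>z\<in>ball xbar \<eta>'. \<forall>A h. (P has_derivative A) (at z) \<longrightarrow> A h \<bullet> h \<le> (1 - \<delta>) * (norm h)\<^sup>2)"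
proof (rule ccontr)
  assume neg: "\<not> ?thesis"
  define i where "i = (\<lambda>k. inverse (real (Suc k)))"
  have i: "0 < i k" "i k \<le> 1" for k by (auto simp: i_def field_simps)
  have "\<exists>z A h. z \<in> ball xbar (\<eta> * i k) \<and> (P has_derivative A) (at z) \<and> \<not> A h \<bullet> h \<le> (1 - i k) * (norm h)\<^sup>2" for k
  proof -
    have "0 < \<eta> * i k" "\<eta> * i k \<le> \<eta>" using eta(1) i[of k] by (auto simp: mult_left_le)
    then show ?thesis using neg i(1)[of k] by blast
  qed
  then obtain zs As hs where zs: "\<And>k. zs k \<in> ball xbar (\<eta> * i k)"
    and As: "\<And>k. (P has_derivative As k) (at (zs k))"
    and hs: "\<And>k. \<not> As k (hs k) \<bullet> hs k \<le> (1 - i k) * (norm (hs k))\<^sup>2" by metis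
  have bA: "bounded_linear (As k)" for k using As has_derivative_bounded_linear by blast
  have zsb: "zs k \<in> ball xbar \<eta>" for k
  proof -
    have "\<eta> * i k \<le> \<eta>" using eta(1) i[of k] by (auto simp: mult_left_le)
    then show ?thesis using zs[of k] by auto
  qed
  define us where "us = (\<lambda>k. hs k /\<^sub>R norm (hs k))"
  have hs0: "hs k \<noteq> 0" for k using hs[of k] by auto
  then have nus: "norm (us k) = 1" for k by (simp add: us_def)
  have us: "1 - i k < As k (us k) \<bullet> us k" for k
  proof -
    have "As k (us k) = As k (hs k) /\<^sub>R norm (hs k)"
      unfolding us_def using linear_scale[OF bounded_linear.linear[OF bA]] by blast
    then have "As k (us k) \<bullet> us k = (As k (hs k) \<bullet> hs k) / (norm (hs k))\<^sup>2"
      by (simp add: us_def power2_eq_square divide_inverse)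
    moreover have "1 - i k < (As k (hs k) \<bullet> hs k) / (norm (hs k))\<^sup>2"
      using hs[of k] hs0[of k] by (simp add: pos_less_divide_eq)
    ultimately show ?thesis by simp
  qed
  \<comment> \<open>As bounded operators the derivatives lie in a closed ball of a
    finite-dimensional space, so one subsequence makes operators and unit vectors converge
    together.\<close>
  define Bs where "Bs = (\<lambda>k. Blinfun (As k))"
  have Bs: "blinfun_apply (Bs k) = As k" for k unfolding Bs_def by (rule bounded_linear_Blinfun_apply[OF bA])
  have "norm (Bs k) \<le> \<rho>" for k
    by (rule norm_blinfun_bound) (use rho P_derivative_norm_le[OF zsb As] in \<open>auto simp: Bs\<close>)
  then have "\<And>k. (Bs k, us k) \<in> cball 0 \<rho> \<times> sphere 0 1" using nus by simp
  moreover have "compact (cball (0 :: 'a \<Rightarrow>\<^sub>L 'a) \<rho> \<times> sphere (0::'a) 1)"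
    by (intro compact_Times compact_cball compact_sphere)
  ultimately obtain l s where s: "strict_mono (s :: nat \<Rightarrow> nat)" "((\<lambda>k. (Bs k, us k)) \<circ> s) \<longlonglongrightarrow> l" and l: "l \<in> cball (0 :: 'a \<Rightarrow>\<^sub>L 'a) \<rho> \<times> sphere (0::'a) 1"
    unfolding compact_def by (metis (mono_tags, lifting))
  define B where "B = fst l"
  define u where "u = snd l"
  have Bl: "(\<lambda>k. Bs (s k)) \<longlonglongrightarrow> B" and ul: "(\<lambda>k. us (s k)) \<longlonglongrightarrow> u"
    using tendsto_fst[OF s(2)] tendsto_snd[OF s(2)] by (auto simp: o_def B_def u_def)
  have nu: "norm u = 1" using l by (auto simp: u_def)
  define A where "A = blinfun_apply B"
  have Al: "(\<lambda>k. As (s k) x) \<longlonglongrightarrow> A x" for x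
    using blinfun.tendsto[OF Bl tendsto_const[of x]] by (simp add: Bs A_def)
  have linA: "linear A" unfolding A_def using blinfun.bounded_linear_right bounded_linear.linear by blast
  have il: "i \<longlonglongrightarrow> 0" unfolding i_def by (rule LIMSEQ_inverse_real_of_nat)
  have "zs \<longlonglongrightarrow> xbar"
  proof (rule LIM_zero_cancel, rule Lim_null_comparison)
    show "\<forall>\<^sub>F k in sequentially. norm (zs k - xbar) \<le> \<eta> * i k"
      using zs by (intro always_eventually allI) (auto simp: dist_norm norm_minus_commute less_imp_le)
    show "(\<lambda>k. \<eta> * i k) \<longlonglongrightarrow> 0" by (intro tendsto_mult_right_zero il)
  qed
  then have zl: "(\<lambda>k. zs (s k)) \<longlonglongrightarrow> xbar" using LIMSEQ_subseq_LIMSEQ[OF _ s(1)] by (auto simp: o_def)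
  note q = dual_form_in_quad_bundle[OF zsb zl As linA Al]
  have "(\<lambda>k. As (s k) (us (s k)) \<bullet> us (s k)) \<longlonglongrightarrow> A u \<bullet> u"
    using tendsto_inner[OF blinfun.tendsto[OF Bl ul] ul] by (simp add: Bs A_def)
  moreover have "(\<lambda>k. 1 - i (s k)) \<longlonglongrightarrow> 1 - 0"
    using LIMSEQ_subseq_LIMSEQ[OF il s(1)] by (intro tendsto_intros) (simp add: o_def)
  ultimately have Auu: "1 \<le> A u \<bullet> u" using us by (intro LIMSEQ_le[of "\<lambda>k. 1 - i (s k)" 1]) (auto intro: less_imp_le)
  also have le: "A u \<bullet> u \<le> norm (A u)" using norm_cauchy_schwarz[of "A u" u] nu by simp
  finally have n1: "1 \<le> norm (A u)" .
  then have "norm (A u) \<le> norm (A u) * norm (A u)" by (simp add: mult_le_cancel_right1)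
  then have "u \<bullet> A u - A u \<bullet> A u \<le> 0" using le by (simp add: inner_commute power2_norm_eq_inner[symmetric] power2_eq_square)
  then have "\<rho> * (u \<bullet> A u - A u \<bullet> A u) \<le> 0" using rho by (simp add: mult_nonneg_nonpos)
  then have "dual_form \<rho> A (A u) \<le> 0" using dual_form_range[OF q(1), of \<rho> u] rho by simp
  moreover have "0 < dual_form \<rho> A (A u)" using n1 by (intro pos q(2)) auto
  ultimately show False by simp
qed

lemma G_strongly_monotone:
  assumes \<eta>': "\<eta>' \<le> \<eta>" and contr: "\<And>z A h. z \<in> ball xbar \<eta>' \<Longrightarrow> (P has_derivative A) (at z) \<Longrightarrow> A h \<bullet> h \<le> (1 - \<delta>) * (norm h)\<^sup>2"
    and z: "z \<in> ball xbar \<eta>'" "z' \<in> ball xbar \<eta>'"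
  shows "\<rho> * \<delta> * (norm (z' - z))\<^sup>2 \<le> (G z' - G z) \<bullet> (z' - z)"
proof -
  \<comment> \<open>The differentiation theorem is stated for maps that are Lipschitz on the whole
    space, whereas \<open>P\<close> is controlled only on \<open>V\<close>. Composing with the
    nonexpansive projection onto \<open>V\<close> keeps the constant and leaves \<open>P\<close>
    unchanged on \<open>V\<close>.\<close>
  define P' where "P' = (\<lambda>z. P (closest_point V z))"
  have cpV: "closest_point V x \<in> V" for x using eta(1) by (intro closest_point_in_set) auto
  have P'eq: "P' z = P z" if "z \<in> V" for z using that by (simp add: P'_def closest_point_self)
  have "\<rho>-lipschitz_on UNIV P'"
  proof (rule lipschitz_onI)
    fix x y
    have "dist (P' x) (P' y) \<le> \<rho> * norm (closest_point V x - closest_point V y)"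
      unfolding P'_def dist_norm by (rule P_lipschitz[OF cpV cpV])
    also have "\<dots> \<le> \<rho> * dist x y"
      unfolding dist_norm[symmetric] using rho eta(1) by (intro mult_left_mono closest_point_lipschitz) auto
    finally show "dist (P' x) (P' y) \<le> \<rho> * dist x y" .
  qed (use rho in simp)
  moreover have "A h \<bullet> h \<le> (1 - \<delta>) * (norm h)\<^sup>2" if y: "y \<in> ball xbar \<eta>'" and A: "(P' has_derivative A) (at y)" for y A h
  proof -
    have "(P has_derivative A) (at y)"
      by (rule has_derivative_transform_within_open[OF A open_ball y])
        (use \<eta>' in \<open>auto intro!: P'eq\<close>)
    then show ?thesis by (rule contr[OF y])
  qed
  ultimately have "(P' z' - P' z) \<bullet> (z' - z) \<le> (1 - \<delta>) * (norm (z' - z))\<^sup>2"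
    by (intro inner_diff_le_if_derivative_le[OF _ open_ball convex_ball _ z]) auto
  moreover have "z \<in> V" "z' \<in> V" using z \<eta>' by auto
  ultimately have "(P z' - P z) \<bullet> (z' - z) \<le> (1 - \<delta>) * (norm (z' - z))\<^sup>2" by (simp add: P'eq)
  then have "\<rho> * ((P z' - P z) \<bullet> (z' - z)) \<le> \<rho> * ((1 - \<delta>) * (norm (z' - z))\<^sup>2)"
    using rho by (intro mult_left_mono) auto
  moreover have "(G z' - G z) \<bullet> (z' - z) = \<rho> * (norm (z' - z))\<^sup>2 - \<rho> * ((P z' - P z) \<bullet> (z' - z))"
    by (simp add: G_def power2_norm_eq_inner inner_diff algebra_simps)
  ultimately show ?thesis by (simp add: algebra_simps)
qed

text \<open>Along the segment, \<open>e\<close> minus its affine and quadratic parts has a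
  nonnegative derivative by the monotonicity of \<open>G\<close>.\<close>

lemma e_strongly_convex:
  assumes \<eta>': "\<eta>' \<le> \<eta>"
    and mono: "\<And>z z'. z \<in> ball xbar \<eta>' \<Longrightarrow> z' \<in> ball xbar \<eta>' \<Longrightarrow> \<sigma> * (norm (z' - z))\<^sup>2 \<le> (G z' - G z) \<bullet> (z' - z)"
    and z: "z \<in> ball xbar \<eta>'" "z' \<in> ball xbar \<eta>'"
  shows "e z + G z \<bullet> (z' - z) + \<sigma> / 2 * (norm (z' - z))\<^sup>2 \<le> e z'"
proof -
  define d where "d = z' - z"
  define \<phi> where "\<phi> = (\<lambda>s. e (z + s *\<^sub>R d) - s * (G z \<bullet> d) - \<sigma> * (norm d)\<^sup>2 * s\<^sup>2 / 2)"
  have "\<phi> 0 \<le> \<phi> 1"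
  proof (rule DERIV_nonneg_imp_nondecreasing[of 0 1 \<phi>])
    fix s :: real assume s: "0 \<le> s" "s \<le> 1"
    have "(1 - s) *\<^sub>R z + s *\<^sub>R z' \<in> ball xbar \<eta>'" using convexD[OF convex_ball z, of "1 - s" s] s by simp
    moreover have "(1 - s) *\<^sub>R z + s *\<^sub>R z' = z + s *\<^sub>R d" by (simp add: d_def algebra_simps)
    ultimately have y: "z + s *\<^sub>R d \<in> ball xbar \<eta>'" by simp
    then have y': "z + s *\<^sub>R d \<in> ball xbar \<eta>" using \<eta>' by auto
    have "((\<lambda>s. e (z + s *\<^sub>R d)) has_derivative (\<lambda>k. G (z + s *\<^sub>R d) \<bullet> (k *\<^sub>R d))) (at s)"
      by (rule has_derivative_compose[of "\<lambda>s. z + s *\<^sub>R d" "\<lambda>k. k *\<^sub>R d" s UNIV e])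
        (auto intro!: derivative_eq_intros e_derivative[OF y'])
    moreover have "(\<lambda>k. G (z + s *\<^sub>R d) \<bullet> (k *\<^sub>R d)) = (*) (G (z + s *\<^sub>R d) \<bullet> d)" by (auto simp: mult.commute)
    ultimately have "((\<lambda>s. e (z + s *\<^sub>R d)) has_real_derivative G (z + s *\<^sub>R d) \<bullet> d) (at s)"
      by (simp add: has_field_derivative_def)
    then have "(\<phi> has_real_derivative (G (z + s *\<^sub>R d) - G z) \<bullet> d - \<sigma> * (norm d)\<^sup>2 * s) (at s)"
      unfolding \<phi>_def by (auto intro!: derivative_eq_intros simp: inner_diff_left)
    moreover have "0 \<le> (G (z + s *\<^sub>R d) - G z) \<bullet> d - \<sigma> * (norm d)\<^sup>2 * s"
    proof (cases "s = 0")
      case False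
      have "\<sigma> * (norm (s *\<^sub>R d))\<^sup>2 \<le> (G (z + s *\<^sub>R d) - G z) \<bullet> (s *\<^sub>R d)" using mono[OF z(1) y] by simp
      then have "s * (\<sigma> * (norm d)\<^sup>2 * s) \<le> s * ((G (z + s *\<^sub>R d) - G z) \<bullet> d)"
        by (simp add: power_mult_distrib power2_eq_square mult_ac)
      then show ?thesis using False s by (simp add: mult_le_cancel_left)
    qed simp
    ultimately show "\<exists>y. DERIV \<phi> s :> y \<and> y \<ge> 0" by blast
  qed simp
  then show ?thesis by (simp add: \<phi>_def d_def)
qed

text \<open>An interior minimiser \<open>Z v\<close> of the tilted envelope solves
  \<open>G (Z v) = v\<close>, so \<open>P (Z v) = Z v - v /\<^sub>R \<rho>\<close>. Strong convexity
  of \<open>e\<close> then passes to quadratic growth of \<open>f\<close> at this point, and strong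
  monotonicity of \<open>G\<close> makes \<open>Z\<close> Lipschitz.\<close>

lemma tilt_stable_if_G_strongly_monotone:
  assumes \<eta>': "0 < \<eta>'" "\<eta>' \<le> \<eta>" and \<sigma>: "\<sigma> > 0"
    and mono: "\<And>z z'. z \<in> ball xbar \<eta>' \<Longrightarrow> z' \<in> ball xbar \<eta>' \<Longrightarrow> \<sigma> * (norm (z' - z))\<^sup>2 \<le> (G z' - G z) \<bullet> (z' - z)"
  shows "tilt_stable f xbar"
proof -
  have sc: "e z + G z \<bullet> (z' - z) + \<sigma> / 2 * (norm (z' - z))\<^sup>2 \<le> e z'"
    if "z \<in> ball xbar \<eta>'" "z' \<in> ball xbar \<eta>'" for z z'
    using that by (intro e_strongly_convex[OF \<eta>'(2)] mono)
  define \<kappa> where "\<kappa> = \<eta>' / 2"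
  define \<gamma> where "\<gamma> = \<kappa> / 2"
  \<comment> \<open>The three bounds keep the shift \<open>v /\<^sub>R \<rho>\<close> within
    \<open>\<kappa> / 2\<close>, the minimiser \<open>Z v\<close> interior to the ball of radius
    \<open>\<kappa>\<close>, and \<open>m v\<close> within \<open>\<gamma>\<close> of
    \<open>xbar\<close>.\<close>
  define \<nu> where "\<nu> = min (\<rho> * \<kappa> / 2) (min (\<sigma> * \<kappa> / 4) (\<sigma> * \<gamma> / (4 * \<rho>)))"
  have \<kappa>: "0 < \<kappa>" "\<kappa> < \<eta>'" "0 < \<gamma>" "\<gamma> \<le> \<epsilon>" using \<eta>' eta(6) eps by (auto simp: \<kappa>_def \<gamma>_def)
  have \<nu>: "\<nu> > 0" using \<kappa> \<sigma> rho by (auto simp: \<nu>_def)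
  have sub: "cball xbar \<kappa> \<subseteq> ball xbar \<eta>'" using \<kappa> by auto
  have subV: "ball xbar \<eta>' \<subseteq> V" using \<eta>' by auto
  have xb: "xbar \<in> ball xbar \<eta>'" using \<eta>' by simp
  have "\<exists>z\<in>cball xbar \<kappa>. G z = v \<and> norm (z - xbar) \<le> 2 * norm v / \<sigma>" if v: "norm v < \<nu>" for v
  proof -
    have der: "((\<lambda>z. e z - v \<bullet> z) has_derivative (\<lambda>h. G z \<bullet> h - v \<bullet> h)) (at z)" if "z \<in> cball xbar \<kappa>" for z
      using that sub \<eta>' by (auto intro!: derivative_eq_intros e_derivative)
    have "continuous_on (cball xbar \<kappa>) (\<lambda>z. e z - v \<bullet> z)"
      using der has_derivative_continuous by (blast intro: continuous_at_imp_continuous_on)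
    then obtain z where z: "z \<in> cball xbar \<kappa>" "\<And>y. y \<in> cball xbar \<kappa> \<Longrightarrow> e z - v \<bullet> z \<le> e y - v \<bullet> y"
      using continuous_attains_inf[OF compact_cball, of xbar \<kappa>] \<kappa>(1) by force
    have "e xbar + \<sigma> / 2 * (norm (z - xbar))\<^sup>2 \<le> e z" using sc[OF xb, of z] z(1) sub by (auto simp: G_xbar)
    moreover have "e z - v \<bullet> z \<le> e xbar - v \<bullet> xbar" using \<kappa>(1) by (intro z(2)) simp
    ultimately have "\<sigma> / 2 * (norm (z - xbar))\<^sup>2 \<le> v \<bullet> (z - xbar)" by (simp add: inner_diff_right)
    also have "\<dots> \<le> norm v * norm (z - xbar)" by (rule norm_cauchy_schwarz)
    finally have "norm (z - xbar) * (\<sigma> / 2 * norm (z - xbar)) \<le> norm (z - xbar) * norm v"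
      by (simp add: power2_eq_square mult_ac)
    then have "norm (z - xbar) = 0 \<or> \<sigma> / 2 * norm (z - xbar) \<le> norm v"
      by (smt (verit) mult_le_cancel_left_pos norm_ge_zero)
    then have nz: "norm (z - xbar) \<le> 2 * norm v / \<sigma>" using \<sigma> by (auto simp: field_simps)
    have "norm v < \<sigma> * \<kappa> / 4" using v by (simp add: \<nu>_def)
    then have "2 * norm v / \<sigma> < \<kappa>" using \<sigma> \<kappa> by (simp add: field_simps) (smt (verit) mult_pos_pos)
    with nz have zb: "z \<in> ball xbar \<kappa>" by (simp add: dist_norm norm_minus_commute)
    have "(\<lambda>h. G z \<bullet> h - v \<bullet> h) = (\<lambda>h. 0)"
      by (rule differential_zero_maxmin[OF zb open_ball der[OF z(1)]]) (use z in auto)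
    \<comment> \<open>The vanishing derivative is evaluated in the direction
      \<open>G z - v\<close>.\<close>
    then have "G z \<bullet> (G z - v) - v \<bullet> (G z - v) = 0" by metis
    then have "(G z - v) \<bullet> (G z - v) = 0" by (simp add: inner_diff_left)
    then have "G z = v" by simp
    with z nz show ?thesis by blast
  qed
  then obtain Z where Z: "\<And>v. norm v < \<nu> \<Longrightarrow> Z v \<in> cball xbar \<kappa>" "\<And>v. norm v < \<nu> \<Longrightarrow> G (Z v) = v"
    "\<And>v. norm v < \<nu> \<Longrightarrow> norm (Z v - xbar) \<le> 2 * norm v / \<sigma>" by metis
  define m where "m = (\<lambda>v. P (Z v))"
  have ZV: "Z v \<in> V" "Z v \<in> ball xbar \<eta>'" if "norm v < \<nu>" for v using Z(1)[OF that] sub subV by blast+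
  have growth: "fr (m v) - v \<bullet> m v + \<sigma> / 2 * (norm (y - m v))\<^sup>2 \<le> fr y - v \<bullet> y"
    if v: "norm v < \<nu>" and y: "y \<in> dom" "y \<in> cball xbar \<gamma>" for v y
  proof -
    \<comment> \<open>Evaluating \<open>e\<close> at \<open>y + w\<close> with competitor
      \<open>y\<close> costs the same penalty as evaluating it at \<open>Z v\<close> with
      \<open>m v\<close>, so the penalties cancel and only \<open>f\<close> remains.\<close>
    define w where "w = v /\<^sub>R \<rho>"
    have "w = G (Z v) /\<^sub>R \<rho>" by (simp add: w_def Z(2)[OF v])
    then have mw: "m v = Z v - w" using rho by (simp add: m_def G_def)
    have nw: "norm w \<le> \<kappa> / 2" using v rho by (simp add: w_def \<nu>_def field_simps)
    have "norm (y + w - xbar) \<le> norm (y - xbar) + norm w" using norm_triangle_ineq[of "y - xbar" w] by (simp add: algebra_simps)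
    also have "\<dots> \<le> \<kappa>" using y(2) nw by (simp add: \<gamma>_def dist_norm norm_minus_commute)
    finally have "y + w \<in> cball xbar \<kappa>" by (simp add: dist_norm norm_minus_commute)
    then have yw: "y + w \<in> ball xbar \<eta>'" using sub by blast
    have "e (Z v) + v \<bullet> (y + w - Z v) + \<sigma> / 2 * (norm (y + w - Z v))\<^sup>2 \<le> e (y + w)"
      using sc[OF ZV(2)[OF v] yw] Z(2)[OF v] by simp
    moreover have "e (y + w) \<le> fr y + \<rho> / 2 * (norm w)\<^sup>2" using e_le[of "y + w" y] yw subV y(1) by auto
    moreover have "e (Z v) = fr (m v) + \<rho> / 2 * (norm w)\<^sup>2" using mw by (simp add: e_def m_def)
    moreover have "y + w - Z v = y - m v" by (simp add: mw)
    ultimately have "fr (m v) + v \<bullet> (y - m v) + \<sigma> / 2 * (norm (y - m v))\<^sup>2 \<le> fr y" by simp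
    then show ?thesis by (simp add: inner_diff_right)
  qed
  have m_in: "m v \<in> dom" "m v \<in> cball xbar \<gamma>" if v: "norm v < \<nu>" for v
  proof -
    show "m v \<in> dom" unfolding m_def by (rule P_dom[OF ZV(1)[OF v]])
    have "norm (m v - xbar) \<le> 2 * \<rho> * norm (Z v - xbar)" unfolding m_def by (rule P_near[OF ZV(1)[OF v]])
    also have "\<dots> \<le> 2 * \<rho> * (2 * norm v / \<sigma>)" using Z(3)[OF v] rho by (intro mult_left_mono) auto
    also have "\<dots> \<le> 2 * \<rho> * (2 * (\<sigma> * \<gamma> / (4 * \<rho>)) / \<sigma>)"
      using v rho \<sigma> by (intro mult_left_mono divide_right_mono) (auto simp: \<nu>_def)
    also have "\<dots> = \<gamma>" using rho \<sigma> by simp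
    finally show "m v \<in> cball xbar \<gamma>" by (simp add: dist_norm norm_minus_commute)
  qed
  have argmin: "tilt_argmin f xbar \<gamma> v = {m v}" if v: "norm v < \<nu>" for v
  proof -
    note fm = f_dom[OF m_in(1)[OF v]]
    have cd: "y \<in> cball xbar \<epsilon>" if "y \<in> cball xbar \<gamma>" for y using that \<kappa>(4) by auto
    have "m v \<in> tilt_argmin f xbar \<gamma> v"
      unfolding tilt_argmin_def
    proof (intro CollectI conjI ballI m_in(2)[OF v])
      fix y assume y: "y \<in> cball xbar \<gamma>"
      show "f (m v) - ereal (v \<bullet> m v) \<le> f y - ereal (v \<bullet> y)"
      proof (cases "y \<in> dom")
        case True
        have "0 \<le> \<sigma> / 2 * (norm (y - m v))\<^sup>2" using \<sigma> by simp
        then show ?thesis using growth[OF v True y] by (simp add: fm f_dom[OF True])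
      qed (use f_not_dom[OF cd[OF y]] in simp)
    qed
    moreover have "y = m v" if y: "y \<in> tilt_argmin f xbar \<gamma> v" for y
    proof -
      have yc: "y \<in> cball xbar \<gamma>" and le: "f y - ereal (v \<bullet> y) \<le> f (m v) - ereal (v \<bullet> m v)"
        using y m_in(2)[OF v] by (auto simp: tilt_argmin_def)
      have yd: "y \<in> dom" using le f_not_dom[OF cd[OF yc]] by (cases "y \<in> dom") (auto simp: fm)
      have "fr y - v \<bullet> y \<le> fr (m v) - v \<bullet> m v" using le by (simp add: fm f_dom[OF yd])
      then have "\<sigma> / 2 * (norm (y - m v))\<^sup>2 \<le> 0" using growth[OF v yd yc] by linarith
      then show ?thesis using \<sigma> by (simp add: mult_le_0_iff)
    qed
    ultimately show ?thesis by blast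
  qed
  have "(\<rho> / \<sigma>)-lipschitz_on (ball (0 :: 'a) \<nu>) m"
  proof (rule lipschitz_onI)
    fix v v' :: 'a assume "v \<in> ball 0 \<nu>" "v' \<in> ball 0 \<nu>"
    then have v: "norm v < \<nu>" "norm v' < \<nu>" by auto
    have "\<sigma> * (norm (Z v - Z v'))\<^sup>2 \<le> (v - v') \<bullet> (Z v - Z v')"
      using mono[OF ZV(2)[OF v(2)] ZV(2)[OF v(1)]] Z(2)[OF v(1)] Z(2)[OF v(2)] by simp
    also have "\<dots> \<le> norm (v - v') * norm (Z v - Z v')" by (rule norm_cauchy_schwarz)
    finally have "norm (Z v - Z v') * (\<sigma> * norm (Z v - Z v')) \<le> norm (Z v - Z v') * norm (v - v')"
      by (simp add: power2_eq_square mult_ac)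
    then have "norm (Z v - Z v') = 0 \<or> \<sigma> * norm (Z v - Z v') \<le> norm (v - v')"
      by (smt (verit) mult_le_cancel_left_pos norm_ge_zero)
    then have "norm (Z v - Z v') \<le> norm (v - v') / \<sigma>" using \<sigma> by (auto simp: field_simps)
    then have "\<rho> * norm (Z v - Z v') \<le> \<rho> * (norm (v - v') / \<sigma>)" using rho by (intro mult_left_mono) auto
    then show "dist (m v) (m v') \<le> \<rho> / \<sigma> * dist v v'"
      using P_lipschitz[OF ZV(1)[OF v(1)] ZV(1)[OF v(2)]] by (simp add: m_def dist_norm)
  qed (use rho \<sigma> in simp)
  moreover have "m 0 = xbar"
    using Z(3)[of 0] \<nu> by (simp add: m_def P_xbar)
  moreover have "\<forall>v\<in>ball 0 \<nu>. tilt_argmin f xbar \<gamma> v = {m v}" using argmin by simp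
  moreover have "tilt_argmin f xbar \<gamma> 0 = {m 0}" using argmin \<nu> by simp
  moreover have "open (ball (0::'a) \<nu>)" "0 \<in> ball (0::'a) \<nu>" using \<nu> by auto
  ultimately show ?thesis unfolding tilt_stable_def using fin \<kappa>(3) by metis
qed

lemma tilt_stable_if_quad_bundle_pos:
  assumes "\<And>w q. w \<noteq> 0 \<Longrightarrow> q \<in> quad_bundle f xbar 0 \<Longrightarrow> 0 < q w"
  shows "tilt_stable f xbar"
proof -
  obtain \<delta> \<eta>' where "\<delta> > 0" and \<eta>': "0 < \<eta>'" "\<eta>' \<le> \<eta>"
    and contr: "\<And>z A h. z \<in> ball xbar \<eta>' \<Longrightarrow> (P has_derivative A) (at z) \<Longrightarrow> A h \<bullet> h \<le> (1 - \<delta>) * (norm h)\<^sup>2"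
    using P_derivative_strict_contraction assms by blast
  show ?thesis
  proof (rule tilt_stable_if_G_strongly_monotone[OF \<eta>'])
    show "0 < \<rho> * \<delta>" using \<open>\<delta> > 0\<close> rho by simp
    show "\<rho> * \<delta> * (norm (z' - z))\<^sup>2 \<le> (G z' - G z) \<bullet> (z' - z)"
      if "z \<in> ball xbar \<eta>'" "z' \<in> ball xbar \<eta>'" for z z'
      using G_strongly_monotone[OF \<eta>'(2), of \<delta> z z'] contr that by blast
  qed
qed

end

subsection \<open>From tilt stability to the quadratic bundle\<close>

text \<open>The tilt \<open>v\<close> is perturbed by \<open>d\<close> towards \<open>y\<close>. The
  gain is \<open>d \<bullet> (y - m v)\<close>, while the minimiser moves by at most
  \<open>C * norm d\<close>, so the loss is quadratic in \<open>d\<close>.\<close>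

lemma tilt_minimizer_growth:
  fixes m :: "'a::real_inner \<Rightarrow> 'a"
  assumes C: "C > 0" and \<delta>: "\<delta> > 0"
    and min: "\<And>v y. norm v \<le> \<delta> \<Longrightarrow> y \<in> D \<Longrightarrow> h (m v) - v \<bullet> m v \<le> h y - v \<bullet> y"
    and mD: "\<And>v. norm v \<le> \<delta> \<Longrightarrow> m v \<in> D"
    and lip: "\<And>v v'. norm v \<le> \<delta> \<Longrightarrow> norm v' \<le> \<delta> \<Longrightarrow> norm (m v - m v') \<le> C * norm (v - v')"
    and v: "norm v \<le> \<delta> / 2" and y: "y \<in> D" "norm (y - m v) \<le> C * \<delta>"
  shows "h (m v) + v \<bullet> (y - m v) + 1 / (2 * C) / 2 * (norm (y - m v))\<^sup>2 \<le> (h y :: real)"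
proof -
  define x where "x = m v"
  \<comment> \<open>The factor \<open>1 / (2 * C)\<close> maximises
    \<open>t - C * t\<^sup>2\<close>, which is the guaranteed gain per squared distance for
    \<open>d = t *\<^sub>R (y - x)\<close>.\<close>
  define d where "d = (1 / (2 * C)) *\<^sub>R (y - x)"
  have nd: "norm d = norm (y - x) / (2 * C)" using C by (simp add: d_def)
  have "norm d \<le> \<delta> / 2" using y(2) C by (simp add: nd x_def field_simps)
  then have v': "norm (v + d) \<le> \<delta>" using v norm_triangle_ineq[of v d] by linarith
  have v\<delta>: "norm v \<le> \<delta>" using v \<delta> by linarith
  define x' where "x' = m (v + d)"
  have 1: "h x' - (v + d) \<bullet> x' \<le> h y - (v + d) \<bullet> y" unfolding x'_def by (rule min[OF v' y(1)])
  have 2: "h x - v \<bullet> x \<le> h x' - v \<bullet> x'" unfolding x_def x'_def by (rule min[OF v\<delta> mD[OF v']])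
  have "d \<bullet> (x' - x) \<le> norm d * norm (x' - x)" by (rule norm_cauchy_schwarz)
  also have "\<dots> \<le> norm d * (C * norm d)"
    using lip[OF v' v\<delta>] by (intro mult_left_mono) (auto simp: x_def x'_def)
  also have "\<dots> = (norm (y - x))\<^sup>2 / (4 * C)" using C by (simp add: nd power2_eq_square field_simps)
  finally have 3: "d \<bullet> (x' - x) \<le> (norm (y - x))\<^sup>2 / (4 * C)" .
  have 4: "d \<bullet> (y - x) = (norm (y - x))\<^sup>2 / (2 * C)" by (simp add: d_def power2_norm_eq_inner)
  have "h x + v \<bullet> (y - x) + (d \<bullet> (y - x) - d \<bullet> (x' - x)) \<le> h y"
    using 1 2 by (simp add: inner_diff_right inner_add_left)
  moreover have "(norm (y - x))\<^sup>2 / (2 * C) - (norm (y - x))\<^sup>2 / (4 * C) = 1 / (2 * C) / 2 * (norm (y - x))\<^sup>2"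
    using C by (simp add: field_simps)
  ultimately show ?thesis using 3 4 unfolding x_def by linarith
qed

text \<open>The required \<open>v\<close> minimises the regularised conjugate
  \<open>\<theta> v + \<parallel>v\<parallel>\<^sup>2 / (2 * s) - z \<bullet> v\<close>, where \<open>\<theta> v = v \<bullet> m v - h (m v)\<close> has gradient \<open>m\<close>.\<close>

lemma tilt_minimizer_resolvent:
  fixes m :: "'a::euclidean_space \<Rightarrow> 'a"
  assumes C: "C > 0" and s: "s > (0::real)"
    and min: "\<And>v y. norm v \<le> \<delta> \<Longrightarrow> y \<in> D \<Longrightarrow> h (m v) - v \<bullet> m v \<le> (h y :: real) - v \<bullet> y"
    and mD: "\<And>v. norm v \<le> \<delta> \<Longrightarrow> m v \<in> D"
    and lip: "\<And>v v'. norm v \<le> \<delta> \<Longrightarrow> norm v' \<le> \<delta> \<Longrightarrow> norm (m v - m v') \<le> C * norm (v - v')"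
    and z: "2 * s * norm (z - m 0) < \<delta>"
  shows "\<exists>v. norm v \<le> 2 * s * norm (z - m 0) \<and> m v + v /\<^sub>R s = z"
proof -
  have \<delta>: "\<delta> > 0" using z s by (smt (verit) mult_nonneg_nonneg norm_ge_zero)
  define \<theta> where "\<theta> = (\<lambda>v. v \<bullet> m v - h (m v))"
  \<comment> \<open>Optimality of \<open>m v\<close> against the competitor \<open>m v'\<close> says
    that \<open>m v'\<close> is a subgradient of \<open>\<theta>\<close> at
    \<open>v'\<close>.\<close>
  have up: "\<theta> v' - \<theta> v \<le> m v' \<bullet> (v' - v)" if "norm v \<le> \<delta>" "norm v' \<le> \<delta>" for v v'
    using min[OF that(1) mD[OF that(2)]] by (simp add: \<theta>_def inner_diff inner_commute)
  define R where "R = norm (m 0) + C * \<delta>"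
  have mR: "norm (m v) \<le> R" if "norm v \<le> \<delta>" for v
  proof -
    have "norm (m v) \<le> norm (m 0) + norm (m v - m 0)" using norm_triangle_ineq[of "m 0" "m v - m 0"] by simp
    also have "norm (m v - m 0) \<le> C * norm v" using lip[OF that, of 0] \<delta> by simp
    also have "C * norm v \<le> C * \<delta>" using that C by simp
    finally show ?thesis by (simp add: R_def)
  qed
  have up': "\<theta> v' - \<theta> v \<le> R * norm (v' - v)" if "norm v \<le> \<delta>" "norm v' \<le> \<delta>" for v v'
  proof -
    have "\<theta> v' - \<theta> v \<le> norm (m v') * norm (v' - v)"
      using up[OF that] norm_cauchy_schwarz[of "m v'" "v' - v"] by linarith
    also have "\<dots> \<le> R * norm (v' - v)" using mR[OF that(2)] by (intro mult_right_mono) auto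
    finally show ?thesis .
  qed
  have "R-lipschitz_on (cball 0 \<delta>) \<theta>"
  proof (rule lipschitz_onI)
    fix v v' :: 'a assume "v \<in> cball 0 \<delta>" "v' \<in> cball 0 \<delta>"
    then have "norm v \<le> \<delta>" "norm v' \<le> \<delta>" by auto
    then show "dist (\<theta> v) (\<theta> v') \<le> R * dist v v'"
      using up'[of v v'] up'[of v' v] by (simp add: dist_real_def dist_norm norm_minus_commute abs_le_iff)
  qed (use C \<delta> in \<open>auto simp: R_def\<close>)
  then have cont: "continuous_on (cball 0 \<delta>) \<theta>" by (rule lipschitz_on_continuous_on)
  define \<psi> where "\<psi> = (\<lambda>v. \<theta> v + (norm v)\<^sup>2 / (2 * s) - z \<bullet> v)"
  have "continuous_on (cball 0 \<delta>) \<psi>" unfolding \<psi>_def using s by (intro continuous_intros cont) auto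
  then obtain v where v: "v \<in> cball 0 \<delta>" "\<And>v'. v' \<in> cball 0 \<delta> \<Longrightarrow> \<psi> v \<le> \<psi> v'"
    using continuous_attains_inf[OF compact_cball, of 0 \<delta> \<psi>] \<delta> by force
  have nv: "norm v \<le> \<delta>" using v by simp
  have "\<psi> v \<le> \<psi> 0" using \<delta> by (intro v(2)) simp
  moreover have "\<theta> 0 + v \<bullet> m 0 \<le> \<theta> v"
    using up[OF nv, of 0] \<delta> by (simp add: inner_commute)
  ultimately have "(norm v)\<^sup>2 / (2 * s) \<le> (z - m 0) \<bullet> v" by (simp add: \<psi>_def inner_diff inner_commute)
  also have "\<dots> \<le> norm (z - m 0) * norm v" by (rule norm_cauchy_schwarz)
  finally have "norm v * norm v \<le> norm v * (2 * s * norm (z - m 0))"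
    using s by (simp add: power2_eq_square field_simps)
  \<comment> \<open>Comparison with the value at \<open>0\<close> places the minimiser strictly
    inside the ball, so no multiplier for the constraint appears.\<close>
  then have nv2: "norm v \<le> 2 * s * norm (z - m 0)"
    using s by (cases "v = 0") (auto simp: mult_le_cancel_left)
  \<comment> \<open>\<open>E\<close> is the gradient of \<open>\<psi>\<close> at \<open>v\<close>.
    If it were nonzero, a short step against it would decrease \<open>\<psi>\<close>.\<close>
  define E where "E = m v + v /\<^sub>R s - z"
  have "E = 0"
  proof (rule ccontr)
    assume E: "E \<noteq> 0"
    \<comment> \<open>\<open>K\<close> sums the quadratic errors from the Lipschitz constant of
      \<open>m\<close> and from the squared norm. The step length \<open>t\<close> keeps the total
      error within half the first-order decrease and the new point inside the ball.\<close>
    define K where "K = C + 1 / (2 * s)"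
    have K: "K > 0" using C s by (simp add: K_def add_pos_pos)
    define t where "t = min (1 / (2 * K)) ((\<delta> - norm v) / norm E)"
    have t: "t > 0" using K nv2 z E by (simp add: t_def)
    have tK: "t * K \<le> 1 / 2" using K by (simp add: t_def min_def field_simps)
    have "t * norm E \<le> \<delta> - norm v" using E by (simp add: t_def min_def field_simps)
    then have v': "norm (v - t *\<^sub>R E) \<le> \<delta>" using norm_triangle_ineq4[of v "t *\<^sub>R E"] t by simp
    have "\<psi> v \<le> \<psi> (v - t *\<^sub>R E)" using v' by (intro v(2)) simp
    moreover have "\<theta> (v - t *\<^sub>R E) - \<theta> v \<le> - t * (m (v - t *\<^sub>R E) \<bullet> E)" using up[OF nv v'] by simp
    moreover have "(norm (v - t *\<^sub>R E))\<^sup>2 / (2 * s) = (norm v)\<^sup>2 / (2 * s) - t * ((v /\<^sub>R s) \<bullet> E) + t\<^sup>2 * (norm E)\<^sup>2 / (2 * s)"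
      using norm_sq_add[of v "- (t *\<^sub>R E)"] s by (simp add: power_mult_distrib field_simps)
    ultimately have "0 \<le> - t * (m (v - t *\<^sub>R E) \<bullet> E) - t * ((v /\<^sub>R s) \<bullet> E) + t\<^sup>2 * (norm E)\<^sup>2 / (2 * s) + t * (z \<bullet> E)"
      by (simp add: \<psi>_def inner_diff_right)
    also have "\<dots> = t * ((m v - m (v - t *\<^sub>R E)) \<bullet> E) - t * (E \<bullet> E) + t\<^sup>2 * (norm E)\<^sup>2 / (2 * s)"
      by (simp add: E_def inner_diff_left inner_add_left algebra_simps)
    also have "(m v - m (v - t *\<^sub>R E)) \<bullet> E \<le> (C * (t * norm E)) * norm E"
    proof -
      have "(m v - m (v - t *\<^sub>R E)) \<bullet> E \<le> norm (m v - m (v - t *\<^sub>R E)) * norm E" by (rule norm_cauchy_schwarz)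
      also have "\<dots> \<le> (C * (t * norm E)) * norm E"
        using lip[OF nv v'] t by (intro mult_right_mono) auto
      finally show ?thesis .
    qed
    finally have "0 \<le> t * ((C * (t * norm E)) * norm E) - t * (E \<bullet> E) + t\<^sup>2 * (norm E)\<^sup>2 / (2 * s)"
      using t by (simp add: mult_left_mono)
    also have "\<dots> = t * ((t * K - 1) * (norm E)\<^sup>2)"
      using s by (simp add: K_def power2_norm_eq_inner power2_eq_square norm_eq_sqrt_inner field_simps)
    finally have "0 \<le> (t * K - 1) * (norm E)\<^sup>2" using t by (simp add: zero_le_mult_iff)
    then show False using tK E by (simp add: zero_le_mult_iff)
  qed
  then have "m v + v /\<^sub>R s = z" by (simp add: E_def)
  with nv2 show ?thesis by blast
qed

section \<open>Positivity of the quadratic bundle under tilt stability\<close>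

context local_prox_regular
begin

lemma second_subderiv_ge_of_growth:
  assumes x: "x \<in> dom" "norm (x - xbar) < s" "s \<le> \<epsilon>" and d: "d > 0"
    and growth: "\<And>y. y \<in> dom \<Longrightarrow> norm (y - xbar) \<le> s \<Longrightarrow> norm (y - x) \<le> d \<Longrightarrow>
      fr x + v \<bullet> (y - x) + c / 2 * (norm (y - x))\<^sup>2 \<le> fr y"
  shows "ereal (c * (norm w)\<^sup>2) \<le> second_subderiv f x v w"
proof (rule second_subderiv_geI[OF x(1)])
  let ?F = "at_right (0::real) \<times>\<^sub>F nhds w"
  have f1: "filterlim fst (at_right 0) ?F" and f2: "(snd \<longlongrightarrow> w) ?F"
    by (rule filterlim_fst, rule filterlim_snd)
  have fst0: "(fst \<longlongrightarrow> 0) ?F" using f1 by (simp add: filterlim_at)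
  show "norm (x - xbar) < \<epsilon>" using x by simp
  show "((\<lambda>p. c * (norm (snd p))\<^sup>2) \<longlongrightarrow> c * (norm w)\<^sup>2) ?F" by (intro tendsto_intros f2)
  define S where "S = ball xbar s \<inter> ball x d"
  have S: "open S" "x \<in> S" using x(2) d by (auto simp: S_def dist_norm norm_minus_commute)
  have "((\<lambda>p. x + fst p *\<^sub>R snd p) \<longlongrightarrow> x + 0 *\<^sub>R w) ?F" by (intro tendsto_intros fst0 f2)
  then have "\<forall>\<^sub>F p in ?F. x + fst p *\<^sub>R snd p \<in> S" using topological_tendstoD[OF _ S(1)] S(2) by simp
  then show "\<forall>\<^sub>F p in ?F. 0 < fst p \<longrightarrow> x + fst p *\<^sub>R snd p \<in> dom \<longrightarrow>
      c * (norm (snd p))\<^sup>2 * ((fst p)\<^sup>2 / 2) \<le> fr (x + fst p *\<^sub>R snd p) - fr x - fst p * (v \<bullet> snd p)"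
  proof eventually_elim
    case (elim p)
    then have "norm (x + fst p *\<^sub>R snd p - xbar) < s" "norm (x + fst p *\<^sub>R snd p - x) < d"
      by (simp_all add: S_def dist_norm norm_minus_commute)
    then show ?case using growth[of "x + fst p *\<^sub>R snd p"] by (simp add: power_mult_distrib algebra_simps)
  qed
qed

text \<open>All second subderivatives along the approximating sequence share the lower bound
  \<open>c * (norm u)\<^sup>2\<close> from some index on. Such a continuous bound passes to any
  epi-limit.\<close>

lemma quad_bundle_pos_if_tilt_stable:
  assumes tilt: "tilt_stable f xbar" and sdc: "subdiff_continuous f xbar 0"
    and q: "q \<in> quad_bundle f xbar 0" and w: "w \<noteq> 0"
  shows "0 < q w"
proof -
  obtain \<gamma> U m C0 where \<gamma>: "\<gamma> > 0" and arg0: "tilt_argmin f xbar \<gamma> 0 = {xbar}" and U: "open U" "0 \<in> U"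
    and arg: "\<And>v. v \<in> U \<Longrightarrow> tilt_argmin f xbar \<gamma> v = {m v}" and lip0: "C0-lipschitz_on U m"
    using tilt unfolding tilt_stable_def by blast
  define C where "C = C0 + 1"
  have C: "C > 0" using lipschitz_on_nonneg[OF lip0] by (simp add: C_def)
  obtain \<delta>1 where \<delta>1: "\<delta>1 > 0" "cball 0 \<delta>1 \<subseteq> U" using U by (meson open_contains_cball)
  define s where "s = min \<gamma> \<epsilon>"
  have s: "s > 0" using \<gamma> eps by (simp add: s_def)
  \<comment> \<open>This keeps \<open>m v\<close> within \<open>s / 2\<close> of
    \<open>xbar\<close>, hence interior to the region of radius \<open>s\<close> where its
    minimality is used.\<close>
  define \<delta> where "\<delta> = min \<delta>1 (s / (2 * C))"
  have \<delta>: "\<delta> > 0" "C * \<delta> \<le> s / 2" using \<delta>1 C s by (auto simp: \<delta>_def min_def field_simps)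
  have inU: "v \<in> U" if "norm v \<le> \<delta>" for v using that \<delta>1(2) by (auto simp: \<delta>_def)
  have lip: "norm (m v - m v') \<le> C * norm (v - v')" if "norm v \<le> \<delta>" "norm v' \<le> \<delta>" for v v'
  proof -
    have "norm (m v - m v') \<le> C0 * norm (v - v')"
      using lipschitz_onD[OF lip0 inU[OF that(1)] inU[OF that(2)]] by (simp add: dist_norm)
    also have "\<dots> \<le> C * norm (v - v')" by (intro mult_right_mono) (auto simp: C_def)
    finally show ?thesis .
  qed
  have m0: "m 0 = xbar" using arg[OF U(2)] arg0 by simp
  have mnear: "norm (m v - xbar) \<le> s / 2" if "norm v \<le> \<delta>" for v
  proof -
    have "norm (m v - m 0) \<le> C * norm v" using lip[OF that, of 0] \<delta>(1) by simp
    also have "\<dots> \<le> C * \<delta>" using that C by simp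
    finally show ?thesis using \<delta>(2) m0 by simp
  qed
  define D where "D = {y \<in> dom. norm (y - xbar) \<le> s}"
  have D\<gamma>: "y \<in> cball xbar \<gamma>" if "y \<in> D" for y using that by (simp add: D_def s_def dist_norm norm_minus_commute)
  have mD: "m v \<in> D" if v: "norm v \<le> \<delta>" for v
  proof -
    have "m v \<in> tilt_argmin f xbar \<gamma> v" using arg[OF inU[OF v]] by simp
    then have "f (m v) - ereal (v \<bullet> m v) \<le> f xbar - ereal (v \<bullet> xbar)" using \<gamma> by (simp add: tilt_argmin_def)
    then have "f (m v) < \<infinity>" unfolding f_xbar by (cases "f (m v)") auto
    moreover have "norm (m v - xbar) \<le> s" using mnear[OF v] s by linarith
    ultimately show ?thesis by (auto simp: D_def s_def intro: in_domI)
  qed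
  have min: "fr (m v) - v \<bullet> m v \<le> fr y - v \<bullet> y" if v: "norm v \<le> \<delta>" and y: "y \<in> D" for v y
  proof -
    have "m v \<in> tilt_argmin f xbar \<gamma> v" using arg[OF inU[OF v]] by simp
    then have "f (m v) - ereal (v \<bullet> m v) \<le> f y - ereal (v \<bullet> y)" using D\<gamma>[OF y] by (simp add: tilt_argmin_def)
    then show ?thesis using f_dom[of "m v"] f_dom[of y] mD[OF v] y by (simp add: D_def)
  qed
  define c where "c = 1 / (2 * C)"
  have c: "c > 0" using C by (simp add: c_def)
  have subderiv: "ereal (c * (norm u)\<^sup>2) \<le> second_subderiv f (m v) v u" if v: "norm v \<le> \<delta> / 2" for v u
  proof (rule second_subderiv_ge_of_growth[where s = s and d = "C * \<delta>"])
    have v': "norm v \<le> \<delta>" using v \<delta>(1) by linarith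
    show "m v \<in> dom" using mD[OF v'] by (simp add: D_def)
    show "norm (m v - xbar) < s" using mnear[OF v'] s by linarith
    show "s \<le> \<epsilon>" by (simp add: s_def)
    show "0 < C * \<delta>" using C \<delta>(1) by simp
    show "fr (m v) + v \<bullet> (y - m v) + c / 2 * (norm (y - m v))\<^sup>2 \<le> fr y"
      if "y \<in> dom" "norm (y - xbar) \<le> s" "norm (y - m v) \<le> C * \<delta>" for y
      unfolding c_def using that
      by (intro tilt_minimizer_growth[OF C \<delta>(1), where D = D] min mD lip v) (auto simp: D_def)
  qed
  \<comment> \<open>The tilted pair \<open>(m v', v')\<close> with
    \<open>m v' + v' /\<^sub>R \<rho> = x + v /\<^sub>R \<rho>\<close> satisfies
    \<open>v' - v = \<rho> *\<^sub>R (x - m v')\<close>. Adding its minimality to the prox-regular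
    inequality at \<open>x\<close> leaves the squared distance with coefficient
    \<open>\<rho> - r / 2 > 0\<close>, so the pairs agree.\<close>
  have critical: "x = m v" if gph: "v \<in> limiting_subdiff f x" and fx: "f x < ereal (fr xbar + \<epsilon>)"
    and x: "norm (x - xbar) \<le> s / 2" and v: "norm v \<le> \<epsilon> / 2" and z: "2 * \<rho> * norm (x + v /\<^sub>R \<rho> - xbar) < \<delta>" for x v
  proof -
    have xe: "norm (x - xbar) \<le> \<epsilon> / 2" using x by (simp add: s_def)
    note pr = prox_real[OF gph xe v fx]
    obtain v' where v': "norm v' \<le> 2 * \<rho> * norm (x + v /\<^sub>R \<rho> - m 0)" "m v' + v' /\<^sub>R \<rho> = x + v /\<^sub>R \<rho>"
      using tilt_minimizer_resolvent[OF C rho(2) min mD lip, where z = "x + v /\<^sub>R \<rho>"] z m0 by auto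
    have nv': "norm v' \<le> \<delta>" using v'(1) z m0 by simp
    have "x \<in> D" using pr(1) x s by (simp add: D_def)
    from min[OF nv' this] have 1: "fr (m v') - v' \<bullet> m v' \<le> fr x - v' \<bullet> x" .
    have 2: "fr x + v \<bullet> (m v' - x) - r / 2 * (norm (m v' - x))\<^sup>2 \<le> fr (m v')"
      using pr(2) mD[OF nv'] by (simp add: D_def)
    have "v' - v = \<rho> *\<^sub>R (x - m v')"
    proof -
      have "\<rho> *\<^sub>R (m v' + v' /\<^sub>R \<rho>) = \<rho> *\<^sub>R (x + v /\<^sub>R \<rho>)" using v'(2) by simp
      then show ?thesis using rho by (simp add: algebra_simps)
    qed
    then have "(v' - v) \<bullet> (x - m v') = \<rho> * (norm (x - m v'))\<^sup>2" by (simp add: power2_norm_eq_inner)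
    moreover have "(v' - v) \<bullet> (x - m v') \<le> r / 2 * (norm (x - m v'))\<^sup>2"
      using 1 2 by (simp add: inner_diff norm_minus_commute)
    ultimately have "(r / 2 + 1) * (norm (x - m v'))\<^sup>2 \<le> 0" by (simp add: \<rho>_def algebra_simps)
    then have xm: "x = m v'" using r0 by (simp add: mult_le_0_iff)
    then have "v' = v" using \<open>v' - v = \<rho> *\<^sub>R (x - m v')\<close> by simp
    then show ?thesis using xm by simp
  qed
  from q obtain xs vs where gq: "GQF q" and g: "\<And>k. (xs k, vs k) \<in> gph_subdiff f" and lim: "(\<lambda>k. (xs k, vs k)) \<longlonglongrightarrow> (xbar, 0)"
    and ep: "epi_converges (\<lambda>k. second_subderiv f (xs k) (vs k)) q"
    unfolding quad_bundle_def by blast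
  have xl: "xs \<longlonglongrightarrow> xbar" and vl: "vs \<longlonglongrightarrow> 0" using tendsto_fst[OF lim] tendsto_snd[OF lim] by auto
  have gl: "vs k \<in> limiting_subdiff f (xs k)" for k using g by (simp add: gph_subdiff_def)
  \<comment> \<open>Convergence of the function values places the pairs of the sequence in the
    regime \<open>f x < f xbar + \<epsilon>\<close>, where the prox-regular inequality
    applies.\<close>
  have fl: "(\<lambda>k. f (xs k)) \<longlonglongrightarrow> ereal (fr xbar)"
    using sdc xl vl gl unfolding subdiff_continuous_def f_xbar[symmetric] by blast
  have e1: "\<forall>\<^sub>F k in sequentially. f (xs k) < ereal (fr xbar + \<epsilon>)"
    by (rule order_tendstoD(2)[OF fl]) (use eps in simp)
  have "(\<lambda>k. norm (xs k - xbar)) \<longlonglongrightarrow> norm (xbar - xbar)" by (intro tendsto_intros xl)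
  then have e2: "\<forall>\<^sub>F k in sequentially. norm (xs k - xbar) < s / 2"
    by (rule order_tendstoD(2)) (use s in simp)
  have vn: "(\<lambda>k. norm (vs k)) \<longlonglongrightarrow> norm (0::'a)" by (intro tendsto_intros vl)
  have e3: "\<forall>\<^sub>F k in sequentially. norm (vs k) < min (\<epsilon> / 2) (\<delta> / 2)"
    by (rule order_tendstoD(2)[OF vn]) (use eps \<delta> in simp)
  have "(\<lambda>k. 2 * \<rho> * norm (xs k + vs k /\<^sub>R \<rho> - xbar)) \<longlonglongrightarrow> 2 * \<rho> * norm (xbar + 0 /\<^sub>R \<rho> - xbar)" by (intro tendsto_intros xl vl)
  then have e4: "\<forall>\<^sub>F k in sequentially. 2 * \<rho> * norm (xs k + vs k /\<^sub>R \<rho> - xbar) < \<delta>"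
    by (rule order_tendstoD(2)) (use \<delta> in simp)
  from e1 e2 e3 e4 have low: "\<forall>\<^sub>F k in sequentially. \<forall>u. ereal (c * (norm u)\<^sup>2) \<le> second_subderiv f (xs k) (vs k) u"
  proof eventually_elim
    case (elim k)
    then have "xs k = m (vs k)" by (intro critical[OF gl]) auto
    then show ?case using subderiv[of "vs k"] elim by simp
  qed
  show ?thesis
  proof (cases "q w")
    case (real \<alpha>)
    then have "(w, \<alpha>) \<in> epi q" by (simp add: epi_def)
    \<comment> \<open>Membership in the inner limit supplies points of the approximating epigraphs
      at almost every index, where the uniform bound is available.\<close>
    also have "epi q = inner_limit (\<lambda>k. epi (second_subderiv f (xs k) (vs k)))"
      using ep by (simp add: epi_converges_def PK_converges_def)
    finally obtain zs where zs: "zs \<longlonglongrightarrow> (w, \<alpha>)" "\<forall>\<^sub>F k in sequentially. zs k \<in> epi (second_subderiv f (xs k) (vs k))"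
      by (auto simp: inner_limit_def)
    have "\<forall>\<^sub>F k in sequentially. c * (norm (fst (zs k)))\<^sup>2 \<le> snd (zs k)"
      using low zs(2)
    proof eventually_elim
      case (elim k)
      have "ereal (c * (norm (fst (zs k)))\<^sup>2) \<le> second_subderiv f (xs k) (vs k) (fst (zs k))"
        using elim(1) by blast
      also have "\<dots> \<le> ereal (snd (zs k))" using elim(2) by (auto simp: epi_def case_prod_beta)
      finally have "ereal (c * (norm (fst (zs k)))\<^sup>2) \<le> ereal (snd (zs k))" .
      then show ?case by simp
    qed
    moreover have "(\<lambda>k. c * (norm (fst (zs k)))\<^sup>2) \<longlonglongrightarrow> c * (norm w)\<^sup>2"
      using tendsto_fst[OF zs(1)] by (auto intro!: tendsto_intros)
    moreover have "(\<lambda>k. snd (zs k)) \<longlonglongrightarrow> \<alpha>" using tendsto_snd[OF zs(1)] by simp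
    ultimately have "c * (norm w)\<^sup>2 \<le> \<alpha>" by (intro tendsto_le[OF sequentially_bot])
    moreover have "0 < c * (norm w)\<^sup>2" using c w by simp
    ultimately show ?thesis using real by simp
  qed (use gq in \<open>auto simp: GQF_def proper_def\<close>)
qed

end

lemma prox_regular_imp_local:
  assumes "prox_regular f xbar 0"
  obtains \<epsilon> r where "local_prox_regular f xbar \<epsilon> r"
proof -
  from assms have fin: "\<bar>f xbar\<bar> \<noteq> \<infinity>" and l: "locally_lsc_at f xbar" and z: "0 \<in> limiting_subdiff f xbar"
    by (auto simp: prox_regular_def)
  obtain \<epsilon>1 r where e1: "\<epsilon>1 > 0" "r \<ge> 0" and pr: "\<And>x v x'. (x, v) \<in> gph_subdiff f \<Longrightarrow> (x, v) \<in> cball (xbar, 0) \<epsilon>1 \<Longrightarrow>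
      f x < f xbar + ereal \<epsilon>1 \<Longrightarrow> x' \<in> cball xbar \<epsilon>1 \<Longrightarrow>
      f x' \<ge> f x + ereal (v \<bullet> (x' - x)) - ereal (r / 2 * (norm (x' - x))\<^sup>2)"
    using assms unfolding prox_regular_def by blast
  obtain \<epsilon>2 where e2: "\<epsilon>2 > 0" and cl: "\<And>\<alpha>. ereal \<alpha> \<le> f xbar + ereal \<epsilon>2 \<Longrightarrow> closed {y \<in> cball xbar \<epsilon>2. f y \<le> ereal \<alpha>}"
    using l unfolding locally_lsc_at_def by blast
  define \<epsilon> where "\<epsilon> = min \<epsilon>1 \<epsilon>2"
  have e: "\<epsilon> > 0" "\<epsilon> \<le> \<epsilon>1" "\<epsilon> \<le> \<epsilon>2" using e1 e2 by (auto simp: \<epsilon>_def)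
  have mono: "f xbar + ereal \<epsilon> \<le> f xbar + ereal \<epsilon>1" "f xbar + ereal \<epsilon> \<le> f xbar + ereal \<epsilon>2"
    using e by (auto intro: add_left_mono)
  have "local_prox_regular f xbar \<epsilon> r"
  proof
    fix \<alpha> assume "ereal \<alpha> \<le> f xbar + ereal \<epsilon>"
    then have "closed {y \<in> cball xbar \<epsilon>2. f y \<le> ereal \<alpha>}" using mono(2) by (intro cl) (rule order_trans)
    then have "closed (cball xbar \<epsilon> \<inter> {y \<in> cball xbar \<epsilon>2. f y \<le> ereal \<alpha>})" by (intro closed_Int closed_cball)
    moreover have "cball xbar \<epsilon> \<inter> {y \<in> cball xbar \<epsilon>2. f y \<le> ereal \<alpha>} = {y \<in> cball xbar \<epsilon>. f y \<le> ereal \<alpha>}"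
      using e by auto
    ultimately show "closed {y \<in> cball xbar \<epsilon>. f y \<le> ereal \<alpha>}" by simp
  next
    fix x v x' assume v: "v \<in> limiting_subdiff f x" and n: "norm (x - xbar) \<le> \<epsilon> / 2" "norm v \<le> \<epsilon> / 2"
      and fx: "f x < f xbar + ereal \<epsilon>" and x': "x' \<in> cball xbar \<epsilon>"
    have "dist (xbar, 0) (x, v) \<le> dist xbar x + dist 0 v"
      unfolding dist_Pair_Pair by (rule sqrt_sum_squares_le_sum) auto
    also have "\<dots> \<le> \<epsilon>1" using n e by (simp add: dist_norm norm_minus_commute)
    finally show "f x + ereal (v \<bullet> (x' - x)) - ereal (r / 2 * (norm (x' - x))\<^sup>2) \<le> f x'"
      using v fx mono(1) x' e by (intro pr) (auto simp: gph_subdiff_def)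
  qed (use fin z e e1 in auto)
  then show thesis by (rule that)
qed

theorem theorem3p10:
  fixes f :: "'a::euclidean_space \<Rightarrow> ereal" and xbar vbar :: 'a
  assumes "vbar = 0"
    and "prox_regular f xbar vbar"
    and "subdiff_continuous f xbar vbar"
  shows "tilt_stable f xbar \<longleftrightarrow>
    (\<forall>w. w \<noteq> 0 \<longrightarrow> (\<forall>q \<in> quad_bundle f xbar vbar. q w > 0))"
proof -
  obtain \<epsilon> r where "local_prox_regular f xbar \<epsilon> r"
    using prox_regular_imp_local assms(1,2) by blast
  then interpret local_prox_regular f xbar \<epsilon> r .
  show ?thesis
    using quad_bundle_pos_if_tilt_stable tilt_stable_if_quad_bundle_pos assms(1,3) by blast
qed

end
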